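(* Let $K$ be a totally real number field of narrow class number $1$, let $\mathcal A$ be a definite quaternion algebra over $K$ of discriminant $\mathfrak D$, and let $\mathcal H$ be a maximal $\mathcal O_K$-order in $\mathcal A$ of class number $1$. Then for every totally positive $\alpha\in\mathcal O_K$, $$r_{\mathcal H}(\alpha)=\#\mathcal H^1\cdot\sigma_{\mathfrak D}(\alpha).$$
   Context: $\mathcal O_K$ is the ring of integers of $K$; narrow class number $1$ means $\mathcal O_K$ is a PID and every totally positive unit is a square of a unit. Definite quaternion algebra: $\mathcal A\otimes_{K,\sigma}\mathbb R$ is Hamilton's quaternions for each real embedding $\sigma$; $\operatorname{nrd}$ is its reduced norm. The discriminant $\mathfrak D$ of $\mathcal A$ is the product of the finite primes $\mathfrak p$ of $\mathcal O_K$ at which $\mathcal A\otimes K_{\mathfrak p}$ is a division algebra. An order is a finitely generated $\mathcal O_K$-submodule spanning $\mathcal A$ that is a subring with $1$. $\mathcal H^1=\{\mathbf u\in\mathcal H:\operatorname{nrd}\mathbf u=1\}$. Class number of $\mathcal H$: number of classes of lattices $L$ with right order $\mathcal H$ modulo $L\sim\mathbf xL$, $\mathbf x\in\mathcal A^\times$. For an order $\mathcal G$, $r_{\mathcal G}(\alpha)=\#\{\mathbf q\in\mathcal G:\operatorname{nrd}(\mathbf q)=\alpha\}$. For an ideal $\mathfrak E=\mathfrak p_1\cdots\mathfrak p_r$ of $\mathcal O_K$ (prime factorization) and $\alpha\in\mathcal O_K$, $\sigma_{\mathfrak E}(\alpha)=\sum\operatorname{Nm}(\delta\mathcal O_K)$,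 the sum over all (principal) ideals $\delta\mathcal O_K$ dividing $\alpha\mathcal O_K$ and divisible by none of $\mathfrak p_1,\dots,\mathfrak p_r$; $\operatorname{Nm}$ is the absolute ideal norm. *)

theory Defs
  imports
    Complex_Main
    "HOL-Algebra.Ring_Divisibility"
    "HOL-Algebra.Ideal_Product"
    "HOL-Algebra.Algebraic_Closure_Type"
begin

section \<open>Number fields\<close>

definition number_field :: "'k::field_char_0 itself \<Rightarrow> bool" where
  "number_field _ \<longleftrightarrow>
     (\<exists>B. finite_dimensional_vector_space (\<lambda>r (x::'k). of_rat r * x) B)"

definition totally_real :: "'k::field_char_0 itself \<Rightarrow> bool" where
  "totally_real _ \<longleftrightarrow>
     (\<forall>\<sigma> \<in> ring_hom (ring_of_type_algebra :: 'k ring) (ring_of_type_algebra :: complex ring).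
        \<forall>x. \<sigma> x \<in> \<real>)"

definition real_embeddings :: "('k::field_char_0 \<Rightarrow> real) set" where
  "real_embeddings = ring_hom ring_of_type_algebra ring_of_type_algebra"

definition totally_positive :: "'k::field_char_0 \<Rightarrow> bool" where
  "totally_positive x \<longleftrightarrow> (\<forall>\<sigma> \<in> real_embeddings. \<sigma> x > 0)"

definition ring_of_integers :: "'k::field_char_0 ring" where
  "ring_of_integers = ring_of_type_algebra \<lparr>carrier := {x. algebraic_int x}\<rparr>"

definition narrow_class_number_one :: "'k::field_char_0 itself \<Rightarrow> bool" where
  "narrow_class_number_one _ \<longleftrightarrow>
     principal_domain (ring_of_integers :: 'k ring) \<and>
     (\<forall>u \<in> Units (ring_of_integers :: 'k ring).
        totally_positive u \<longrightarrow> (\<exists>v \<in> Units ring_of_integers. u = v ^ 2))"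

definition finite_prime :: "'k::field_char_0 set \<Rightarrow> bool" where
  "finite_prime P \<longleftrightarrow> primeideal P ring_of_integers \<and> P \<noteq> {0}"

definition ideal_norm :: "'k::field_char_0 set \<Rightarrow> nat" where
  "ideal_norm I = Coset.order (ring_of_integers Quot I)"


section \<open>Completion at a finite prime\<close>

text \<open>
  \<open>prime_nbhd P n\<close> is \<open>{x. v\<^sub>P(x) \<ge> n}\<close>, written as the extension of \<open>P\<^sup>n\<close> to the localisation
  of the ring of integers at \<open>P\<close>. These sets are a basis of neighbourhoods of 0 for the \<open>P\<close>-adic
  topology on \<open>K\<close>; the completion is the ring of \<open>P\<close>-adic Cauchy sequences modulo the ideal of
  null sequences.
\<close>

definition prime_nbhd :: "'k::field_char_0 set \<Rightarrow> nat \<Rightarrow> 'k set" where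
  "prime_nbhd P n =
     {y / z | y z. y \<in> P [^]\<^bsub>ideals_set ring_of_integers\<^esub> n \<and> z \<in> carrier ring_of_integers - P}"

definition cauchy_seqs :: "'k::field_char_0 set \<Rightarrow> (nat \<Rightarrow> 'k) set" where
  "cauchy_seqs P = {s. \<forall>n. \<exists>N. \<forall>k\<ge>N. \<forall>l\<ge>N. s k - s l \<in> prime_nbhd P n}"

definition null_seqs :: "'k::field_char_0 set \<Rightarrow> (nat \<Rightarrow> 'k) set" where
  "null_seqs P = {s. \<forall>n. \<exists>N. \<forall>k\<ge>N. s k \<in> prime_nbhd P n}"

definition cauchy_ring :: "'k::field_char_0 set \<Rightarrow> (nat \<Rightarrow> 'k) ring" where
  "cauchy_ring P = \<lparr>
     carrier = cauchy_seqs P,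
     monoid.mult = (\<lambda>s t k. s k * t k),
     one = (\<lambda>_. 1),
     ring.zero = (\<lambda>_. 0),
     add = (\<lambda>s t k. s k + t k)\<rparr>"

definition completion :: "'k::field_char_0 set \<Rightarrow> (nat \<Rightarrow> 'k) set ring" where
  "completion P = cauchy_ring P Quot null_seqs P"

definition completion_embedding :: "'k::field_char_0 set \<Rightarrow> 'k \<Rightarrow> (nat \<Rightarrow> 'k) set" where
  "completion_embedding P x = null_seqs P +>\<^bsub>cauchy_ring P\<^esub> (\<lambda>_. x)"


section \<open>Quaternion algebras\<close>

text \<open>
  \<open>quat_ring L a b\<close> is the quaternion algebra \<open>(a, b | L)\<close>: the free \<open>L\<close>-module on
  \<open>1, i, j, k = ij\<close> with \<open>i\<^sup>2 = a\<close>, \<open>j\<^sup>2 = b\<close>, \<open>ji = -ij\<close>.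
\<close>

definition quat_ring ::
    "('l, 'm) ring_scheme \<Rightarrow> 'l \<Rightarrow> 'l \<Rightarrow> ('l \<times> 'l \<times> 'l \<times> 'l) ring" where
  "quat_ring L a b = \<lparr>
     carrier = carrier L \<times> carrier L \<times> carrier L \<times> carrier L,
     monoid.mult = (\<lambda>(t1, x1, y1, z1) (t2, x2, y2, z2).
       ((t1 \<otimes>\<^bsub>L\<^esub> t2 \<oplus>\<^bsub>L\<^esub> a \<otimes>\<^bsub>L\<^esub> (x1 \<otimes>\<^bsub>L\<^esub> x2)) \<oplus>\<^bsub>L\<^esub> b \<otimes>\<^bsub>L\<^esub> (y1 \<otimes>\<^bsub>L\<^esub> y2)
            \<ominus>\<^bsub>L\<^esub> (a \<otimes>\<^bsub>L\<^esub> b) \<otimes>\<^bsub>L\<^esub> (z1 \<otimes>\<^bsub>L\<^esub> z2),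
        (t1 \<otimes>\<^bsub>L\<^esub> x2 \<oplus>\<^bsub>L\<^esub> x1 \<otimes>\<^bsub>L\<^esub> t2) \<oplus>\<^bsub>L\<^esub> b \<otimes>\<^bsub>L\<^esub> (z1 \<otimes>\<^bsub>L\<^esub> y2 \<ominus>\<^bsub>L\<^esub> y1 \<otimes>\<^bsub>L\<^esub> z2),
        (t1 \<otimes>\<^bsub>L\<^esub> y2 \<oplus>\<^bsub>L\<^esub> y1 \<otimes>\<^bsub>L\<^esub> t2) \<oplus>\<^bsub>L\<^esub> a \<otimes>\<^bsub>L\<^esub> (x1 \<otimes>\<^bsub>L\<^esub> z2 \<ominus>\<^bsub>L\<^esub> z1 \<otimes>\<^bsub>L\<^esub> x2),
        (t1 \<otimes>\<^bsub>L\<^esub> z2 \<oplus>\<^bsub>L\<^esub> z1 \<otimes>\<^bsub>L\<^esub> t2) \<oplus>\<^bsub>L\<^esub> (x1 \<otimes>\<^bsub>L\<^esub> y2 \<ominus>\<^bsub>L\<^esub> y1 \<otimes>\<^bsub>L\<^esub> x2))),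
     one = (\<one>\<^bsub>L\<^esub>, \<zero>\<^bsub>L\<^esub>, \<zero>\<^bsub>L\<^esub>, \<zero>\<^bsub>L\<^esub>),
     ring.zero = (\<zero>\<^bsub>L\<^esub>, \<zero>\<^bsub>L\<^esub>, \<zero>\<^bsub>L\<^esub>, \<zero>\<^bsub>L\<^esub>),
     add = (\<lambda>(t1, x1, y1, z1) (t2, x2, y2, z2).
       (t1 \<oplus>\<^bsub>L\<^esub> t2, x1 \<oplus>\<^bsub>L\<^esub> x2, y1 \<oplus>\<^bsub>L\<^esub> y2, z1 \<oplus>\<^bsub>L\<^esub> z2))\<rparr>"

definition quat_of :: "('k \<Rightarrow> 'q::ring_1) \<Rightarrow> 'q \<Rightarrow> 'q \<Rightarrow> 'k \<times> 'k \<times> 'k \<times> 'k \<Rightarrow> 'q" where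
  "quat_of \<iota> i j = (\<lambda>(t, x, y, z). \<iota> t + \<iota> x * i + \<iota> y * j + \<iota> z * (i * j))"

text \<open>
  The ring \<open>'q\<close>, made into a \<open>K\<close>-algebra by \<open>\<iota>\<close>, is a quaternion algebra over \<open>K\<close>, and \<open>i\<close>, \<open>j\<close>
  are generators exhibiting it as \<open>(a, b | K)\<close>. (The characteristic is 0, so every quaternion
  algebra has such generators.)
\<close>

definition quaternion_algebra ::
    "('k::field_char_0 \<Rightarrow> 'q::ring_1) \<Rightarrow> 'k \<Rightarrow> 'k \<Rightarrow> 'q \<Rightarrow> 'q \<Rightarrow> bool" where
  "quaternion_algebra \<iota> a b i j \<longleftrightarrow>
     \<iota> \<in> ring_hom ring_of_type_algebra ring_of_type_algebra \<and>
     (\<forall>c q. \<iota> c * q = q * \<iota> c) \<and>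
     a \<noteq> 0 \<and> b \<noteq> 0 \<and> i * i = \<iota> a \<and> j * j = \<iota> b \<and> j * i = - (i * j) \<and>
     bij (quat_of \<iota> i j)"

text \<open>
  The reduced norm is \<open>q * conj q\<close> with \<open>conj (t + x i + y j + z k) = t - x i - y j - z k\<close>,
  an element of the image of \<open>K\<close>.
\<close>

definition nrd :: "('k::field_char_0 \<Rightarrow> 'q::ring_1) \<Rightarrow> 'q \<Rightarrow> 'q \<Rightarrow> 'q \<Rightarrow> 'k" where
  "nrd \<iota> i j q = (THE n. \<exists>t x y z. q = quat_of \<iota> i j (t, x, y, z) \<and>
                    \<iota> n = q * quat_of \<iota> i j (t, - x, - y, - z))"

text \<open>
  For \<open>A = (a, b | K)\<close> and a field homomorphism \<open>\<phi> : K \<rightarrow> L\<close>, extending scalars keeps the basis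
  \<open>1, i, j, ij\<close> and its multiplication table: \<open>A \<otimes> L = (\<phi> a, \<phi> b | L)\<close>.
\<close>

definition base_change ::
    "('l, 'm) ring_scheme \<Rightarrow> ('k \<Rightarrow> 'l) \<Rightarrow> 'k \<Rightarrow> 'k \<Rightarrow> ('l \<times> 'l \<times> 'l \<times> 'l) ring" where
  "base_change L \<phi> a b = quat_ring L (\<phi> a) (\<phi> b)"

definition hamilton_quaternions :: "(real \<times> real \<times> real \<times> real) ring" where
  "hamilton_quaternions = quat_ring ring_of_type_algebra (- 1) (- 1)"

text \<open>The second conjunct makes the isomorphism one of real algebras.\<close>

definition definite :: "'k::field_char_0 \<Rightarrow> 'k \<Rightarrow> bool" where
  "definite a b \<longleftrightarrow>
     (\<forall>\<sigma> \<in> real_embeddings.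
        \<exists>h \<in> ring_iso (base_change ring_of_type_algebra \<sigma> a b) hamilton_quaternions.
          \<forall>c. h (c, 0, 0, 0) = (c, 0, 0, 0))"

definition division_ring :: "('l, 'm) ring_scheme \<Rightarrow> bool" where
  "division_ring D \<longleftrightarrow> ring D \<and> Units D = carrier D - {\<zero>\<^bsub>D\<^esub>}"

definition ramified_primes :: "'k::field_char_0 \<Rightarrow> 'k \<Rightarrow> 'k set set" where
  "ramified_primes a b =
     {P. finite_prime P \<and> division_ring (base_change (completion P) (completion_embedding P) a b)}"

definition discriminant :: "'k::field_char_0 \<Rightarrow> 'k \<Rightarrow> 'k set" where
  "discriminant a b = (\<Otimes>\<^bsub>ideals_set ring_of_integers\<^esub> P \<in> ramified_primes a b. P)"


section \<open>Lattices and orders\<close>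

definition full_lattice :: "('k::field_char_0 \<Rightarrow> 'q::ring_1) \<Rightarrow> 'q set \<Rightarrow> bool" where
  "full_lattice \<iota> L \<longleftrightarrow>
     (\<exists>S. finite S \<and> L = {\<Sum>s\<in>S. \<iota> (c s) * s | c. \<forall>s\<in>S. c s \<in> carrier ring_of_integers}) \<and>
     module.span (\<lambda>c q. \<iota> c * q) L = UNIV"

definition quat_order :: "('k::field_char_0 \<Rightarrow> 'q::ring_1) \<Rightarrow> 'q set \<Rightarrow> bool" where
  "quat_order \<iota> G \<longleftrightarrow> full_lattice \<iota> G \<and> 1 \<in> G \<and> (\<forall>x\<in>G. \<forall>y\<in>G. x * y \<in> G)"

definition maximal_order :: "('k::field_char_0 \<Rightarrow> 'q::ring_1) \<Rightarrow> 'q set \<Rightarrow> bool" where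
  "maximal_order \<iota> H \<longleftrightarrow> quat_order \<iota> H \<and> (\<forall>G. quat_order \<iota> G \<and> H \<subseteq> G \<longrightarrow> G = H)"

definition right_order :: "'q::ring_1 set \<Rightarrow> 'q set" where
  "right_order L = {x. \<forall>l\<in>L. l * x \<in> L}"

definition lattices_with_right_order ::
    "('k::field_char_0 \<Rightarrow> 'q::ring_1) \<Rightarrow> 'q set \<Rightarrow> 'q set set" where
  "lattices_with_right_order \<iota> H = {L. full_lattice \<iota> L \<and> right_order L = H}"

definition lattice_equiv :: "('k::field_char_0 \<Rightarrow> 'q::ring_1) \<Rightarrow> 'q set \<Rightarrow> 'q set rel" where
  "lattice_equiv \<iota> H =
     {(L, M). L \<in> lattices_with_right_order \<iota> H \<and> M \<in> lattices_with_right_order \<iota> H \<and>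
        (\<exists>x \<in> Units (ring_of_type_algebra :: 'q ring). M = (\<lambda>l. x * l) ` L)}"

definition class_number :: "('k::field_char_0 \<Rightarrow> 'q::ring_1) \<Rightarrow> 'q set \<Rightarrow> nat" where
  "class_number \<iota> H = card (lattices_with_right_order \<iota> H // lattice_equiv \<iota> H)"

definition norm_one_elements ::
    "('k::field_char_0 \<Rightarrow> 'q::ring_1) \<Rightarrow> 'q \<Rightarrow> 'q \<Rightarrow> 'q set \<Rightarrow> 'q set" where
  "norm_one_elements \<iota> i j H = {u \<in> H. nrd \<iota> i j u = 1}"

definition repr_number ::
    "('k::field_char_0 \<Rightarrow> 'q::ring_1) \<Rightarrow> 'q \<Rightarrow> 'q \<Rightarrow> 'q set \<Rightarrow> 'k \<Rightarrow> nat" where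
  "repr_number \<iota> i j G \<alpha> = card {q \<in> G. nrd \<iota> i j q = \<alpha>}"


section \<open>The divisor sum\<close>

text \<open>The primes occurring in the factorization of \<open>E\<close> are the finite primes dividing \<open>E\<close>.\<close>

definition divisor_sum :: "'k::field_char_0 set \<Rightarrow> 'k \<Rightarrow> nat" where
  "divisor_sum E \<alpha> =
     (\<Sum>I \<in> {I. (\<exists>\<delta> \<in> carrier ring_of_integers. I = PIdl\<^bsub>ring_of_integers\<^esub> \<delta>) \<and>
                I divides\<^bsub>ideals_set ring_of_integers\<^esub> (PIdl\<^bsub>ring_of_integers\<^esub> \<alpha>) \<and>
                (\<forall>P. finite_prime P \<and> P divides\<^bsub>ideals_set ring_of_integers\<^esub> E \<longrightarrow>
                     \<not> P divides\<^bsub>ideals_set ring_of_integers\<^esub> I)}. ideal_norm I)"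

end

theory Submission
  imports Defs
begin

text \<open>
  Since the class number is 1, every right ideal of the order \<open>H\<close> is principal, and the elements of
  norm \<open>\<alpha>\<close> are, up to the free action of \<open>H\<^sup>1\<close>, the right ideals of norm \<open>\<alpha>\<close>: a generator can be
  rescaled to have norm exactly \<open>\<alpha>\<close> because norms are totally positive and totally positive units are
  squares. Let \<open>n(\<alpha>)\<close> be the number of these ideals. Counting pairs of an ideal of norm \<open>p \<alpha>\<close> and an
  ideal of norm \<open>p\<close> containing it gives \<open>n(p \<alpha>) = m n(\<alpha>) - (m - 1) n(\<alpha> / p)\<close>, where \<open>m\<close> is the number
  of ideals of norm \<open>p\<close>; the divisor sum satisfies the same recursion with \<open>m = 1\<close> if \<open>p\<close> divides the
  discriminant and \<open>m = Nm p + 1\<close> otherwise.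

  Modulo \<open>p\<close> the norm form is isotropic, so \<open>m \<ge> 1\<close>. If there are two ideals of norm \<open>p\<close>, then 1 is the
  sum of an element of each, which gives an idempotent \<open>e\<close> of \<open>H / p H\<close>; the ideals other than
  \<open>(1 - e) H + p H\<close> correspond to the elements of \<open>(1 - e) H e\<close> modulo \<open>p\<close>, which is a line over the
  residue field. By Hensel's lemma \<open>e\<close> then yields zero divisors in the completion. If \<open>m = 1\<close>, then
  \<open>p\<^sup>2\<^sup>n\<close> divides \<open>N z\<close> only if \<open>p\<^sup>n\<close> divides \<open>z\<close>, so the norm has no nontrivial zero in the completion.
\<close>

section \<open>Principal ideal domains inside their fraction field\<close>

text \<open>Two obstacles shape the proof. First, nothing is known beforehand about
  \<open>H / p H\<close>, not even its dimension. Dimension arguments are replaced by one fact: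
  \<open>H / p H\<close> is not spanned by 1 and a single further element, since otherwise a nonzero
  commutator of \<open>H\<close> would be divisible by all powers of \<open>p\<close>. From this
  come both the independent elements that make the norm form isotropic and the nonvanishing of the
  corner \<open>(1 - e) H e\<close>. Second, a prime met in a factorization need not be totally
  positive, while the recursion needs a prime that is a norm. It is traded for the norm of a
  generator of a right ideal above it, an associate that is totally positive because the algebra is
  definite; so isotropy modulo every prime has to come first. Ramification is defined by counting
  right ideals; the completions serve only to identify these primes with those dividing the
  discriminant. The ring of integers is a subset of its field and divisibility a relation on the
  whole field, so that \<open>\<alpha> / p\<close> may be written down when it is not integral; both
  counts then vanish by themselves.\<close>

locale pid_in_field =
  fixes R :: "'k::field_char_0 set"
  assumes one_mem [simp, intro]: "1 \<in> R"
    and add_mem [simp, intro]: "\<lbrakk>x \<in> R; y \<in> R\<rbrakk> \<Longrightarrow> x + y \<in> R"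
    and uminus_mem [simp, intro]: "x \<in> R \<Longrightarrow> - x \<in> R"
    and mult_mem [simp, intro]: "\<lbrakk>x \<in> R; y \<in> R\<rbrakk> \<Longrightarrow> x * y \<in> R"
    and principal: "\<lbrakk>I \<subseteq> R; 0 \<in> I; \<And>x y. x \<in> I \<Longrightarrow> y \<in> I \<Longrightarrow> x + y \<in> I;
                      \<And>c x. c \<in> R \<Longrightarrow> x \<in> I \<Longrightarrow> c * x \<in> I\<rbrakk> \<Longrightarrow> \<exists>d\<in>R. I = (*) d ` R"
    and fraction: "\<exists>d\<in>R. d \<noteq> 0 \<and> d * x \<in> R"
begin

lemma zero_mem [simp, intro]: "0 \<in> R"
  using add_mem[OF one_mem uminus_mem[OF one_mem]] by simp

lemma diff_mem [simp, intro]: "\<lbrakk>x \<in> R; y \<in> R\<rbrakk> \<Longrightarrow> x - y \<in> R"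
  using add_mem[OF _ uminus_mem, of x y] by simp

lemma power_mem [simp, intro]: "x \<in> R \<Longrightarrow> x ^ n \<in> R"
  by (induction n) auto

lemma of_nat_mem [simp, intro]: "of_nat n \<in> R"
  by (induction n) auto

lemma of_int_mem [simp, intro]: "of_int n \<in> R"
  by (cases n rule: int_cases2) auto

lemma numeral_mem [simp, intro]: "numeral n \<in> R"
  using of_nat_mem[of "numeral n"] by simp

lemma sum_mem [intro]: "(\<And>x. x \<in> A \<Longrightarrow> f x \<in> R) \<Longrightarrow> sum f A \<in> R"
  by (induction A rule: infinite_finite_induct) auto

definition dv :: "'k \<Rightarrow> 'k \<Rightarrow> bool" (infix \<open>\<preceq>\<close> 50) where
  "x \<preceq> y \<longleftrightarrow> (\<exists>c\<in>R. y = x * c)"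

lemma dvI [intro?]: "c \<in> R \<Longrightarrow> y = x * c \<Longrightarrow> x \<preceq> y"
  unfolding dv_def by blast

lemma dv_refl [simp]: "x \<preceq> x"
  by (rule dvI[of 1]) auto

lemma dv_0 [simp]: "x \<preceq> 0"
  by (rule dvI[of 0]) auto

lemma dv_trans [trans]: "x \<preceq> y \<Longrightarrow> y \<preceq> z \<Longrightarrow> x \<preceq> z"
  unfolding dv_def by (metis mult.assoc mult_mem)

lemma dv_add: "x \<preceq> y \<Longrightarrow> x \<preceq> z \<Longrightarrow> x \<preceq> y + z"
  unfolding dv_def by (metis add_mem distrib_left)

lemma dv_uminus: "x \<preceq> y \<Longrightarrow> x \<preceq> - y"
  unfolding dv_def by (metis uminus_mem mult_minus_right)

lemma dv_diff: "x \<preceq> y \<Longrightarrow> x \<preceq> z \<Longrightarrow> x \<preceq> y - z"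
  unfolding dv_def by (metis diff_mem right_diff_distrib)

lemma dv_add_iff: "x \<preceq> y \<Longrightarrow> x \<preceq> y + z \<longleftrightarrow> x \<preceq> z"
  using dv_add dv_diff[of x "y + z" y] by auto

lemma dv_mult: "x \<preceq> y \<Longrightarrow> c \<in> R \<Longrightarrow> x \<preceq> c * y"
  unfolding dv_def by (metis mult.left_commute mult_mem)

lemma dv_mult2: "x \<preceq> y \<Longrightarrow> c \<in> R \<Longrightarrow> x \<preceq> y * c"
  using dv_mult[of x y c] by (simp add: mult.commute)

lemma dv_triv [simp]: "c \<in> R \<Longrightarrow> x \<preceq> c * x" "c \<in> R \<Longrightarrow> x \<preceq> x * c"
  by (simp_all add: dv_mult dv_mult2)

lemma dv_mult_cancel: "c \<noteq> 0 \<Longrightarrow> c * x \<preceq> c * y \<longleftrightarrow> x \<preceq> y"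
  unfolding dv_def by (simp add: mult.assoc)

lemma dv_mult_mono: "x \<preceq> y \<Longrightarrow> c * x \<preceq> c * y"
  unfolding dv_def by (auto simp: mult.assoc)

lemma dv_one: "1 \<preceq> x \<longleftrightarrow> x \<in> R"
  unfolding dv_def by auto

lemma dv_mem: "x \<preceq> y \<Longrightarrow> x \<in> R \<Longrightarrow> y \<in> R"
  unfolding dv_def by auto

lemma dv_antisym:
  assumes "x \<preceq> y" "y \<preceq> x" "x \<noteq> 0"
  obtains u where "u \<in> R" "u \<preceq> 1" "y = x * u"
proof -
  obtain u where u: "u \<in> R" "y = x * u" using assms(1) by (auto simp: dv_def)
  obtain v where v: "v \<in> R" "x = y * v" using assms(2) by (auto simp: dv_def)
  have "x * (u * v) = x * 1" using u(2) v(2) by (metis mult.assoc mult.right_neutral)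
  hence "u * v = 1" using assms(3) by (metis mult_left_cancel)
  hence "u \<preceq> 1" using dvI[OF v(1), of 1 u] by simp
  thus ?thesis using that u by blast
qed

definition prm :: "'k \<Rightarrow> bool" where
  "prm p \<longleftrightarrow> p \<in> R \<and> p \<noteq> 0 \<and> \<not> p \<preceq> 1 \<and> (\<forall>x\<in>R. \<forall>y\<in>R. p \<preceq> x * y \<longrightarrow> p \<preceq> x \<or> p \<preceq> y)"

lemma prm_mem [simp]: "prm p \<Longrightarrow> p \<in> R"
  and prm_nz [simp]: "prm p \<Longrightarrow> p \<noteq> 0"
  and prm_nonunit [simp]: "prm p \<Longrightarrow> \<not> p \<preceq> 1"
  and prm_dv_mult: "prm p \<Longrightarrow> x \<in> R \<Longrightarrow> y \<in> R \<Longrightarrow> p \<preceq> x * y \<longleftrightarrow> p \<preceq> x \<or> p \<preceq> y"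
  unfolding prm_def by (auto intro: dv_mult dv_mult2)

lemma prm_dv_power: "prm p \<Longrightarrow> x \<in> R \<Longrightarrow> p \<preceq> x ^ n \<Longrightarrow> p \<preceq> x"
  by (induction n) (auto simp: prm_dv_mult)

lemma ideal_two:
  assumes "x \<in> R" "y \<in> R"
  obtains d u v where "d \<in> R" "d \<preceq> x" "d \<preceq> y" "u \<in> R" "v \<in> R" "d = u * x + v * y"
proof -
  define I where "I = {u * x + v * y | u v. u \<in> R \<and> v \<in> R}"
  have "\<exists>d\<in>R. I = (*) d ` R"
  proof (rule principal)
    show "I \<subseteq> R" unfolding I_def using assms by auto
    have "0 = 0 * x + 0 * y" by simp
    thus "0 \<in> I" unfolding I_def using zero_mem by blast
    show "a + b \<in> I" if ab: "a \<in> I" "b \<in> I" for a b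
    proof -
      obtain u v u' v' where "a = u * x + v * y" "b = u' * x + v' * y"
        "u \<in> R" "v \<in> R" "u' \<in> R" "v' \<in> R" using ab unfolding I_def by blast
      hence "a + b = (u + u') * x + (v + v') * y" "u + u' \<in> R" "v + v' \<in> R"
        by (auto simp: algebra_simps)
      thus ?thesis unfolding I_def by blast
    qed
    show "c * a \<in> I" if "c \<in> R" "a \<in> I" for c a
    proof -
      from that obtain u v where "a = u * x + v * y" "u \<in> R" "v \<in> R" unfolding I_def by blast
      hence "c * a = (c * u) * x + (c * v) * y" "c * u \<in> R" "c * v \<in> R"
        using that by (auto simp: algebra_simps)
      thus ?thesis unfolding I_def by blast
    qed
  qed
  then obtain d where d: "d \<in> R" "I = (*) d ` R" by blast
  have "x = 1 * x + 0 * y" "y = 0 * x + 1 * y" by simp_all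
  hence "x \<in> I" "y \<in> I" unfolding I_def by blast+
  moreover have "d \<in> I" using d by force
  ultimately have "\<exists>c\<in>R. x = d * c" "\<exists>c\<in>R. y = d * c" "\<exists>u v. d = u * x + v * y \<and> u \<in> R \<and> v \<in> R"
    using d(2) unfolding I_def by blast+
  thus ?thesis using that d(1) unfolding dv_def by blast
qed

text \<open>The generator \<open>d\<close> of the ideal of \<open>c\<close> and \<open>p\<close>
  divides \<open>p = d e\<close>; as \<open>p\<close> does not divide \<open>d\<close>, it divides
  \<open>e\<close>, so \<open>d\<close> is a unit. Nonzero residues modulo a prime are therefore
  invertible.\<close>

lemma prm_bezout:
  assumes "prm p" "c \<in> R" "\<not> p \<preceq> c"
  obtains u v where "u \<in> R" "v \<in> R" "u * c + v * p = 1"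
proof -
  obtain d u v where d: "d \<in> R" "d \<preceq> c" "d \<preceq> p" "u \<in> R" "v \<in> R" "d = u * c + v * p"
    by (rule ideal_two[OF assms(2) prm_mem[OF assms(1)]])
  obtain e where e: "e \<in> R" "p = d * e" using d by (auto simp: dv_def)
  have "\<not> p \<preceq> d" using assms(3) dv_trans[OF _ d(2)] by blast
  hence "p \<preceq> e" using e prm_dv_mult[OF assms(1) d(1) e(1)] dv_refl[of p] by metis
  then obtain f where "f \<in> R" "e = p * f" by (auto simp: dv_def)
  hence "p * (f * d) = p * 1" using e(2) by (metis mult.assoc mult.commute mult.right_neutral)
  hence "f * d = 1" using prm_nz[OF assms(1)] by (metis mult_left_cancel)
  hence "(f * u) * c + (f * v) * p = 1"
    using d(6) by (simp add: algebra_simps)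
  thus ?thesis using that[of "f * u" "f * v"] \<open>f \<in> R\<close> d(4,5) by blast
qed

text \<open>Ascending chain condition: the ideals generated along an infinite chain have a principal
  union, whose generator already lies in one of them. The descents along divisibility rest on
  this.\<close>

lemma wf_proper_divisor: "wf {(y, x). y \<in> R \<and> x \<in> R \<and> y \<preceq> x \<and> \<not> x \<preceq> y}"
  unfolding wf_iff_no_infinite_down_chain
proof
  assume "\<exists>f. \<forall>i. (f (Suc i), f i) \<in> {(y, x). y \<in> R \<and> x \<in> R \<and> y \<preceq> x \<and> \<not> x \<preceq> y}"
  then obtain f where f: "\<And>i. f i \<in> R" "\<And>i. f (Suc i) \<preceq> f i" "\<And>i. \<not> f i \<preceq> f (Suc i)"
    by blast
  have mono: "f j \<preceq> f i" if "i \<le> j" for i j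
    using that
    by (induction j rule: dec_induct) (use dv_refl f(2) dv_trans in blast)+
  define I where "I = {y. \<exists>i. f i \<preceq> y}"
  have "\<exists>d\<in>R. I = (*) d ` R"
  proof (rule principal)
    show "x + y \<in> I" if xy: "x \<in> I" "y \<in> I" for x y
    proof -
      obtain i j where "f i \<preceq> x" "f j \<preceq> y" using xy I_def by auto
      hence "f (max i j) \<preceq> x" "f (max i j) \<preceq> y" using mono dv_trans by (meson max.cobounded1 max.cobounded2)+
      thus ?thesis unfolding I_def using dv_add by blast
    qed
    show "I \<subseteq> R" unfolding I_def using f(1) dv_mem by blast
    show "0 \<in> I" unfolding I_def by auto
    show "c * x \<in> I" if "c \<in> R" "x \<in> I" for c x
      using that dv_mult unfolding I_def by blast
  qed
  then obtain d where d: "d \<in> R" "I = (*) d ` R" by blast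
  hence "d \<in> I" by force
  then obtain i where "f i \<preceq> d" unfolding I_def by auto
  moreover have "f (Suc i) \<in> I" unfolding I_def using dv_refl by blast
  hence "d \<preceq> f (Suc i)" using d by (auto simp: dv_def)
  ultimately show False using dv_trans f(3) by blast
qed

text \<open>A nonunit divisor \<open>z\<close> of \<open>x\<close> that is minimal for divisibility
  is prime: if \<open>z\<close> does not divide \<open>a\<close>, their gcd is a proper divisor of
  \<open>z\<close>, hence a unit, and the Bezout relation multiplied by \<open>b\<close>
  finishes.\<close>

lemma exists_prime_divisor:
  assumes "x \<in> R" "x \<noteq> 0" "\<not> x \<preceq> 1"
  shows "\<exists>p. prm p \<and> p \<preceq> x"
proof -
  define Q where "Q = {y\<in>R. \<not> y \<preceq> 1 \<and> y \<preceq> x}"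
  have "x \<in> Q" using assms Q_def by auto
  then obtain z where z: "z \<in> Q" and
    min: "\<And>y. (y, z) \<in> {(y, x). y \<in> R \<and> x \<in> R \<and> y \<preceq> x \<and> \<not> x \<preceq> y} \<Longrightarrow> y \<notin> Q"
    using wfE_min[OF wf_proper_divisor, of x Q] by blast
  have zR: "z \<in> R" "\<not> z \<preceq> 1" "z \<preceq> x" using z unfolding Q_def by auto
  have "z \<preceq> b" if "a \<in> R" "b \<in> R" "z \<preceq> a * b" "\<not> z \<preceq> a" for a b
  proof -
    obtain d u v where d: "d \<in> R" "d \<preceq> z" "d \<preceq> a" "u \<in> R" "v \<in> R" "d = u * z + v * a"
      by (rule ideal_two[OF zR(1) \<open>a \<in> R\<close>])
    have "\<not> z \<preceq> d" using d that dv_trans by blast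
    hence "d \<notin> Q" using min[of d] d zR by auto
    moreover have "d \<preceq> x" using d zR dv_trans by blast
    ultimately have "d \<preceq> 1" using d unfolding Q_def by auto
    then obtain e where e: "e \<in> R" "1 = d * e" by (auto simp: dv_def)
    have "b = (d * e) * b" using e(2) by simp
    also have "\<dots> = z * (e * u * b) + (e * v) * (a * b)" using d(6) by (simp add: algebra_simps)
    finally show ?thesis using that d e by (metis dv_add dv_mult dv_triv(2) mult_mem)
  qed
  moreover have "z \<noteq> 0" using zR assms(2) by (auto simp: dv_def)
  ultimately have "prm z" using zR unfolding prm_def by blast
  thus ?thesis using zR by blast
qed

lemma dv_proper_prm: "prm p \<Longrightarrow> y \<noteq> 0 \<Longrightarrow> y \<in> R \<Longrightarrow> \<not> p * y \<preceq> y"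
  using dv_mult_cancel[of y p 1] by (auto simp: mult.commute)

text \<open>The hypothesis covers all divisors of \<open>x\<close> because the recursion for
  \<open>p x\<close> refers to \<open>x\<close> and to \<open>x / p\<close>, and because
  \<open>x\<close> absorbs a unit when the prime is made totally positive.\<close>

lemma prime_induct [consumes 2, case_names unit prime]:
  assumes "x \<in> R" "x \<noteq> 0"
    and "\<And>u. u \<in> R \<Longrightarrow> u \<preceq> 1 \<Longrightarrow> P u"
    and "\<And>p x. prm p \<Longrightarrow> x \<in> R \<Longrightarrow> x \<noteq> 0 \<Longrightarrow> (\<And>y. y \<in> R \<Longrightarrow> y \<preceq> x \<Longrightarrow> P y) \<Longrightarrow> P (p * x)"
  shows "P x"
  using assms(1,2)
proof (induction x rule: wf_induct_rule[OF wf_proper_divisor])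
  case (1 x)
  show ?case
  proof (cases "x \<preceq> 1")
    case False
    then obtain p where p: "prm p" "p \<preceq> x" using exists_prime_divisor 1 by blast
    then obtain y where y: "y \<in> R" "x = p * y" by (auto simp: dv_def)
    have y0: "y \<noteq> 0" using y 1 by auto
    have "P z" if "z \<in> R" "z \<preceq> y" for z
    proof (rule 1(1))
      have "\<not> x \<preceq> z" using that dv_trans dv_proper_prm[OF p(1) y0 y(1)] y(2) by blast
      moreover have "z \<preceq> x" using that y dv_mult p(1) by (metis prm_mem)
      ultimately show "(z, x) \<in> {(y, x). y \<in> R \<and> x \<in> R \<and> y \<preceq> x \<and> \<not> x \<preceq> y}"
        using that 1 by auto
      show "z \<in> R" by fact
      show "z \<noteq> 0" using that y0 by (auto simp: dv_def)
    qed
    thus ?thesis unfolding y using assms(4) p y y0 by blast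
  qed (use assms(3) 1 in auto)
qed

lemma prm_multiplicity:
  assumes "prm p" "x \<in> R" "x \<noteq> 0"
  obtains n y where "y \<in> R" "\<not> p \<preceq> y" "x = p ^ n * y"
  using assms(2,3)
proof (induction x arbitrary: thesis rule: wf_induct_rule[OF wf_proper_divisor])
  case (1 x)
  show ?case
  proof (cases "p \<preceq> x")
    case True
    then obtain y where y: "y \<in> R" "x = p * y" by (auto simp: dv_def)
    have y0: "y \<noteq> 0" using y 1 by auto
    have "(y, x) \<in> {(y, x). y \<in> R \<and> x \<in> R \<and> y \<preceq> x \<and> \<not> x \<preceq> y}"
      using dv_proper_prm[OF assms(1) y0 y(1)] y 1 assms(1) by auto
    then obtain n z where "z \<in> R" "\<not> p \<preceq> z" "y = p ^ n * z" using 1(1)[of y] y y0 by blast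
    thus ?thesis using 1(2)[of z "Suc n"] y by (simp add: mult.assoc)
  qed (use 1(2)[of x 0] 1 in auto)
qed

lemma prm_power_dv_imp_0:
  assumes "prm p" "x \<in> R" "\<And>n. p ^ n \<preceq> x"
  shows "x = 0"
proof (rule ccontr)
  assume "x \<noteq> 0"
  then obtain n y where y: "y \<in> R" "\<not> p \<preceq> y" "x = p ^ n * y"
    by (rule prm_multiplicity[OF assms(1,2)])
  have "p ^ n * p \<preceq> p ^ n * y" using assms(3)[of "Suc n"] y by (simp add: mult.commute)
  thus False using dv_mult_cancel[of "p ^ n"] y assms(1) by auto
qed

lemma prm_power_cancel:
  assumes "prm p" "s \<in> R" "x \<in> R" "\<not> p \<preceq> s" "p ^ n \<preceq> s * x"
  shows "p ^ n \<preceq> x"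
  using assms(3,5)
proof (induction n arbitrary: x)
  case 0 thus ?case by (simp add: dv_one)
next
  case (Suc n)
  have "p \<preceq> s * x" using Suc.prems using dv_trans[OF dv_triv(2)[of "p ^ n" p]] assms(1) by simp
  hence "p \<preceq> x" using prm_dv_mult assms Suc by blast
  then obtain y where y: "y \<in> R" "x = p * y" by (auto simp: dv_def)
  have "p * p ^ n \<preceq> p * (s * y)" using Suc.prems(2) y by (simp add: mult.left_commute)
  hence "p ^ n \<preceq> s * y" using dv_mult_cancel assms(1) prm_nz by blast
  thus ?case using Suc.IH[OF y(1)] y dv_mult_mono by simp
qed

lemma prm_dv_prm:
  assumes "prm p" "prm r" "p \<preceq> r"
  shows "r \<preceq> p"
proof -
  obtain c where c: "c \<in> R" "r = p * c" using assms by (auto simp: dv_def)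
  hence "r \<preceq> p \<or> r \<preceq> c" using assms prm_dv_mult[of r p c] by auto
  moreover have "\<not> r \<preceq> c" using c assms dv_proper_prm[of p c] prm_nz[OF assms(2)] by (metis mult_zero_right)
  ultimately show ?thesis by simp
qed

text \<open>The set of all \<open>y\<close> with \<open>y c\<^sup>n \<in> R\<close> for every \<open>n\<close> is an ideal stable under multiplication
  by \<open>c\<close>.\<close>

lemma completely_integrally_closed:
  assumes "d \<noteq> 0" "\<And>n. d * c ^ n \<in> R"
  shows "c \<in> R"
proof -
  define I where "I = {y. \<forall>n. y * c ^ n \<in> R}"
  have I_R: "I \<subseteq> R" unfolding I_def by (auto dest: spec[of _ 0])
  have "\<exists>e\<in>R. I = (*) e ` R"
    by (rule principal[OF I_R]) (auto simp: I_def distrib_right mult.assoc)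
  then obtain e where e: "e \<in> R" "I = (*) e ` R" by blast
  have "d \<in> I" using assms unfolding I_def by auto
  hence e0: "e \<noteq> 0" using e assms by auto
  have "e \<in> I" using e by force
  hence "e * c ^ Suc n \<in> R" for n unfolding I_def by blast
  hence "e * c \<in> I" unfolding I_def by (simp add: mult.assoc)
  then obtain r where "r \<in> R" "e * c = e * r" using e by auto
  thus ?thesis using e0 by simp
qed

lemma common_denominator:
  assumes "finite S"
  shows "\<exists>d\<in>R. d \<noteq> 0 \<and> (\<forall>x\<in>S. d * x \<in> R)"
  using assms
proof induction
  case (insert x S)
  obtain e where "e \<in> R" "e \<noteq> 0" "e * x \<in> R" using fraction by blast
  moreover obtain d where "d \<in> R" "d \<noteq> 0" "\<forall>x\<in>S. d * x \<in> R" using insert by blast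
  ultimately have "e * d \<in> R" "e * d \<noteq> 0" "e * d * x \<in> R" "\<forall>y\<in>S. e * d * y \<in> R"
    by (auto simp: mult.assoc mult.left_commute[of e d x])
  thus ?case by blast
qed (auto intro: bexI[of _ 1])

section \<open>Residue classes and their number\<close>

definition residue :: "'k \<Rightarrow> 'k \<Rightarrow> 'k set" where
  "residue d x = {y\<in>R. d \<preceq> y - x}"

definition residues :: "'k \<Rightarrow> 'k set set" where
  "residues d = residue d ` R"

lemma residue_eq_iff:
  assumes "x \<in> R" "y \<in> R"
  shows "residue d x = residue d y \<longleftrightarrow> d \<preceq> x - y"
proof
  assume "residue d x = residue d y"
  moreover have "x \<in> residue d x" using assms unfolding residue_def by simp
  ultimately have "x \<in> residue d y" by simp
  thus "d \<preceq> x - y" unfolding residue_def by simp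
next
  assume "d \<preceq> x - y"
  hence "d \<preceq> z - x \<longleftrightarrow> d \<preceq> z - y" for z
    using dv_add[of d "z - x" "x - y"] dv_diff[of d "z - y" "x - y"] by auto
  thus "residue d x = residue d y" unfolding residue_def by auto
qed

text \<open>Every residue class modulo \<open>d e\<close> is \<open>x + d y\<close> for unique classes \<open>x\<close> modulo \<open>d\<close> and \<open>y\<close>
  modulo \<open>e\<close>; no finiteness is involved, because cardinalities of products are multiplicative
  with the junk value 0 for infinite sets.\<close>

lemma card_residues_mult:
  assumes "d \<in> R" "d \<noteq> 0" "e \<in> R" "e \<noteq> 0"
  shows "card (residues (d * e)) = card (residues d) * card (residues e)"
proof -
  define rep where "rep f A = (SOME x. x \<in> R \<and> residue f x = A)" for f A
  have rep: "rep f A \<in> R" "residue f (rep f A) = A" if "A \<in> residues f" for f A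
  proof -
    have "\<exists>x. x \<in> R \<and> residue f x = A" using that unfolding residues_def by auto
    from someI_ex[OF this] show "rep f A \<in> R" "residue f (rep f A) = A" unfolding rep_def by auto
  qed
  have "bij_betw (\<lambda>(A, B). residue (d * e) (rep d A + d * rep e B))
          (residues d \<times> residues e) (residues (d * e))"
    unfolding bij_betw_def
  proof
    show "inj_on (\<lambda>(A, B). residue (d * e) (rep d A + d * rep e B)) (residues d \<times> residues e)"
    proof (clarsimp simp: inj_on_def)
      fix A B A' B'
      assume AB: "A \<in> residues d" "B \<in> residues e" "A' \<in> residues d" "B' \<in> residues e"
        and "residue (d * e) (rep d A + d * rep e B) = residue (d * e) (rep d A' + d * rep e B')"
      hence dv: "d * e \<preceq> (rep d A - rep d A') + d * (rep e B - rep e B')"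
        using residue_eq_iff rep assms by (simp add: algebra_simps)
      hence "d \<preceq> (rep d A - rep d A') + d * (rep e B - rep e B')"
        by (rule dv_trans[rotated]) (use assms in auto)
      moreover have "d \<preceq> d * (rep e B - rep e B')" using rep AB by auto
      ultimately have "d \<preceq> rep d A - rep d A'" using dv_add_iff by (metis add.commute)
      hence A: "A = A'" using residue_eq_iff rep AB by metis
      hence "d * e \<preceq> d * (rep e B - rep e B')" using dv by simp
      hence "e \<preceq> rep e B - rep e B'" using dv_mult_cancel assms by blast
      thus "A = A' \<and> B = B'" using A residue_eq_iff rep AB by metis
    qed
    show "(\<lambda>(A, B). residue (d * e) (rep d A + d * rep e B)) ` (residues d \<times> residues e) = residues (d * e)"
    proof (intro equalityI subsetI)
      fix C assume "C \<in> residues (d * e)"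
      then obtain x where x: "x \<in> R" "C = residue (d * e) x" unfolding residues_def by auto
      define A where "A = residue d x"
      have A: "A \<in> residues d" using x unfolding A_def residues_def by auto
      have "d \<preceq> x - rep d A" using residue_eq_iff rep[OF A] x A_def by blast
      then obtain y where y: "y \<in> R" "x - rep d A = d * y" by (auto simp: dv_def)
      define B where "B = residue e y"
      have B: "B \<in> residues e" using y unfolding B_def residues_def by auto
      have "e \<preceq> y - rep e B" using residue_eq_iff rep[OF B] y B_def by blast
      hence "d * e \<preceq> d * (y - rep e B)" using dv_mult_mono by blast
      hence "d * e \<preceq> x - (rep d A + d * rep e B)" using y(2) by (simp add: algebra_simps)
      hence "C = residue (d * e) (rep d A + d * rep e B)"
        using x residue_eq_iff rep[OF A] rep[OF B] assms by auto
      thus "C \<in> (\<lambda>(A, B). residue (d * e) (rep d A + d * rep e B)) ` (residues d \<times> residues e)"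
        using A B by force
    qed (use rep assms in \<open>auto simp: residues_def\<close>)
  qed
  hence "card (residues d \<times> residues e) = card (residues (d * e))" by (rule bij_betw_same_card)
  thus ?thesis by (simp add: card_cartesian_product)
qed

end

section \<open>The ring of integers of a number field\<close>

text \<open>Finite degree over the rationals enters the proof only through such relations.
  Multiplying a rational relation by the product \<open>d\<close> of its denominators makes the
  coefficients integral.\<close>

lemma number_field_dependent:
  assumes "number_field TYPE('k::field_char_0)"
  obtains D :: nat where
    "\<And>S :: 'k set. finite S \<Longrightarrow> card S > D \<Longrightarrow>
       \<exists>r :: 'k \<Rightarrow> int. (\<Sum>s\<in>S. of_int (r s) * s) = 0 \<and> (\<exists>s\<in>S. r s \<noteq> 0)"
proof -
  obtain B where "finite_dimensional_vector_space (\<lambda>r (x::'k). of_rat r * x) B"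
    using assms unfolding number_field_def by blast
  then interpret V: finite_dimensional_vector_space "\<lambda>r (x::'k). of_rat r * x" B .
  have "\<exists>r :: 'k \<Rightarrow> int. (\<Sum>s\<in>S. of_int (r s) * s) = 0 \<and> (\<exists>s\<in>S. r s \<noteq> 0)"
    if S: "finite S" "card S > card B" for S :: "'k set"
  proof -
    have "V.dependent S"
      using V.independent_span_bound[of B S] V.finite_Basis V.span_Basis S(2) by auto
    then obtain u v where u: "v \<in> S" "u v \<noteq> 0" "(\<Sum>v\<in>S. of_rat (u v) * v) = 0"
      using V.dependent_finite[OF S(1)] by blast
    define d where "d = (\<Prod>v\<in>S. snd (quotient_of (u v)))"
    have d0: "d \<noteq> 0"
      unfolding d_def using S(1) quotient_of_denom_pos' by (simp add: less_imp_neq[symmetric])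
    have "\<exists>z. of_int z = of_int d * u s" if s: "s \<in> S" for s
    proof -
      have "snd (quotient_of (u s)) dvd d" unfolding d_def using S(1) s by (rule dvd_prodI)
      then obtain e where e: "d = snd (quotient_of (u s)) * e" by (auto simp: dvd_def)
      have "u s = of_int (fst (quotient_of (u s))) / of_int (snd (quotient_of (u s)))"
        by (metis prod.collapse quotient_of_div)
      moreover have "snd (quotient_of (u s)) \<noteq> 0" using quotient_of_denom_pos'[of "u s"] by linarith
      ultimately have "of_int d * u s = of_int (fst (quotient_of (u s)) * e)"
        unfolding e by (simp add: field_simps)
      thus ?thesis by metis
    qed
    then obtain r where r: "\<And>s. s \<in> S \<Longrightarrow> of_int (r s) = of_int d * u s" by metis
    have "(of_int (r s) :: 'k) = of_int d * of_rat (u s)" if "s \<in> S" for s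
    proof -
      have "of_rat (of_int (r s)) = (of_rat (of_int d * u s) :: 'k)" using r[OF that] by simp
      thus ?thesis by (simp add: of_rat_mult)
    qed
    hence "(\<Sum>s\<in>S. of_int (r s) * s) = (\<Sum>s\<in>S. of_int d * (of_rat (u s) * s))"
      by (intro sum.cong) (auto simp: mult.assoc)
    also have "\<dots> = 0" using u(3) by (simp flip: sum_distrib_left)
    finally have "(\<Sum>s\<in>S. of_int (r s) * s) = 0" .
    moreover have "r v \<noteq> 0" using r[OF u(1)] u d0 by auto
    ultimately show ?thesis using u(1) by blast
  qed
  thus ?thesis using that by blast
qed

lemma number_field_algebraic:
  assumes "number_field TYPE('k::field_char_0)"
  shows "algebraic (x :: 'k)"
proof -
  obtain D where D: "\<And>S :: 'k set. finite S \<Longrightarrow> card S > D \<Longrightarrow>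
       \<exists>r :: 'k \<Rightarrow> int. (\<Sum>s\<in>S. of_int (r s) * s) = 0 \<and> (\<exists>s\<in>S. r s \<noteq> 0)"
    using number_field_dependent[OF assms] by metis
  show ?thesis
  proof (cases "inj_on (\<lambda>n. x ^ n) {..D}")
    case True
    hence "card ((\<lambda>n. x ^ n) ` {..D}) > D" by (simp add: card_image)
    then obtain r :: "'k \<Rightarrow> int" where
      r: "(\<Sum>s\<in>(\<lambda>n. x ^ n) ` {..D}. of_int (r s) * s) = 0" "\<exists>s\<in>(\<lambda>n. x ^ n) ` {..D}. r s \<noteq> 0"
      using D[of "(\<lambda>n. x ^ n) ` {..D}"] by auto
    define p :: "'k poly" where "p = (\<Sum>n\<le>D. monom (of_int (r (x ^ n))) n)"
    have c: "coeff p n = (if n \<le> D then of_int (r (x ^ n)) else 0)" for n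
      by (simp add: p_def coeff_sum if_distrib cong: if_cong)
    show ?thesis
    proof (rule algebraicI)
      show "coeff p i \<in> \<int>" for i by (simp add: c)
      show "p \<noteq> 0" using r(2) c by (metis atMost_iff coeff_0 image_iff of_int_eq_0_iff)
      show "poly p x = 0" using r(1) by (simp add: p_def poly_sum poly_monom sum.reindex[OF True])
    qed
  next
    case False
    \<comment> \<open>Coinciding powers make the set too small for the bound \<open>D\<close>, but
      the coincidence itself gives the polynomial X^n - X^m.\<close>
    then obtain m n where mn: "m < n" "x ^ m = x ^ n"
      unfolding inj_on_def by (metis linorder_neqE_nat)
    show ?thesis
    proof (rule algebraicI)
      let ?p = "monom 1 n - monom 1 m :: 'k poly"
      show "coeff ?p i \<in> \<int>" for i by auto
      show "?p \<noteq> 0" using mn by (metis coeff_diff coeff_monom coeff_0 diff_zero less_irrefl zero_neq_one)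
      show "poly ?p x = 0" using mn by (simp add: poly_monom)
    qed
  qed
qed

lemma algebraic_int_multiple:
  assumes "algebraic (x :: 'k::field_char_0)"
  obtains l :: int where "l \<noteq> 0" "algebraic_int (of_int l * x)"
proof -
  obtain p where p: "p \<noteq> 0" "poly (map_poly of_int p) x = 0"
    using assms by (auto elim: algebraicE')
  define n where "n = degree p"
  define l where "l = coeff p n"
  have l0: "l \<noteq> 0" using p by (simp add: l_def n_def)
  have n0: "n > 0"
  proof (rule ccontr)
    assume "\<not> n > 0"
    hence "degree p = 0" by (simp add: n_def)
    then obtain a where "p = [:a:]" by (rule degree_eq_zeroE)
    thus False using p by (simp add: map_poly_pCons)
  qed
  \<comment> \<open>\<open>q\<close> is l^(n-1) p(X / l), the monic polynomial for \<open>l\<close>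
    times a root of \<open>p\<close>; its coefficients stay integral because \<open>l\<close> is the
    leading coefficient.\<close>
  define q :: "'k poly" where
    "q = monom 1 n + (\<Sum>i<n. monom (of_int (coeff p i * l ^ (n - 1 - i))) i)"
  have cq: "coeff q i = (if i = n then 1 else if i < n then of_int (coeff p i * l ^ (n - 1 - i)) else 0)" for i
    by (simp add: q_def coeff_sum)
  have dq: "degree q = n"
  proof (rule antisym)
    show "degree q \<le> n" by (rule degree_le) (simp add: cq)
    show "n \<le> degree q" by (rule le_degree) (simp add: cq)
  qed
  have "poly q (of_int l * x) = of_int l ^ (n - 1) * (\<Sum>i\<le>n. of_int (coeff p i) * x ^ i)"
  proof -
    have "of_int (coeff p i * l ^ (n - 1 - i)) * (of_int l * x) ^ i = of_int l ^ (n - 1) * (of_int (coeff p i) * x ^ i)"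
      if "i < n" for i
    proof -
      have "(n - 1 - i) + i = n - 1" using that by auto
      hence "(of_int l :: 'k) ^ (n - 1 - i) * of_int l ^ i = of_int l ^ (n - 1)" by (metis power_add)
      thus ?thesis by (simp add: power_mult_distrib mult_ac)
    qed
    moreover have "(of_int l * x) ^ n = of_int l ^ (n - 1) * (of_int (coeff p n) * x ^ n)"
      using n0 by (cases n) (auto simp: l_def power_mult_distrib mult_ac)
    moreover have "{..n} = insert n {..<n}" by auto
    ultimately show ?thesis
      unfolding q_def poly_add poly_sum poly_monom sum_distrib_left
      by (simp del: of_int_mult of_int_power)
  qed
  also have "(\<Sum>i\<le>n. of_int (coeff p i) * x ^ i) = poly (map_poly of_int p) x"
    by (simp add: poly_altdef n_def degree_map_poly coeff_map_poly)
  finally have "poly q (of_int l * x) = 0" using p by simp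
  hence "algebraic_int (of_int l * x)"
    by (intro algebraic_int.intros[of q]) (auto simp: dq cq)
  thus ?thesis using that l0 by blast
qed

text \<open>A polynomial equation for \<open>x\<close> exhibits its constant term as a multiple of
  \<open>x\<close>; factors X are stripped as long as the constant term vanishes. This is the source
  of the rational prime below a prime of the ring of integers.\<close>

lemma algebraic_int_dvd_int:
  assumes "algebraic_int (x :: 'k::field_char_0)" "x \<noteq> 0"
  obtains p :: "int poly" and n :: int where "n \<noteq> 0" "of_int n = x * poly (map_poly of_int p) x"
proof -
  obtain p where p: "poly (map_poly of_int p) x = 0" "lead_coeff p = 1"
    using assms unfolding algebraic_int_altdef_ipoly by auto
  have "\<exists>p n. n \<noteq> 0 \<and> of_int n = x * poly (map_poly of_int p) x"
    if "p \<noteq> 0" "poly (map_poly of_int p) x = 0" for p :: "int poly"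
    using that
  proof (induction p)
    case (pCons a p)
    have e: "of_int a + x * poly (map_poly of_int p) x = 0"
      using pCons.prems by (simp add: map_poly_pCons)
    show ?case
    proof (cases "a = 0")
      case True
      thus ?thesis using pCons e assms(2) by auto
    next
      case False
      have "of_int (- a) = x * poly (map_poly of_int p) x" using e by (simp add: add_eq_0_iff2 minus_equation_iff)
      thus ?thesis using False by (metis neg_equal_0_iff_equal)
    qed
  qed auto
  moreover have "p \<noteq> 0" using p(2) by auto
  ultimately show ?thesis using p(1) that by blast
qed

lemma ring_of_integers_simps [simp]:
  "carrier ring_of_integers = {x. algebraic_int x}"
  "x \<otimes>\<^bsub>ring_of_integers\<^esub> y = x * y" "x \<oplus>\<^bsub>ring_of_integers\<^esub> y = x + y"
  "\<one>\<^bsub>ring_of_integers\<^esub> = 1" "\<zero>\<^bsub>ring_of_integers\<^esub> = 0"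
  by (simp_all add: ring_of_integers_def ring_of_type_algebra_def)

lemma number_field_pid:
  assumes "number_field TYPE('k::field_char_0)"
    and "principal_domain (ring_of_integers :: 'k ring)"
  shows "pid_in_field {x :: 'k. algebraic_int x}"
proof -
  interpret P: principal_domain "ring_of_integers :: 'k ring" by fact
  show ?thesis
  proof
    show "x + y \<in> {x. algebraic_int x}" if "x \<in> {x. algebraic_int x}" "y \<in> {x. algebraic_int x}" for x y :: 'k
      using P.a_closed[of x y] that by simp
    show m: "x * y \<in> {x. algebraic_int x}" if "x \<in> {x. algebraic_int x}" "y \<in> {x. algebraic_int x}" for x y :: 'k
      using P.m_closed[of x y] that by simp
    show "\<exists>d\<in>{x. algebraic_int x}. d \<noteq> 0 \<and> d * x \<in> {x. algebraic_int x}" for x :: 'k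
    proof -
      obtain l :: int where "l \<noteq> 0" "algebraic_int (of_int l * x)"
        using algebraic_int_multiple[OF number_field_algebraic[OF assms(1)]] by blast
      thus ?thesis by (intro bexI[of _ "of_int l"]) auto
    qed
    show "\<exists>d\<in>{x. algebraic_int x}. I = (*) d ` {x. algebraic_int x}"
      if I: "I \<subseteq> {x :: 'k. algebraic_int x}" "0 \<in> I" "\<And>x y. x \<in> I \<Longrightarrow> y \<in> I \<Longrightarrow> x + y \<in> I"
        "\<And>c x. c \<in> {x. algebraic_int x} \<Longrightarrow> x \<in> I \<Longrightarrow> c * x \<in> I" for I
    proof -
      have neg: "- x \<in> I" if "x \<in> I" for x using I(4)[of "- 1" x] that by simp
      have inv: "inv\<^bsub>add_monoid ring_of_integers\<^esub> x = - x" if "algebraic_int x" for x :: 'k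
        using P.add.inv_equality[of "- x" x] that by (simp add: a_inv_def)
      have "ideal I ring_of_integers"
      proof (rule idealI)
        show "Ring.ring (ring_of_integers :: 'k ring)" by (rule P.ring_axioms)
        show "subgroup I (add_monoid ring_of_integers)"
          by (unfold subgroup_def) (use I(1,2,3) neg inv in \<open>auto simp: subset_eq\<close>)
        show "x \<otimes>\<^bsub>ring_of_integers\<^esub> a \<in> I" "a \<otimes>\<^bsub>ring_of_integers\<^esub> x \<in> I"
          if "a \<in> I" "x \<in> carrier ring_of_integers" for a x
          using I(4)[of x a] that by (simp_all add: mult.commute)
      qed
      then obtain d :: 'k where "algebraic_int d" "I = PIdl\<^bsub>ring_of_integers\<^esub> d"
        using P.exists_gen by auto
      moreover from this have "I = (*) d ` {x. algebraic_int x}"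
        by (auto simp: cgenideal_def mult.commute)
      ultimately show ?thesis by auto
    qed
  qed auto
qed

locale number_ring = pid_in_field R for R :: "'k::field_char_0 set" +
  assumes R_eq: "R = {x. algebraic_int x}"
    and number_field: "number_field TYPE('k)"
begin

text \<open>The least positive integer divisible by \<open>p\<close> is prime: in a factorization
  one factor is again divisible by \<open>p\<close>, so it cannot be smaller.\<close>

lemma prm_dv_rational_prime:
  assumes "prm p"
  obtains l :: nat where "Factorial_Ring.prime l" "p \<preceq> of_nat l"
proof -
  have p: "algebraic_int p" "p \<noteq> 0" using assms prm_mem R_eq by auto
  obtain f :: "int poly" and n :: int where n: "n \<noteq> 0" "of_int n = p * poly (map_poly of_int f) p"
    by (rule algebraic_int_dvd_int[OF p])
  have "poly (map_poly of_int f) p \<in> R"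
    unfolding poly_altdef using assms by (intro sum_mem mult_mem power_mem) (auto simp: coeff_map_poly)
  hence "p \<preceq> of_int n" using n(2) dvI by blast
  hence "p \<preceq> of_nat (nat \<bar>n\<bar>)" using dv_uminus[of p "of_int n"] by (cases "n \<ge> 0") auto
  hence "nat \<bar>n\<bar> \<noteq> 0 \<and> p \<preceq> of_nat (nat \<bar>n\<bar>)" using n(1) by auto
  then obtain m :: nat where m: "m \<noteq> 0 \<and> p \<preceq> of_nat m" and
    least: "\<And>k. k < m \<Longrightarrow> \<not> (k \<noteq> 0 \<and> p \<preceq> of_nat k)"
    by (metis exists_least_iff[of "\<lambda>m. m \<noteq> 0 \<and> p \<preceq> of_nat m"])
  have "m \<noteq> 1" using m assms by auto
  have "Factorial_Ring.prime m"
    unfolding prime_nat_iff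
  proof (intro conjI allI impI)
    show "1 < m" using m \<open>m \<noteq> 1\<close> by linarith
    fix d assume "d dvd m"
    then obtain e where e: "m = d * e" by (auto simp: dvd_def)
    hence "p \<preceq> of_nat d \<or> p \<preceq> of_nat e" using m assms by (simp add: prm_dv_mult)
    moreover have "d \<noteq> 0" "e \<noteq> 0" using m e by auto
    ultimately have "\<not> d < m \<or> \<not> e < m" using least by blast
    thus "d = 1 \<or> d = m" using e \<open>d \<noteq> 0\<close> \<open>e \<noteq> 0\<close> by (cases "d = 1"; cases "e = 1") auto
  qed
  thus ?thesis using that m by blast
qed

lemma prm_dv_of_int_iff:
  assumes "prm p" "Factorial_Ring.prime (l::nat)" "p \<preceq> of_nat l"
  shows "p \<preceq> of_int k \<longleftrightarrow> int l dvd k"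
proof
  assume "int l dvd k"
  then obtain e where "k = int l * e" by (auto simp: dvd_def)
  thus "p \<preceq> of_int k" using dv_mult2[OF assms(3), of "of_int e"] by simp
next
  assume k: "p \<preceq> of_int k"
  show "int l dvd k"
  proof (rule ccontr)
    assume "\<not> int l dvd k"
    hence "Rings.coprime (int l) k" using assms(2) by (simp add: prime_imp_coprime)
    then obtain u v where "u * int l + v * k = 1" by (metis bezout_int coprime_iff_gcd_eq_1)
    hence "of_int (u * int l + v * k) = (1 :: 'k)" by simp
    hence "of_int u * of_nat l + of_int v * of_int k = (1 :: 'k)" by simp
    moreover have "p \<preceq> of_int u * of_nat l + of_int v * of_int k"
      using dv_add[OF dv_mult[OF assms(3)] dv_mult[OF k]] by simp
    ultimately show False using assms(1) by simp
  qed
qed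

text \<open>A maximal subset of \<open>R\<close> that is linearly independent modulo \<open>p\<close> over the prime field has at
  most \<open>[K : \<rat>]\<close> elements, because a rational relation can be made integral and primitive.\<close>

lemma finite_residues:
  assumes p: "prm p"
  shows "finite (residues p)"
proof -
  obtain l :: nat where l: "Factorial_Ring.prime l" "p \<preceq> of_nat l"
    using prm_dv_rational_prime[OF p] by blast
  note l_iff = prm_dv_of_int_iff[OF p l]
  have l0: "l > 0" using l(1) prime_gt_0_nat by blast
  obtain D where D: "\<And>S :: 'k set. finite S \<Longrightarrow> card S > D \<Longrightarrow>
       \<exists>r :: 'k \<Rightarrow> int. (\<Sum>s\<in>S. of_int (r s) * s) = 0 \<and> (\<exists>s\<in>S. r s \<noteq> 0)"
    using number_field_dependent[OF number_field] by metis
  define ind where "ind B \<longleftrightarrow> finite B \<and> B \<subseteq> R \<and>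
      (\<forall>r :: 'k \<Rightarrow> int. p \<preceq> (\<Sum>b\<in>B. of_int (r b) * b) \<longrightarrow> (\<forall>b\<in>B. int l dvd r b))" for B
  have bound: "card B \<le> D" if B: "ind B" for B
  proof (rule ccontr)
    assume "\<not> card B \<le> D"
    then obtain r :: "'k \<Rightarrow> int" where r: "(\<Sum>s\<in>B. of_int (r s) * s) = 0" "\<exists>s\<in>B. r s \<noteq> 0"
      using D[of B] B unfolding ind_def by auto
    have fB: "finite B" using B unfolding ind_def by blast
    \<comment> \<open>Without division by \<open>g\<close> all coefficients might be divisible by
      \<open>l\<close>, and independence modulo \<open>p\<close> would say nothing.\<close>
    define g where "g = Gcd (r ` B)"
    have g0: "g \<noteq> 0" using r(2) unfolding g_def by auto
    define r' where "r' b = r b div g" for b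
    have r': "r b = g * r' b" if "b \<in> B" for b
      using that unfolding r'_def g_def by simp
    have "of_int g * (\<Sum>s\<in>B. of_int (r' s) * s) = (\<Sum>s\<in>B. of_int (r s) * s)"
      unfolding sum_distrib_left by (rule sum.cong) (auto simp: r')
    hence "(\<Sum>s\<in>B. of_int (r' s) * s) = 0" using r(1) g0 by simp
    hence "p \<preceq> (\<Sum>s\<in>B. of_int (r' s) * s)" by simp
    hence "\<forall>b\<in>B. int l dvd r' b" using B unfolding ind_def by blast
    hence "\<forall>b\<in>B. g * int l dvd r b" using r' by (auto intro: mult_dvd_mono)
    hence "g * int l dvd g" unfolding g_def by (intro Gcd_greatest) auto
    hence "int l dvd 1" using g0 by (simp add: dvd_mult_cancel_left)
    thus False using prime_gt_1_nat[OF l(1)] by (simp add: zdvd1_eq)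
  qed
  have "ind {}" unfolding ind_def by simp
  then obtain B where B: "ind B" and max: "\<And>C. ind C \<Longrightarrow> card C \<le> card B"
    using ex_has_greatest_nat[of ind "{}" card "Suc D"] bound le_imp_less_Suc by blast
  have fB: "finite B" and BR: "B \<subseteq> R" using B unfolding ind_def by blast+
  have comb: "(\<Sum>b\<in>B. of_int (c b) * b) \<in> R" for c :: "'k \<Rightarrow> int" using BR by (intro sum_mem) auto
  have span: "\<exists>c :: 'k \<Rightarrow> int. p \<preceq> x - (\<Sum>b\<in>B. of_int (c b) * b)" if x: "x \<in> R" for x
  proof (cases "x \<in> B")
    case True
    have "(\<Sum>b\<in>B. of_int (if b = x then 1 else 0) * b) = (\<Sum>b\<in>B. if b = x then b else 0)"
      by (rule sum.cong) auto
    also have "\<dots> = x" using True fB by simp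
    finally show ?thesis by (metis diff_self dv_0)
  next
    case False
    have "\<not> ind (insert x B)" using max[of "insert x B"] False fB by auto
    then obtain r :: "'k \<Rightarrow> int" where
      r: "p \<preceq> (\<Sum>b\<in>insert x B. of_int (r b) * b)" "\<not> (\<forall>b\<in>insert x B. int l dvd r b)"
      using fB BR x unfolding ind_def by auto
    have sum: "p \<preceq> of_int (r x) * x + (\<Sum>b\<in>B. of_int (r b) * b)" using r(1) False fB by simp
    have nd: "\<not> int l dvd r x"
    proof
      assume "int l dvd r x"
      hence "p \<preceq> of_int (r x) * x" using l_iff dv_mult2 x by blast
      hence "p \<preceq> (\<Sum>b\<in>B. of_int (r b) * b)" using sum dv_add_iff by blast
      hence "\<forall>b\<in>B. int l dvd r b" using B unfolding ind_def by blast
      thus False using r(2) \<open>int l dvd r x\<close> by blast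
    qed
    hence "Rings.coprime (int l) (r x)" using l(1) by (simp add: prime_imp_coprime)
    \<comment> \<open>\<open>v\<close> inverts \<open>r x\<close> modulo \<open>l\<close>;
      multiplying the relation by \<open>v\<close> solves it for \<open>x\<close>.\<close>
    then obtain u v where uv: "u * int l + v * r x = 1" by (metis bezout_int coprime_iff_gcd_eq_1)
    hence "of_int (u * int l + v * r x) = (1 :: 'k)" by simp
    hence uv': "x = (of_int u * of_nat l + of_int v * of_int (r x)) * x" by simp
    have "p \<preceq> of_int v * (of_int (r x) * x + (\<Sum>b\<in>B. of_int (r b) * b)) + of_nat l * (of_int u * x)"
      using dv_add[OF dv_mult[OF sum of_int_mem] dv_mult2[OF l(2), of "of_int u * x"]] x by simp
    also have "of_int v * (of_int (r x) * x + (\<Sum>b\<in>B. of_int (r b) * b)) + of_nat l * (of_int u * x)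
      = (of_int u * of_nat l + of_int v * of_int (r x)) * x + of_int v * (\<Sum>b\<in>B. of_int (r b) * b)"
      by (simp add: algebra_simps)
    also have "\<dots> = x - (\<Sum>b\<in>B. of_int (- v * r b) * b)"
      by (subst uv'[symmetric]) (simp add: sum_distrib_left sum_negf mult.assoc)
    finally show ?thesis by (rule exI[of _ "\<lambda>b. - v * r b"])
  qed
  \<comment> \<open>Coefficients may be reduced modulo \<open>l\<close>, since \<open>p\<close>
    divides \<open>l\<close>; only finitely many coefficient functions remain.\<close>
  have "residues p \<subseteq> (\<lambda>c. residue p (\<Sum>b\<in>B. of_int (c b) * b)) ` ({c. c \<in> B \<rightarrow> {0..<int l} \<and> (\<forall>b. b \<notin> B \<longrightarrow> c b = 0)})"
  proof
    fix A assume "A \<in> residues p"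
    then obtain x where x: "x \<in> R" "A = residue p x" unfolding residues_def by auto
    obtain c :: "'k \<Rightarrow> int" where c: "p \<preceq> x - (\<Sum>b\<in>B. of_int (c b) * b)" using span x by blast
    define c' where "c' b = (if b \<in> B then c b mod int l else 0)" for b
    have "p \<preceq> (\<Sum>b\<in>B. of_int (c b) * b) - (\<Sum>b\<in>B. of_int (c' b) * b)"
    proof -
      have "(\<Sum>b\<in>B. of_int (c b) * b) - (\<Sum>b\<in>B. of_int (c' b) * b) = (\<Sum>b\<in>B. of_nat l * (of_int (c b div int l) * b))"
        unfolding sum_subtractf[symmetric]
      proof (rule sum.cong)
        fix b assume "b \<in> B"
        have "(of_int (c b) :: 'k) = of_nat l * of_int (c b div int l) + of_int (c b mod int l)"
          by (metis mult_div_mod_eq of_int_add of_int_mult of_int_of_nat_eq)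
        hence "of_int (c b) * b = (of_nat l * of_int (c b div int l) + of_int (c b mod int l)) * b" by (rule arg_cong)
        thus "of_int (c b) * b - of_int (c' b) * b = of_nat l * (of_int (c b div int l) * b)"
          using \<open>b \<in> B\<close> unfolding c'_def by (simp add: distrib_right mult.assoc)
      qed simp
      moreover have "p \<preceq> (\<Sum>b\<in>B. of_nat l * (of_int (c b div int l) * b))"
        unfolding sum_distrib_left[symmetric] using BR by (intro dv_mult2[OF l(2)] sum_mem) auto
      ultimately show ?thesis by simp
    qed
    hence "p \<preceq> x - (\<Sum>b\<in>B. of_int (c' b) * b)" using dv_add[OF c] by fastforce
    hence "A = residue p (\<Sum>b\<in>B. of_int (c' b) * b)" using residue_eq_iff[OF x(1) comb] x by blast
    moreover have "c' \<in> {c. c \<in> B \<rightarrow> {0..<int l} \<and> (\<forall>b. b \<notin> B \<longrightarrow> c b = 0)}" using l0 by (auto simp: c'_def)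
    ultimately show "A \<in> (\<lambda>c. residue p (\<Sum>b\<in>B. of_int (c b) * b)) ` ({c. c \<in> B \<rightarrow> {0..<int l} \<and> (\<forall>b. b \<notin> B \<longrightarrow> c b = 0)})"
      by blast
  qed
  moreover have "finite {c :: 'k \<Rightarrow> int. c \<in> B \<rightarrow> {0..<int l} \<and> (\<forall>b. b \<notin> B \<longrightarrow> c b = 0)}"
    by (rule finite_subset[OF _ finite_set_of_finite_funs[OF fB, of "{0..<int l}" 0]]) auto
  ultimately show ?thesis by (rule finite_surj[rotated])
qed

end

section \<open>Conjugation and norm\<close>

lemma a_inv_real: "\<ominus>\<^bsub>ring_of_type_algebra\<^esub> x = - (x :: real)"
proof -
  interpret Ring.ring "ring_of_type_algebra :: real ring" by (rule ring_from_type_algebra)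
  show ?thesis by (rule minus_equality) (simp_all add: ring_of_type_algebra_def)
qed

locale quaternions =
  fixes \<iota> :: "'k::field_char_0 \<Rightarrow> 'q::ring_1" and a b :: 'k and i j :: 'q
  assumes quaternion_algebra: "quaternion_algebra \<iota> a b i j"
begin

lemma \<iota>_hom: "\<iota> \<in> ring_hom ring_of_type_algebra ring_of_type_algebra"
  and \<iota>_central: "\<iota> c * q = q * \<iota> c"
  and ab_nz [simp]: "a \<noteq> 0" "b \<noteq> 0"
  and ii [simp]: "i * i = \<iota> a" and jj [simp]: "j * j = \<iota> b" and ji: "j * i = - (i * j)"
  and bij_quat_of: "bij (quat_of \<iota> i j)"
  using quaternion_algebra unfolding quaternion_algebra_def by blast+

lemma \<iota>_add: "\<iota> (x + y) = \<iota> x + \<iota> y"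
  and \<iota>_mult: "\<iota> (x * y) = \<iota> x * \<iota> y"
  and \<iota>_1 [simp]: "\<iota> 1 = 1"
  using \<iota>_hom unfolding ring_hom_def ring_of_type_algebra_def by auto

lemma \<iota>_0 [simp]: "\<iota> 0 = 0"
  using \<iota>_add[of 0 0] by simp

lemma \<iota>_minus: "\<iota> (- x) = - \<iota> x"
  using \<iota>_add[of x "- x"] by (simp add: eq_neg_iff_add_eq_0 add.commute)

lemma \<iota>_diff: "\<iota> (x - y) = \<iota> x - \<iota> y"
  using \<iota>_add[of x "- y"] by (simp add: \<iota>_minus)

definition coords :: "'q \<Rightarrow> 'k \<times> 'k \<times> 'k \<times> 'k" where
  "coords = inv_into UNIV (quat_of \<iota> i j)"

definition c0 :: "'q \<Rightarrow> 'k" where "c0 q = fst (coords q)"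
definition c1 :: "'q \<Rightarrow> 'k" where "c1 q = fst (snd (coords q))"
definition c2 :: "'q \<Rightarrow> 'k" where "c2 q = fst (snd (snd (coords q)))"
definition c3 :: "'q \<Rightarrow> 'k" where "c3 q = snd (snd (snd (coords q)))"

lemma quat_of_coords: "quat_of \<iota> i j (c0 q, c1 q, c2 q, c3 q) = q"
  unfolding c0_def c1_def c2_def c3_def coords_def
  using bij_quat_of by (simp add: bij_is_surj surj_f_inv_f)

lemma coords_expand: "q = \<iota> (c0 q) + \<iota> (c1 q) * i + \<iota> (c2 q) * j + \<iota> (c3 q) * (i * j)"
  using quat_of_coords[of q] unfolding quat_of_def by simp

lemma coords_quat_of:
  "c0 (quat_of \<iota> i j (t, x, y, z)) = t" "c1 (quat_of \<iota> i j (t, x, y, z)) = x"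
  "c2 (quat_of \<iota> i j (t, x, y, z)) = y" "c3 (quat_of \<iota> i j (t, x, y, z)) = z"
  unfolding c0_def c1_def c2_def c3_def coords_def
  using bij_quat_of by (simp_all add: bij_is_inj)

lemma coordsI:
  assumes "q = \<iota> t + \<iota> x * i + \<iota> y * j + \<iota> z * (i * j)"
  shows "c0 q = t" "c1 q = x" "c2 q = y" "c3 q = z"
  using coords_quat_of[of t x y z] assms unfolding quat_of_def by simp_all

lemma coords_eqI:
  "\<lbrakk>c0 p = c0 q; c1 p = c1 q; c2 p = c2 q; c3 p = c3 q\<rbrakk> \<Longrightarrow> p = q"
  by (metis quat_of_coords)

lemma coords_add [simp]:
  "c0 (p + q) = c0 p + c0 q" "c1 (p + q) = c1 p + c1 q"
  "c2 (p + q) = c2 p + c2 q" "c3 (p + q) = c3 p + c3 q"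
proof -
  have "p + q = \<iota> (c0 p + c0 q) + \<iota> (c1 p + c1 q) * i + \<iota> (c2 p + c2 q) * j + \<iota> (c3 p + c3 q) * (i * j)"
    by (subst coords_expand[of p], subst coords_expand[of q]) (simp add: \<iota>_add distrib_right)
  from coordsI[OF this] show
    "c0 (p + q) = c0 p + c0 q" "c1 (p + q) = c1 p + c1 q"
    "c2 (p + q) = c2 p + c2 q" "c3 (p + q) = c3 p + c3 q" by simp_all
qed

lemma coords_\<iota> [simp]: "c0 (\<iota> c) = c" "c1 (\<iota> c) = 0" "c2 (\<iota> c) = 0" "c3 (\<iota> c) = 0"
  using coordsI[of "\<iota> c" c 0 0 0] by simp_all

lemma coords_0 [simp]: "c0 0 = 0" "c1 0 = 0" "c2 0 = 0" "c3 0 = 0"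
  using coords_\<iota>[of 0] by simp_all

lemma coords_1 [simp]: "c0 1 = 1" "c1 1 = 0" "c2 1 = 0" "c3 1 = 0"
  using coords_\<iota>[of 1] by simp_all

lemma coords_i [simp]: "c0 i = 0" "c1 i = 1" "c2 i = 0" "c3 i = 0"
  using coordsI[of i 0 1 0 0] by simp_all

lemma coords_j [simp]: "c0 j = 0" "c1 j = 0" "c2 j = 1" "c3 j = 0"
  using coordsI[of j 0 0 1 0] by simp_all

lemma coords_minus [simp]: "c0 (- q) = - c0 q" "c1 (- q) = - c1 q" "c2 (- q) = - c2 q" "c3 (- q) = - c3 q"
  using coords_add[of q "- q"] by (simp_all add: eq_neg_iff_add_eq_0 add.commute)

lemma coords_diff [simp]:
  "c0 (p - q) = c0 p - c0 q" "c1 (p - q) = c1 p - c1 q"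
  "c2 (p - q) = c2 p - c2 q" "c3 (p - q) = c3 p - c3 q"
  using coords_add[of p "- q"] by simp_all

lemma \<iota>_mult_mult: "(\<iota> x * u) * (\<iota> y * v) = \<iota> (x * y) * (u * v)"
  by (metis \<iota>_central \<iota>_mult mult.assoc)

lemma basis_mult:
  "i * (i * j) = \<iota> a * j" "j * (i * j) = - (\<iota> b * i)" "(i * j) * i = - (\<iota> a * j)"
  "(i * j) * j = \<iota> b * i" "(i * j) * (i * j) = - \<iota> (a * b)"
proof -
  show 1: "i * (i * j) = \<iota> a * j" by (simp flip: mult.assoc)
  have "j * (i * j) = - (i * j) * j" by (simp flip: mult.assoc add: ji)
  thus 2: "j * (i * j) = - (\<iota> b * i)" by (simp add: mult.assoc \<iota>_central)
  have "(i * j) * i = i * - (i * j)" by (simp add: mult.assoc ji)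
  thus 3: "(i * j) * i = - (\<iota> a * j)" by (simp add: 1)
  show 4: "(i * j) * j = \<iota> b * i" by (simp add: mult.assoc \<iota>_central)
  have "(i * j) * (i * j) = i * (j * (i * j))" by (simp add: mult.assoc)
  also have "\<dots> = - (i * (\<iota> b * i))" by (simp add: 2)
  also have "i * (\<iota> b * i) = \<iota> b * (i * i)" by (metis \<iota>_central mult.assoc)
  also have "\<dots> = \<iota> (a * b)" by (metis \<iota>_mult \<iota>_central ii)
  finally show "(i * j) * (i * j) = - \<iota> (a * b)" .
qed

lemma coords_scale_left [simp]:
  "c0 (\<iota> c * q) = c * c0 q" "c1 (\<iota> c * q) = c * c1 q" "c2 (\<iota> c * q) = c * c2 q" "c3 (\<iota> c * q) = c * c3 q"
proof -
  have "\<iota> c * q = \<iota> (c * c0 q) + \<iota> (c * c1 q) * i + \<iota> (c * c2 q) * j + \<iota> (c * c3 q) * (i * j)"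
    by (subst coords_expand[of q]) (simp only: distrib_left \<iota>_mult mult.assoc)
  from coordsI[OF this] show
    "c0 (\<iota> c * q) = c * c0 q" "c1 (\<iota> c * q) = c * c1 q" "c2 (\<iota> c * q) = c * c2 q" "c3 (\<iota> c * q) = c * c3 q"
    by simp_all
qed

lemma coords_ij [simp]: "c0 (i * j) = 0" "c1 (i * j) = 0" "c2 (i * j) = 0" "c3 (i * j) = 1"
  using coordsI[of "i * j" 0 0 0 1] by simp_all

lemma coords_mult:
  "c0 (p * q) = c0 p * c0 q + a * (c1 p * c1 q) + b * (c2 p * c2 q) - a * b * (c3 p * c3 q)"
  "c1 (p * q) = c0 p * c1 q + c1 p * c0 q + b * (c3 p * c2 q - c2 p * c3 q)"
  "c2 (p * q) = c0 p * c2 q + c2 p * c0 q + a * (c1 p * c3 q - c3 p * c1 q)"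
  "c3 (p * q) = c0 p * c3 q + c3 p * c0 q + (c1 p * c2 q - c2 p * c1 q)"
proof -
  have e: "r = \<iota> (c0 r) * 1 + \<iota> (c1 r) * i + \<iota> (c2 r) * j + \<iota> (c3 r) * (i * j)" for r
    using coords_expand[of r] by simp
  have "p * q = (\<iota> (c0 p) * 1 + \<iota> (c1 p) * i + \<iota> (c2 p) * j + \<iota> (c3 p) * (i * j)) *
    (\<iota> (c0 q) * 1 + \<iota> (c1 q) * i + \<iota> (c2 q) * j + \<iota> (c3 q) * (i * j))"
    using e[of p] e[of q] by presburger
  note pq = this[unfolded distrib_left distrib_right \<iota>_mult_mult, unfolded mult_1_left mult_1_right basis_mult ii jj ji]
  show
  "c0 (p * q) = c0 p * c0 q + a * (c1 p * c1 q) + b * (c2 p * c2 q) - a * b * (c3 p * c3 q)"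
  "c1 (p * q) = c0 p * c1 q + c1 p * c0 q + b * (c3 p * c2 q - c2 p * c3 q)"
  "c2 (p * q) = c0 p * c2 q + c2 p * c0 q + a * (c1 p * c3 q - c3 p * c1 q)"
  "c3 (p * q) = c0 p * c3 q + c3 p * c0 q + (c1 p * c2 q - c2 p * c1 q)"
    unfolding pq by (simp_all add: algebra_simps)
qed

lemma coords_scale_right [simp]:
  "c0 (q * \<iota> c) = c * c0 q" "c1 (q * \<iota> c) = c * c1 q" "c2 (q * \<iota> c) = c * c2 q" "c3 (q * \<iota> c) = c * c3 q"
  by (simp_all add: coords_mult mult.commute)

definition Tr :: "'q \<Rightarrow> 'k" where "Tr q = 2 * c0 q"

definition cj :: "'q \<Rightarrow> 'q" where "cj q = \<iota> (Tr q) - q"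

text \<open>The reduced norm as a polynomial in the coordinates; \<open>nrd_eq\<close> identifies it
  with \<open>nrd\<close>.\<close>

definition N :: "'q \<Rightarrow> 'k" where
  "N q = (c0 q)\<^sup>2 - a * (c1 q)\<^sup>2 - b * (c2 q)\<^sup>2 + a * b * (c3 q)\<^sup>2"

lemma coords_cj [simp]: "c0 (cj q) = c0 q" "c1 (cj q) = - c1 q" "c2 (cj q) = - c2 q" "c3 (cj q) = - c3 q"
  by (simp_all add: cj_def Tr_def)

lemma \<iota>_inj: "\<iota> x = \<iota> y \<longleftrightarrow> x = y"
  using coords_\<iota>(1) by metis

lemma mult_cj: "q * cj q = \<iota> (N q)" and cj_mult_self: "cj q * q = \<iota> (N q)"
  by (rule coords_eqI; simp add: coords_mult N_def power2_eq_square algebra_simps)+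

lemma cj_mult: "cj (p * q) = cj q * cj p"
  by (rule coords_eqI; simp add: coords_mult algebra_simps)

lemma cj_diff: "cj (p - q) = cj p - cj q"
  and cj_\<iota> [simp]: "cj (\<iota> c) = \<iota> c"
  and cj_scale: "cj (\<iota> c * q) = \<iota> c * cj q"
  by (rule coords_eqI; simp)+

lemma add_cj: "q + cj q = \<iota> (Tr q)"
  by (simp add: cj_def)

lemma N_cj [simp]: "N (cj q) = N q"
  by (simp add: N_def)

lemma N_\<iota> [simp]: "N (\<iota> c) = c\<^sup>2"
  by (simp add: N_def)

lemma N_1 [simp]: "N 1 = 1"
  by (simp add: N_def)

lemma N_mult: "N (p * q) = N p * N q"
proof -
  have "\<iota> (N (p * q)) = p * (q * cj q) * cj p"
    by (simp only: mult_cj[symmetric] cj_mult mult.assoc)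
  also have "\<dots> = \<iota> (N q) * (p * cj p)" by (metis mult_cj \<iota>_central mult.assoc)
  also have "\<dots> = \<iota> (N p * N q)" by (metis mult_cj \<iota>_mult \<iota>_central)
  finally show ?thesis by (simp add: \<iota>_inj)
qed

lemma N_scale: "N (\<iota> c * q) = c\<^sup>2 * N q"
  by (simp add: N_mult)

lemma N_minus [simp]: "N (- q) = N q"
  by (simp add: N_def)

lemma N_add: "N (p + q) = N p + N q + Tr (p * cj q)"
  by (simp add: N_def Tr_def coords_mult power2_eq_square algebra_simps)

lemma Tr_add: "Tr (p + q) = Tr p + Tr q"
  and Tr_diff: "Tr (p - q) = Tr p - Tr q"
  and Tr_scale: "Tr (\<iota> c * q) = c * Tr q"
  and Tr_\<iota>: "Tr (\<iota> c) = 2 * c"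
  and Tr_cj: "Tr (cj q) = Tr q"
  by (simp_all add: Tr_def coords_mult algebra_simps)

lemma Tr_eq_N: "Tr q = N (1 + q) - 1 - N q"
  by (simp add: N_def Tr_def power2_eq_square algebra_simps)

text \<open>Follows from q p = Tr(q p) - cj p cj q. When the outer factor has norm 0 modulo a prime,
  e w e becomes the multiple Tr(e w) e of e, which makes the diagonal corners
  one-dimensional.\<close>

lemma mult_mult_self: "p * q * p = \<iota> (Tr (p * q)) * p - \<iota> (N p) * cj q"
  by (rule coords_eqI; simp add: coords_mult N_def Tr_def power2_eq_square algebra_simps)

lemma square_eq: "q * q = \<iota> (Tr q) * q - \<iota> (N q)"
  by (rule coords_eqI; simp add: coords_mult N_def Tr_def power2_eq_square algebra_simps)

lemma nrd_eq [simp]: "nrd \<iota> i j q = N q"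
proof -
  have c: "quat_of \<iota> i j (c0 q, - c1 q, - c2 q, - c3 q) = cj q"
    by (rule coords_eqI) (simp_all add: coords_quat_of)
  show ?thesis unfolding nrd_def
  proof (rule the_equality)
    show "\<exists>t x y z. q = quat_of \<iota> i j (t, x, y, z) \<and> \<iota> (N q) = q * quat_of \<iota> i j (t, - x, - y, - z)"
      using quat_of_coords[of q] c mult_cj[of q] by metis
    show "n = N q"
      if "\<exists>t x y z. q = quat_of \<iota> i j (t, x, y, z) \<and> \<iota> n = q * quat_of \<iota> i j (t, - x, - y, - z)" for n
      using that coords_quat_of c mult_cj[of q] \<iota>_inj by metis
  qed
qed

lemma N_nonzero_inverse:
  assumes "N q \<noteq> 0"
  shows "q * (\<iota> (inverse (N q)) * cj q) = 1" "(\<iota> (inverse (N q)) * cj q) * q = 1"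
proof -
  have "q * (\<iota> (inverse (N q)) * cj q) = \<iota> (inverse (N q)) * (q * cj q)" by (metis \<iota>_central mult.assoc)
  thus "q * (\<iota> (inverse (N q)) * cj q) = 1" using assms by (simp add: mult_cj flip: \<iota>_mult)
  show "(\<iota> (inverse (N q)) * cj q) * q = 1" using assms by (simp add: mult.assoc cj_mult_self flip: \<iota>_mult)
qed

lemma unit_N_nonzero: "p * q = 1 \<Longrightarrow> N p \<noteq> 0"
  using N_mult[of p q] by auto

lemma N_cancel: "N p \<noteq> 0 \<Longrightarrow> p * x = p * y \<Longrightarrow> x = y"
  using N_nonzero_inverse(2)[of p] by (metis mult.assoc mult_1_left)

lemma \<iota>_cancel: "c \<noteq> 0 \<Longrightarrow> \<iota> c * x = \<iota> c * y \<Longrightarrow> x = y"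
  using N_cancel[of "\<iota> c"] by simp

text \<open>If \<open>\<sigma> a\<close> or \<open>\<sigma> b\<close> were positive, a generator
  would go to a Hamilton quaternion with positive real square, hence to a real number, against the
  injectivity of an isomorphism that fixes the reals. So both are negative and the norm form is a
  sum of nonnegative terms.\<close>

lemma definite_N_pos:
  assumes "definite a b" "\<sigma> \<in> real_embeddings" "N q \<noteq> 0"
  shows "\<sigma> (N q) > 0"
proof -
  have \<sigma>_add: "\<sigma> (x + y) = \<sigma> x + \<sigma> y" and \<sigma>_mult: "\<sigma> (x * y) = \<sigma> x * \<sigma> y" and \<sigma>_1: "\<sigma> 1 = 1" for x y
    using assms(2) unfolding real_embeddings_def ring_hom_def ring_of_type_algebra_def by auto
  have \<sigma>_0: "\<sigma> 0 = 0" using \<sigma>_add[of 0 0] by simp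
  have \<sigma>_minus: "\<sigma> (- x) = - \<sigma> x" for x using \<sigma>_add[of x "- x"] \<sigma>_0 by simp
  have \<sigma>_nz: "\<sigma> x \<noteq> 0" if "x \<noteq> 0" for x using \<sigma>_mult[of x "inverse x"] that \<sigma>_1 by auto
  let ?Q = "base_change (ring_of_type_algebra :: real ring) \<sigma> a b"
  obtain h where h: "h \<in> ring_iso ?Q hamilton_quaternions" and hc: "\<And>c. h (c, 0, 0, 0) = (c, 0, 0, 0)"
    using assms unfolding definite_def by blast
  have UNIV: "carrier ?Q = UNIV"
    unfolding base_change_def quat_ring_def ring_of_type_algebra_def by simp
  have h_inj: "inj h" using h UNIV unfolding ring_iso_def bij_betw_def by simp
  have h_mult: "h (x \<otimes>\<^bsub>?Q\<^esub> y) = h x \<otimes>\<^bsub>hamilton_quaternions\<^esub> h y" for x y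
    using h UNIV ring_hom_mult[of h ?Q hamilton_quaternions x y] unfolding ring_iso_def by simp
  note defs = base_change_def hamilton_quaternions_def quat_ring_def ring_of_type_algebra_def
  have mQ: "(t1, x1, y1, z1) \<otimes>\<^bsub>?Q\<^esub> (t2, x2, y2, z2) =
      (t1 * t2 + \<sigma> a * (x1 * x2) + \<sigma> b * (y1 * y2) - \<sigma> a * \<sigma> b * (z1 * z2),
       t1 * x2 + x1 * t2 + \<sigma> b * (z1 * y2 - y1 * z2),
       t1 * y2 + y1 * t2 + \<sigma> a * (x1 * z2 - z1 * x2),
       t1 * z2 + z1 * t2 + (x1 * y2 - y1 * x2))" for t1 x1 y1 z1 t2 x2 y2 z2
    by (simp add: defs a_minus_def a_inv_real[unfolded ring_of_type_algebra_def])
  have mH: "(t1, x1, y1, z1) \<otimes>\<^bsub>hamilton_quaternions\<^esub> (t2, x2, y2, z2) =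
      (t1 * t2 - x1 * x2 - y1 * y2 - z1 * z2,
       t1 * x2 + x1 * t2 - (z1 * y2 - y1 * z2),
       t1 * y2 + y1 * t2 - (x1 * z2 - z1 * x2),
       t1 * z2 + z1 * t2 + (x1 * y2 - y1 * x2))" for t1 x1 y1 z1 t2 x2 y2 z2
    by (simp add: defs a_minus_def a_inv_real[unfolded ring_of_type_algebra_def])
  text \<open>A Hamilton quaternion whose square is a positive real number is real.\<close>
  have sq: "False" if "h v \<otimes>\<^bsub>hamilton_quaternions\<^esub> h v = (s\<^sup>2, 0, 0, 0)" "v \<noteq> (s, 0, 0, 0)" "v \<noteq> (- s, 0, 0, 0)" "s \<noteq> 0" for v s
  proof -
    obtain t x y z where hv: "h v = (t, x, y, z)" by (cases "h v")
    have e: "t * t - x * x - y * y - z * z = s\<^sup>2" "t * x = 0" "t * y = 0" "t * z = 0"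
      using that(1) unfolding hv mH by (auto simp: mult.commute)
    show False
    proof (cases "t = 0")
      case True
      have "s\<^sup>2 > 0" using that(4) by simp
      moreover have "x * x \<ge> 0" "y * y \<ge> 0" "z * z \<ge> 0" by simp_all
      moreover have "t * t = 0" using True by simp
      ultimately show False using e(1) by linarith
    next
      case False
      hence "x = 0" "y = 0" "z = 0" "t * t = s\<^sup>2" using e by auto
      hence "t = s \<or> t = - s" "h v = (t, 0, 0, 0)" using hv by (auto simp: power2_eq_square square_eq_iff)
      hence "h v = h (s, 0, 0, 0) \<or> h v = h (- s, 0, 0, 0)" using hc by auto
      thus False using that(2,3) h_inj by (auto dest: injD)
    qed
  qed
  have neg_a: "\<sigma> a < 0"
  proof (rule ccontr)
    assume "\<not> \<sigma> a < 0"
    hence p: "\<sigma> a > 0" using \<sigma>_nz[of a] by simp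
    have "h (0, 1, 0, 0) \<otimes>\<^bsub>hamilton_quaternions\<^esub> h (0, 1, 0, 0) = ((sqrt (\<sigma> a))\<^sup>2, 0, 0, 0)"
      unfolding h_mult[symmetric] mQ using p by (simp add: hc)
    from sq[OF this] p show False by simp
  qed
  have neg_b: "\<sigma> b < 0"
  proof (rule ccontr)
    assume "\<not> \<sigma> b < 0"
    hence p: "\<sigma> b > 0" using \<sigma>_nz[of b] by simp
    have "h (0, 0, 1, 0) \<otimes>\<^bsub>hamilton_quaternions\<^esub> h (0, 0, 1, 0) = ((sqrt (\<sigma> b))\<^sup>2, 0, 0, 0)"
      unfolding h_mult[symmetric] mQ using p by (simp add: hc)
    from sq[OF this] p show False by simp
  qed
  have \<sigma>_diff: "\<sigma> (x - y) = \<sigma> x - \<sigma> y" for x y using \<sigma>_add[of x "- y"] \<sigma>_minus by simp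
  have "\<sigma> (N q) = (\<sigma> (c0 q))\<^sup>2 + - \<sigma> a * (\<sigma> (c1 q))\<^sup>2 + - \<sigma> b * (\<sigma> (c2 q))\<^sup>2 + \<sigma> a * \<sigma> b * (\<sigma> (c3 q))\<^sup>2"
    unfolding N_def by (simp add: \<sigma>_add \<sigma>_diff \<sigma>_mult power2_eq_square)
  moreover have "\<dots> \<ge> 0"
    using neg_a neg_b by (intro add_nonneg_nonneg mult_nonneg_nonneg mult_nonpos_nonpos) auto
  ultimately show ?thesis using \<sigma>_nz[OF assms(3)] by linarith
qed

end

section \<open>Binary quadratic forms over a finite residue field\<close>

context pid_in_field
begin

text \<open>A map that identifies at most \<open>c\<close> with \<open>- c\<close> modulo
  \<open>p\<close> has fibres of at most two classes, and the class of 0 is alone in its fibre. That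
  class yields the \<open>+ 1\<close>, without which two such images could be disjoint.\<close>

lemma card_residues_le_twice:
  assumes "finite (residues p)" "\<And>c. c \<in> R \<Longrightarrow> f c \<in> R"
    and two: "\<And>c d. c \<in> R \<Longrightarrow> d \<in> R \<Longrightarrow> p \<preceq> f c - f d \<Longrightarrow> p \<preceq> c - d \<or> p \<preceq> c + d"
  shows "card (residues p) + 1 \<le> 2 * card ((\<lambda>c. residue p (f c)) ` R)"
proof -
  define rep where "rep A = (SOME x. x \<in> R \<and> residue p x = A)" for A
  have rep: "rep A \<in> R" "residue p (rep A) = A" if "A \<in> residues p" for A
  proof -
    have "\<exists>x. x \<in> R \<and> residue p x = A" using that unfolding residues_def by auto
    from someI_ex[OF this] show "rep A \<in> R" "residue p (rep A) = A" unfolding rep_def by auto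
  qed
  define g where "g A = residue p (f (rep A))" for A
  define S where "S = g ` residues p"
  have S: "S \<subseteq> (\<lambda>c. residue p (f c)) ` R" unfolding S_def g_def using rep by auto
  have "(\<lambda>c. residue p (f c)) ` R \<subseteq> residues p" using assms(2) unfolding residues_def by auto
  hence fin: "finite ((\<lambda>c. residue p (f c)) ` R)" using assms(1) finite_subset by blast
  have fS: "finite S" unfolding S_def using assms(1) by simp
  have fib: "A = B \<or> A = residue p (- rep B)" if "A \<in> residues p" "B \<in> residues p" "g A = g B" for A B
  proof -
    have "p \<preceq> f (rep A) - f (rep B)" using that residue_eq_iff assms(2) rep unfolding g_def by simp
    hence "p \<preceq> rep A - rep B \<or> p \<preceq> rep A - - rep B" using two rep that by simp
    thus ?thesis using residue_eq_iff[of "rep A" "rep B" p] residue_eq_iff[of "rep A" "- rep B" p] rep that by auto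
  qed
  have two': "card {A \<in> residues p. g A = s} \<le> 2" if s: "s \<in> S" for s
  proof -
    obtain B where B: "B \<in> residues p" "s = g B" using s unfolding S_def by auto
    have "{A \<in> residues p. g A = s} \<subseteq> {B, residue p (- rep B)}" using fib B by auto
    hence "card {A \<in> residues p. g A = s} \<le> card {B, residue p (- rep B)}" by (rule card_mono[rotated]) simp
    also have "\<dots> \<le> 2" by (simp add: card_insert_if)
    finally show ?thesis .
  qed
  define Z where "Z = residue p 0"
  have Z: "Z \<in> residues p" unfolding Z_def residues_def by auto
  have "{A \<in> residues p. g A = g Z} \<subseteq> {Z}"
  proof
    fix A assume "A \<in> {A \<in> residues p. g A = g Z}"
    hence "A = Z \<or> A = residue p (- rep Z)" using fib Z by blast
    moreover have "residue p (- rep Z) = Z"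
    proof -
      have "p \<preceq> rep Z - 0" using rep[OF Z] residue_eq_iff[of "rep Z" 0 p] unfolding Z_def by simp
      hence "p \<preceq> - rep Z - 0" using dv_uminus[of p "rep Z"] by simp
      thus ?thesis using residue_eq_iff[of "- rep Z" 0 p] rep[OF Z] by (simp add: Z_def[symmetric])
    qed
    ultimately show "A \<in> {Z}" by auto
  qed
  hence one: "card {A \<in> residues p. g A = g Z} \<le> 1" using card_mono[of "{Z}"] by simp
  have gZ: "g Z \<in> S" using Z unfolding S_def by auto
  have "residues p = (\<Union>s\<in>S. {A \<in> residues p. g A = s})" unfolding S_def by auto
  hence "card (residues p) = (\<Sum>s\<in>S. card {A \<in> residues p. g A = s})"
    using card_UN_disjoint[of S "\<lambda>s. {A \<in> residues p. g A = s}"] fS assms(1) by fastforce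
  also have "\<dots> = card {A \<in> residues p. g A = g Z} + (\<Sum>s\<in>S - {g Z}. card {A \<in> residues p. g A = s})"
    using sum.remove[OF fS gZ] by simp
  also have "\<dots> \<le> 1 + (\<Sum>s\<in>S - {g Z}. 2)" using one two' by (intro add_mono sum_mono) auto
  also have "\<dots> = 1 + 2 * (card S - 1)" using fS gZ by simp
  finally have "card (residues p) + 1 \<le> 2 * card S" using fS gZ by (cases "card S") (auto simp: card_eq_0_iff)
  also have "card S \<le> card ((\<lambda>c. residue p (f c)) ` R)" using S fin by (rule card_mono[rotated])
  finally show ?thesis by simp
qed

text \<open>Pigeonhole: the squares and the values - w - n d^2 each fill more than half of the
  residue classes, so they share one. Primes above 2 are included.\<close>

lemma binary_form_universal:
  assumes p: "prm p" and fin: "finite (residues p)" and n: "n \<in> R" "\<not> p \<preceq> n" and w: "w \<in> R"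
  obtains c d where "c \<in> R" "d \<in> R" "p \<preceq> c\<^sup>2 + n * d\<^sup>2 + w"
proof -
  let ?f = "\<lambda>c. c\<^sup>2" and ?g = "\<lambda>d. - w - n * d\<^sup>2"
  have diff: "p \<preceq> c - d \<or> p \<preceq> c + d" if "c \<in> R" "d \<in> R" "p \<preceq> c\<^sup>2 - d\<^sup>2" for c d
  proof -
    have "c\<^sup>2 - d\<^sup>2 = (c - d) * (c + d)" by (simp add: power2_eq_square algebra_simps)
    thus ?thesis using that p prm_dv_mult[of p "c - d" "c + d"] by simp
  qed
  let ?S = "(\<lambda>c. residue p (?f c)) ` R" and ?T = "(\<lambda>c. residue p (?g c)) ` R"
  have S: "card (residues p) + 1 \<le> 2 * card ?S"
    by (rule card_residues_le_twice[OF fin]) (use diff in auto)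
  have T: "card (residues p) + 1 \<le> 2 * card ?T"
  proof (rule card_residues_le_twice[OF fin])
    show "- w - n * c\<^sup>2 \<in> R" if "c \<in> R" for c using that n w by auto
    fix c d assume cd: "c \<in> R" "d \<in> R" "p \<preceq> - w - n * c\<^sup>2 - (- w - n * d\<^sup>2)"
    have "- w - n * c\<^sup>2 - (- w - n * d\<^sup>2) = - (n * (c\<^sup>2 - d\<^sup>2))" by (simp add: algebra_simps)
    hence "p \<preceq> n * (c\<^sup>2 - d\<^sup>2)" using cd(3) dv_uminus by fastforce
    moreover have "c\<^sup>2 - d\<^sup>2 \<in> R" using cd by auto
    ultimately have "p \<preceq> c\<^sup>2 - d\<^sup>2" using prm_dv_mult[OF p n(1)] n(2) by blast
    thus "p \<preceq> c - d \<or> p \<preceq> c + d" using diff cd by blast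
  qed
  have sub: "?S \<subseteq> residues p" "?T \<subseteq> residues p" using n w unfolding residues_def by auto
  have "?S \<inter> ?T \<noteq> {}"
  proof
    assume "?S \<inter> ?T = {}"
    hence "card ?S + card ?T = card (?S \<union> ?T)"
      using finite_subset[OF sub(1) fin] finite_subset[OF sub(2) fin] by (simp add: card_Un_disjoint)
    also have "\<dots> \<le> card (residues p)" using sub fin by (intro card_mono) auto
    finally show False using S T by linarith
  qed
  then obtain c d where "c \<in> R" "d \<in> R" "residue p (c\<^sup>2) = residue p (- w - n * d\<^sup>2)" by blast
  moreover from this have "p \<preceq> c\<^sup>2 - (- w - n * d\<^sup>2)" using residue_eq_iff[of "c\<^sup>2" "- w - n * d\<^sup>2" p] n w by auto
  hence "p \<preceq> c\<^sup>2 + n * d\<^sup>2 + w" by (simp add: algebra_simps)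
  ultimately show ?thesis using that by blast
qed

end

section \<open>Orders all of whose right ideals are principal\<close>

text \<open>\<open>H_principal\<close> and \<open>H_normalizer\<close> isolate what is used of class
  number 1 and maximality. By \<open>H_normalizer\<close>, conjugation with an invertible element
  cannot map \<open>H\<close> properly into itself; this makes a two-sided ideal \<open>y H\<close>
  equal to \<open>H y\<close>.\<close>

locale principal_order = number_ring R + quaternions \<iota> a b i j
  for R :: "'k::field_char_0 set" and \<iota> :: "'k \<Rightarrow> 'q::ring_1" and a b :: 'k and i j :: 'q +
  fixes H :: "'q set"
  assumes H_1 [simp, intro]: "1 \<in> H"
    and H_add [simp, intro]: "\<lbrakk>x \<in> H; y \<in> H\<rbrakk> \<Longrightarrow> x + y \<in> H"
    and H_mult [simp, intro]: "\<lbrakk>x \<in> H; y \<in> H\<rbrakk> \<Longrightarrow> x * y \<in> H"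
    and H_scale [simp, intro]: "\<lbrakk>c \<in> R; x \<in> H\<rbrakk> \<Longrightarrow> \<iota> c * x \<in> H"
    and H_denominator: "\<exists>d\<in>R. d \<noteq> 0 \<and> (\<forall>x\<in>H. d * c0 x \<in> R \<and> d * c1 x \<in> R \<and> d * c2 x \<in> R \<and> d * c3 x \<in> R)"
    and H_full: "\<exists>c\<in>R. c \<noteq> 0 \<and> \<iota> c * i \<in> H \<and> \<iota> c * j \<in> H"
    and H_principal: "\<lbrakk>L \<subseteq> H; \<And>x y. x \<in> L \<Longrightarrow> y \<in> L \<Longrightarrow> x + y \<in> L; \<And>x h. x \<in> L \<Longrightarrow> h \<in> H \<Longrightarrow> x * h \<in> L;
        c \<in> R; c \<noteq> 0; \<iota> c \<in> L\<rbrakk> \<Longrightarrow> \<exists>u. L = (*) u ` H"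
    and H_normalizer: "\<lbrakk>u * v = 1; \<And>h. h \<in> H \<Longrightarrow> u * h * v \<in> H; h \<in> H\<rbrakk> \<Longrightarrow> v * h * u \<in> H"
begin

lemma H_\<iota> [simp, intro]: "c \<in> R \<Longrightarrow> \<iota> c \<in> H"
  using H_scale[of c 1] by simp

lemma H_minus [simp, intro]: "x \<in> H \<Longrightarrow> - x \<in> H"
  using H_scale[of "- 1" x] by (simp add: \<iota>_minus)

lemma H_diff [simp, intro]: "x \<in> H \<Longrightarrow> y \<in> H \<Longrightarrow> x - y \<in> H"
  using H_add[OF _ H_minus, of x y] by simp

lemma H_0 [simp, intro]: "0 \<in> H"
  using H_\<iota>[OF zero_mem] by simp

lemma H_power [simp, intro]: "x \<in> H \<Longrightarrow> x ^ n \<in> H"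
  by (induction n) auto

lemma N_power: "N (x ^ n) = N x ^ n"
  by (induction n) (simp_all add: N_mult)

text \<open>All powers of \<open>x\<close> lie in \<open>H\<close>, and the norms of elements of
  \<open>H\<close> have a common denominator. So the powers of \<open>N x\<close> have one, and a
  principal ideal domain is completely integrally closed.\<close>

lemma N_mem [simp, intro]:
  assumes "x \<in> H"
  shows "N x \<in> R"
proof -
  obtain d where d: "d \<in> R" "d \<noteq> 0"
    "\<And>x. x \<in> H \<Longrightarrow> d * c0 x \<in> R \<and> d * c1 x \<in> R \<and> d * c2 x \<in> R \<and> d * c3 x \<in> R"
    using H_denominator by blast
  obtain e where e: "e \<in> R" "e \<noteq> 0" "\<forall>x\<in>{a, b, a * b}. e * x \<in> R"
    using common_denominator[of "{a, b, a * b}"] by auto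
  have eR: "e * a \<in> R" "e * b \<in> R" "e * (a * b) \<in> R" using e(3) by auto
  have "e * d\<^sup>2 * N y \<in> R" if "y \<in> H" for y
  proof -
    have "e * d\<^sup>2 * N y = e * (d * c0 y)\<^sup>2 - e * a * (d * c1 y)\<^sup>2 - e * b * (d * c2 y)\<^sup>2 + e * (a * b) * (d * c3 y)\<^sup>2"
      unfolding N_def by (simp add: algebra_simps power_mult_distrib)
    also have "\<dots> \<in> R" using d(3)[OF that] e(1) eR by auto
    finally show ?thesis .
  qed
  hence "e * d\<^sup>2 * N x ^ n \<in> R" for n using H_power[OF assms, of n] by (simp add: N_power[symmetric])
  thus ?thesis by (rule completely_integrally_closed[rotated]) (use d e in auto)
qed

lemma Tr_mem [simp, intro]: "x \<in> H \<Longrightarrow> Tr x \<in> R"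
  unfolding Tr_eq_N by auto

lemma cj_mem [simp, intro]: "x \<in> H \<Longrightarrow> cj x \<in> H"
  unfolding cj_def by auto

lemma unit_inverse_mem: "x \<in> H \<Longrightarrow> N x \<preceq> 1 \<Longrightarrow> \<exists>y\<in>H. x * y = 1 \<and> y * x = 1"
proof -
  assume x: "x \<in> H" "N x \<preceq> 1"
  then obtain c where c: "c \<in> R" "1 = N x * c" by (auto simp: dv_def)
  hence "c = inverse (N x)" by (metis inverse_unique)
  moreover have "N x \<noteq> 0" using c by auto
  ultimately show ?thesis using N_nonzero_inverse[of x] x c by (intro bexI[of _ "\<iota> c * cj x"]) auto
qed

section \<open>Right ideals of prime norm\<close>

definition mlt :: "'k \<Rightarrow> 'q set" where "mlt p = (\<lambda>h. \<iota> p * h) ` H"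

definition rid :: "'q \<Rightarrow> 'q set" where "rid y = (*) y ` H"

lemma mltI [intro?]: "h \<in> H \<Longrightarrow> x = \<iota> p * h \<Longrightarrow> x \<in> mlt p"
  unfolding mlt_def by blast

lemma mlt_0 [simp]: "0 \<in> mlt p"
  by (rule mltI[of 0]) auto

lemma mlt_add: "x \<in> mlt p \<Longrightarrow> y \<in> mlt p \<Longrightarrow> x + y \<in> mlt p"
  unfolding mlt_def by (auto simp flip: distrib_left)

lemma mlt_minus: "x \<in> mlt p \<Longrightarrow> - x \<in> mlt p"
  unfolding mlt_def by (auto simp flip: mult_minus_right)

lemma mlt_diff: "x \<in> mlt p \<Longrightarrow> y \<in> mlt p \<Longrightarrow> x - y \<in> mlt p"
  using mlt_add[OF _ mlt_minus, of x p y] by simp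

lemma mlt_right: "x \<in> mlt p \<Longrightarrow> y \<in> H \<Longrightarrow> x * y \<in> mlt p"
  unfolding mlt_def by (auto simp: mult.assoc)

lemma mlt_left: "x \<in> mlt p \<Longrightarrow> y \<in> H \<Longrightarrow> y * x \<in> mlt p"
proof -
  assume "x \<in> mlt p" "y \<in> H"
  then obtain h where "h \<in> H" "x = \<iota> p * h" unfolding mlt_def by blast
  hence "y * x = \<iota> p * (y * h)" by (metis \<iota>_central mult.assoc)
  thus ?thesis using \<open>h \<in> H\<close> \<open>y \<in> H\<close> by (intro mltI) auto
qed

lemma mlt_scale: "x \<in> mlt p \<Longrightarrow> c \<in> R \<Longrightarrow> \<iota> c * x \<in> mlt p"
  by (rule mlt_left) auto

lemma mlt_cj: "x \<in> mlt p \<Longrightarrow> cj x \<in> mlt p"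
  unfolding mlt_def by (auto simp: cj_scale)

lemma mlt_self: "h \<in> H \<Longrightarrow> \<iota> p * h \<in> mlt p"
  by (rule mltI) auto

lemma mlt_\<iota>: "p \<preceq> c \<Longrightarrow> h \<in> H \<Longrightarrow> \<iota> c * h \<in> mlt p"
  unfolding dv_def mlt_def by (auto simp: \<iota>_mult mult.assoc)

lemma mlt_H: "p \<in> R \<Longrightarrow> x \<in> mlt p \<Longrightarrow> x \<in> H"
  unfolding mlt_def by auto

lemma mlt_N: "x \<in> mlt p \<Longrightarrow> p\<^sup>2 \<preceq> N x"
  unfolding mlt_def dv_def by (auto simp: N_scale)

lemma mlt_Tr: "x \<in> mlt p \<Longrightarrow> p \<preceq> Tr x"
  unfolding mlt_def dv_def by (auto simp: Tr_scale)

lemma dv_N_add: "p \<preceq> N x \<Longrightarrow> y \<in> mlt p \<Longrightarrow> x \<in> H \<Longrightarrow> p \<in> R \<Longrightarrow> p \<preceq> N (x + y)"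
  unfolding N_add using mlt_N[of y p] mlt_Tr[OF mlt_left[OF mlt_cj], of y p x]
  by (intro dv_add) (auto intro: dv_trans[of p "p\<^sup>2"] simp: power2_eq_square)

lemma mlt_cancel:
  assumes p: "prm p" and c: "c \<in> R" "\<not> p \<preceq> c" and x: "x \<in> H" "\<iota> c * x \<in> mlt p"
  shows "x \<in> mlt p"
proof -
  obtain u v where uv: "u \<in> R" "v \<in> R" "u * c + v * p = 1" by (rule prm_bezout[OF p c])
  have "x = \<iota> (u * c + v * p) * x" using uv by simp
  also have "\<dots> = \<iota> u * (\<iota> c * x) + \<iota> v * (\<iota> p * x)" by (simp only: \<iota>_add \<iota>_mult distrib_right mult.assoc)
  also have "\<dots> \<in> mlt p" by (rule mlt_add[OF mlt_scale[OF x(2) uv(1)] mlt_scale[OF mlt_self[OF x(1)] uv(2)]])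
  finally show ?thesis .
qed

lemma rid_mem: "y * h \<in> rid y" if "h \<in> H"
  unfolding rid_def using that by blast

lemma rid_self: "y \<in> rid y"
  using rid_mem[OF H_1] by simp

lemma rid_add: "x \<in> rid y \<Longrightarrow> x' \<in> rid y \<Longrightarrow> x + x' \<in> rid y"
  unfolding rid_def by (auto simp flip: distrib_left)

lemma rid_minus: "x \<in> rid y \<Longrightarrow> - x \<in> rid y"
  unfolding rid_def by (auto simp flip: mult_minus_right)

lemma rid_diff: "x \<in> rid y \<Longrightarrow> x' \<in> rid y \<Longrightarrow> x - x' \<in> rid y"
  using rid_add[OF _ rid_minus, of x y x'] by simp

lemma rid_right: "x \<in> rid y \<Longrightarrow> h \<in> H \<Longrightarrow> x * h \<in> rid y"
  unfolding rid_def by (auto simp: mult.assoc)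

lemma rid_subset: "x \<in> rid y \<Longrightarrow> rid x \<subseteq> rid y"
  using rid_right unfolding rid_def[of x] by auto

lemma rid_unit: "u \<in> H \<Longrightarrow> N u \<preceq> 1 \<Longrightarrow> rid (y * u) = rid y"
proof
  assume u: "u \<in> H" "N u \<preceq> 1"
  then obtain v where "v \<in> H" "u * v = 1" using unit_inverse_mem by blast
  hence "y = (y * u) * v" by (simp add: mult.assoc)
  thus "rid y \<subseteq> rid (y * u)" using rid_mem[OF \<open>v \<in> H\<close>, of "y * u"] rid_subset by simp
  show "rid (y * u) \<subseteq> rid y" using rid_mem[OF u(1)] rid_subset by blast
qed

text \<open>The norm is prescribed only up to a unit, so the notion depends on the ideal generated
  by \<open>p\<close> alone; exact norms are restored in \<open>maxi_eq_ids\<close>.\<close>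

definition nrm :: "'k \<Rightarrow> 'q \<Rightarrow> bool" where
  "nrm p y \<longleftrightarrow> y \<in> H \<and> N y \<preceq> p \<and> p \<preceq> N y"

definition maxi :: "'k \<Rightarrow> 'q set set" where
  "maxi p = {rid y | y. nrm p y}"

lemma nrm_H: "nrm p y \<Longrightarrow> y \<in> H"
  unfolding nrm_def by blast

lemma nrm_dv_N: "nrm p y \<Longrightarrow> x \<in> rid y \<Longrightarrow> p \<preceq> N x"
  unfolding nrm_def rid_def by (auto simp: N_mult dv_mult2)

lemma mlt_subset_rid: "nrm p y \<Longrightarrow> mlt p \<subseteq> rid y"
proof
  fix x assume y: "nrm p y" and "x \<in> mlt p"
  then obtain h where h: "h \<in> H" "x = \<iota> p * h" unfolding mlt_def by blast
  obtain c where c: "c \<in> R" "p = N y * c" using y unfolding nrm_def dv_def by auto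
  have "\<iota> p = y * (\<iota> c * cj y)" unfolding c(2) by (metis \<iota>_mult mult_cj \<iota>_central mult.assoc)
  hence "x = y * (\<iota> c * cj y * h)" using h by (simp add: mult.assoc)
  thus "x \<in> rid y" using h c nrm_H[OF y] by (metis H_mult H_scale cj_mem rid_mem)
qed

lemma rid_eq_of_mem:
  assumes p: "prm p" and y: "nrm p y" "nrm p y'" and m: "y' \<in> rid y"
  shows "rid y' = rid y"
proof -
  obtain h where h: "h \<in> H" "y' = y * h" using m unfolding rid_def by auto
  have nz: "N y \<noteq> 0" using y(1) prm_nz[OF p] unfolding nrm_def dv_def by auto
  have "N y \<preceq> p" "p \<preceq> N y'" using y unfolding nrm_def by blast+
  moreover have "N y' \<preceq> N y" using y dv_trans unfolding nrm_def by blast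
  hence "N y * N h \<preceq> N y * 1" using h by (simp add: N_mult)
  hence "N h \<preceq> 1" using dv_mult_cancel[OF nz] by blast
  thus ?thesis using h rid_unit by simp
qed

text \<open>The ideal \<open>x H + p H\<close> is principal, say \<open>y H\<close>. All its
  elements have norm divisible by \<open>p\<close>, and \<open>p = y h\<close> gives N y N h = p^2.
  If p^2 divided N y, then \<open>h\<close> would be a unit and \<open>x\<close> would lie in
  \<open>p H\<close>; so N y is \<open>p\<close> up to a unit.\<close>

lemma principal_generator:
  assumes p: "prm p" and x: "x \<in> H" "p \<preceq> N x" "x \<notin> mlt p"
  obtains y where "nrm p y" "x \<in> rid y" "\<forall>z\<in>rid y. \<exists>h\<in>H. z - x * h \<in> mlt p"
proof -
  define L where "L = {x * h + k | h k. h \<in> H \<and> k \<in> mlt p}"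
  have pR: "p \<in> R" "p \<noteq> 0" using p by auto
  have "\<exists>u. L = (*) u ` H"
  proof (rule H_principal)
    show "L \<subseteq> H" unfolding L_def using x pR mlt_H by auto
    show "z + z' \<in> L" if zz: "z \<in> L" "z' \<in> L" for z z'
    proof -
      obtain h k h' k' where "z = x * h + k" "z' = x * h' + k'" "h \<in> H" "h' \<in> H" "k \<in> mlt p" "k' \<in> mlt p"
        using zz unfolding L_def by blast
      hence "z + z' = x * (h + h') + (k + k')" "h + h' \<in> H" "k + k' \<in> mlt p"
        by (auto simp: algebra_simps mlt_add)
      thus ?thesis unfolding L_def by blast
    qed
    show "z * r \<in> L" if zr: "z \<in> L" "r \<in> H" for z r
    proof -
      obtain h k where "z = x * h + k" "h \<in> H" "k \<in> mlt p"
        using zr unfolding L_def by blast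
      hence "z * r = x * (h * r) + k * r" "h * r \<in> H" "k * r \<in> mlt p"
        using zr by (auto simp: algebra_simps mlt_right)
      thus ?thesis unfolding L_def by blast
    qed
    have "\<iota> p = x * 0 + \<iota> p * 1" by simp
    thus "\<iota> p \<in> L" unfolding L_def using mlt_self[OF H_1] H_0 by blast
  qed (use pR in auto)
  then obtain y where y: "L = rid y" unfolding rid_def by blast
  have yL: "y \<in> L" unfolding y by (rule rid_self)
  have yH: "y \<in> H" using yL unfolding L_def using x pR mlt_H by auto
  have "p \<preceq> N y"
  proof -
    obtain h k where "y = x * h + k" "h \<in> H" "k \<in> mlt p" using yL unfolding L_def by blast
    moreover have "p \<preceq> N (x * h)" using x \<open>h \<in> H\<close> by (simp add: N_mult dv_mult2)
    ultimately show ?thesis using dv_N_add[of p "x * h" k] x pR by simp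
  qed
  then obtain e where e: "e \<in> R" "N y = p * e" by (auto simp: dv_def)
  have "x = x * 1 + 0" by simp
  hence xL: "x \<in> L" unfolding L_def using mlt_0 H_1 by blast
  have "\<iota> p = x * 0 + \<iota> p * 1" by simp
  hence "\<iota> p \<in> L" unfolding L_def using mlt_self[OF H_1] H_0 by blast
  then obtain h where h: "h \<in> H" "\<iota> p = y * h" unfolding y rid_def by auto
  have "p\<^sup>2 = N y * N h" using h(2) N_mult[of y h] N_\<iota>[of p] by metis
  hence "p * p = p * (e * N h)" using e by (simp add: power2_eq_square)
  hence eN: "p = e * N h" using pR by simp
  hence "p \<preceq> e \<or> p \<preceq> N h" using prm_dv_mult[OF p e(1) N_mem[OF h(1)]] dv_refl[of p] by simp
  moreover have "\<not> p \<preceq> e"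
  proof
    assume "p \<preceq> e"
    then obtain f where f: "f \<in> R" "e = p * f" by (auto simp: dv_def)
    hence "p * 1 = p * (f * N h)" using eN by (metis mult.assoc mult.right_neutral)
    hence "f * N h = 1" using pR by simp
    hence "N h \<preceq> 1" using f by (intro dvI[of f]) (auto simp: mult.commute)
    then obtain g where g: "g \<in> H" "h * g = 1" using unit_inverse_mem h by blast
    hence "y = \<iota> p * g" using h by (metis mult.assoc mult.right_neutral)
    hence "y \<in> mlt p" using g by (intro mltI)
    moreover obtain k where "k \<in> H" "x = y * k" using xL unfolding y rid_def by auto
    ultimately have "x \<in> mlt p" using mlt_right by simp
    thus False using x by blast
  qed
  ultimately obtain g where g: "g \<in> R" "N h = p * g" by (auto simp: dv_def)
  hence "p * 1 = p * (e * g)" using eN by (metis mult.left_commute mult.right_neutral)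
  hence "e * g = 1" using pR by simp
  hence "p = N y * g" using e by (simp add: mult.assoc)
  hence "nrm p y" unfolding nrm_def using yH \<open>p \<preceq> N y\<close> g dvI by blast
  moreover have "\<exists>h\<in>H. z - x * h \<in> mlt p" if z: "z \<in> rid y" for z
  proof -
    obtain h k where "z = x * h + k" "h \<in> H" "k \<in> mlt p" using z unfolding y[symmetric] L_def by blast
    thus ?thesis by (intro bexI[of _ h]) auto
  qed
  ultimately show ?thesis using that xL y by blast
qed

text \<open>Both ideals contain \<open>x H + p H\<close>, which already has norm \<open>p\<close>,
  and an inclusion between ideals of norm \<open>p\<close> is an equality.\<close>

lemma rid_eq_of_common:
  assumes p: "prm p" and y: "nrm p y" "nrm p y'" and x: "x \<in> rid y" "x \<in> rid y'" "x \<notin> mlt p" "x \<in> H"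
  shows "rid y = rid y'"
proof -
  obtain z where z: "nrm p z" "x \<in> rid z" "\<forall>w\<in>rid z. \<exists>h\<in>H. w - x * h \<in> mlt p"
    by (rule principal_generator[OF p x(4) nrm_dv_N[OF y(1) x(1)] x(3)])
  obtain h where h: "h \<in> H" "z - x * h \<in> mlt p" using z(3) rid_self by blast
  have "z \<in> rid w" if w: "nrm p w" "x \<in> rid w" for w
  proof -
    have "(z - x * h) + x * h \<in> rid w" using h mlt_subset_rid[OF w(1)] rid_right[OF w(2)] by (intro rid_add) auto
    thus ?thesis by simp
  qed
  hence "rid z = rid y" "rid z = rid y'" using rid_eq_of_mem[OF p _ z(1)] y x by blast+
  thus ?thesis by simp
qed

text \<open>For \<open>u\<close> in \<open>H\<close>, the preimage of the commutative algebra
  spanned by 1 and \<open>u\<close> in \<open>H / p H\<close>. It substitutes for dimension: if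
  \<open>u\<close> is outside \<open>pencil p 1\<close> and \<open>v\<close> outside
  \<open>pencil p u\<close>, then 1, \<open>u\<close>, \<open>v\<close> are independent modulo the
  prime \<open>p\<close>.\<close>

definition pencil :: "'k \<Rightarrow> 'q \<Rightarrow> 'q set" where
  "pencil p u = {x. \<exists>r\<in>R. \<exists>s\<in>R. x - \<iota> r - \<iota> s * u \<in> mlt p}"

text \<open>If \<open>H = R + R u + p H\<close>, then \<open>H = R + R u + p\<^sup>n H\<close> for all \<open>n\<close>, so all commutators in \<open>H\<close>
  would be divisible by every power of \<open>p\<close>.\<close>

lemma pencil_not_full:
  assumes p: "prm p" and u: "u \<in> H"
  shows "\<exists>v\<in>H. v \<notin> pencil p u"
proof (rule ccontr)
  assume "\<not> ?thesis"
  hence all: "\<exists>r\<in>R. \<exists>s\<in>R. v - \<iota> r - \<iota> s * u \<in> mlt p" if "v \<in> H" for v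
    using that unfolding pencil_def by blast
  have pR: "p \<in> R" using p by simp
  have pow: "\<exists>r\<in>R. \<exists>s\<in>R. \<exists>h\<in>H. v = \<iota> r + \<iota> s * u + \<iota> (p ^ n) * h" if "v \<in> H" for v n
    using that
  proof (induction n arbitrary: v)
    case 0
    show ?case by (rule bexI[of _ 0], rule bexI[of _ 0], rule bexI[of _ v]) (use 0 in auto)
  next
    case (Suc n)
    obtain r s h where h: "r \<in> R" "s \<in> R" "h \<in> H" "v = \<iota> r + \<iota> s * u + \<iota> (p ^ n) * h"
      using Suc.IH[OF Suc.prems] by blast
    obtain r' s' where r': "r' \<in> R" "s' \<in> R" "h - \<iota> r' - \<iota> s' * u \<in> mlt p" using all[OF h(3)] by blast
    then obtain k where k: "k \<in> H" "h - \<iota> r' - \<iota> s' * u = \<iota> p * k" unfolding mlt_def by blast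
    have h2: "h = \<iota> r' + \<iota> s' * u + \<iota> p * k" using k(2) by (simp add: algebra_simps)
    have "v = \<iota> (r + p ^ n * r') + \<iota> (s + p ^ n * s') * u + \<iota> (p ^ Suc n) * k"
      unfolding h(4) h2 by (simp add: \<iota>_add \<iota>_mult distrib_left distrib_right mult.assoc power_Suc2 del: power_Suc)
    thus ?case using h r' k pR by blast
  qed
  obtain c where c: "c \<in> R" "c \<noteq> 0" "\<iota> c * i \<in> H" "\<iota> c * j \<in> H" using H_full by blast
  define x y where "x = \<iota> c * i" and "y = \<iota> c * j"
  \<comment> \<open>The commutator is 2 c^2 i j, an element of nonzero norm.\<close>
  have NC: "N (x * y - y * x) = 4 * c ^ 4 * (a * b)"
    unfolding x_def y_def by (simp add: N_def coords_mult power2_eq_square power4_eq_xxxx)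
  have xy: "x * y - y * x \<in> mlt (p ^ n)" for n
  proof -
    obtain r s h where h: "r \<in> R" "s \<in> R" "h \<in> H" "x = \<iota> r + \<iota> s * u + \<iota> (p ^ n) * h"
      using pow[of x n] c x_def by blast
    obtain r' s' k where k: "r' \<in> R" "s' \<in> R" "k \<in> H" "y = \<iota> r' + \<iota> s' * u + \<iota> (p ^ n) * k"
      using pow[of y n] c y_def by blast
    \<comment> \<open>\<open>A\<close> and \<open>B\<close> lie in \<open>R + R u\<close> and
      commute, so every remaining term of the commutator carries a factor p^n.\<close>
    define A B where "A = \<iota> r + \<iota> s * u" and "B = \<iota> r' + \<iota> s' * u"
    have AB: "A * B = B * A" "A \<in> H" "B \<in> H"
      unfolding A_def B_def using h k u by (auto intro!: coords_eqI simp: coords_mult algebra_simps)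
    have "x * y - y * x = A * (\<iota> (p ^ n) * k) + \<iota> (p ^ n) * h * B + \<iota> (p ^ n) * h * (\<iota> (p ^ n) * k)
        - (B * (\<iota> (p ^ n) * h) + \<iota> (p ^ n) * k * A + \<iota> (p ^ n) * k * (\<iota> (p ^ n) * h))"
      unfolding h(4) k(4) A_def[symmetric] B_def[symmetric] using AB(1) by (simp add: distrib_left distrib_right)
    also have "\<dots> \<in> mlt (p ^ n)"
      using h k AB pR by (intro mlt_diff mlt_add mlt_left[OF mlt_self] mlt_right[OF mlt_self] mlt_self) auto
    finally show ?thesis .
  qed
  have "p ^ n \<preceq> N (x * y - y * x)" for n
    using mlt_N[OF xy[of n]] by (rule dv_trans[rotated]) (use pR in \<open>simp add: power2_eq_square\<close>)
  moreover have "N (x * y - y * x) \<in> R" using c x_def y_def by auto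
  ultimately have "N (x * y - y * x) = 0" using prm_power_dv_imp_0[OF p] by blast
  thus False using NC c by simp
qed

lemma pencil_add: "x \<in> pencil p u \<Longrightarrow> y \<in> pencil p u \<Longrightarrow> x + y \<in> pencil p u"
proof -
  assume "x \<in> pencil p u" "y \<in> pencil p u"
  then obtain r s r' s' where m: "r \<in> R" "s \<in> R" "x - \<iota> r - \<iota> s * u \<in> mlt p"
    "r' \<in> R" "s' \<in> R" "y - \<iota> r' - \<iota> s' * u \<in> mlt p" unfolding pencil_def by blast
  have "(x + y) - \<iota> (r + r') - \<iota> (s + s') * u = (x - \<iota> r - \<iota> s * u) + (y - \<iota> r' - \<iota> s' * u)"
    by (simp add: \<iota>_add algebra_simps)
  hence "(x + y) - \<iota> (r + r') - \<iota> (s + s') * u \<in> mlt p" using mlt_add[OF m(3) m(6)] by (simp only:)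
  thus ?thesis using m unfolding pencil_def by blast
qed

lemma pencil_scale: "x \<in> pencil p u \<Longrightarrow> c \<in> R \<Longrightarrow> \<iota> c * x \<in> pencil p u"
proof -
  assume "x \<in> pencil p u" and c: "c \<in> R"
  then obtain r s where m: "r \<in> R" "s \<in> R" "x - \<iota> r - \<iota> s * u \<in> mlt p" unfolding pencil_def by blast
  have "\<iota> c * x - \<iota> (c * r) - \<iota> (c * s) * u = \<iota> c * (x - \<iota> r - \<iota> s * u)"
    by (simp add: \<iota>_mult algebra_simps)
  hence "\<iota> c * x - \<iota> (c * r) - \<iota> (c * s) * u \<in> mlt p" using mlt_scale[OF m(3) c] by (simp only:)
  thus ?thesis using m c unfolding pencil_def by blast
qed

lemma pencil_diff: "x \<in> pencil p u \<Longrightarrow> y \<in> pencil p u \<Longrightarrow> x - y \<in> pencil p u"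
  using pencil_add[OF _ pencil_scale[of y p u "- 1"], of x] by (simp add: \<iota>_minus)

lemma pencil_\<iota>: "c \<in> R \<Longrightarrow> \<iota> c \<in> pencil p u"
  unfolding pencil_def by (rule CollectI, rule bexI[of _ c], rule bexI[of _ 0]) auto

lemma pencil_self: "u \<in> pencil p u"
  unfolding pencil_def by (rule CollectI, rule bexI[of _ 0], rule bexI[of _ 1]) auto

lemma pencil_mlt: "x \<in> mlt p \<Longrightarrow> x \<in> pencil p u"
  unfolding pencil_def by (rule CollectI, rule bexI[of _ 0], rule bexI[of _ 0]) auto

lemma pencil_mono: "u \<in> pencil p v \<Longrightarrow> x \<in> pencil p u \<Longrightarrow> x \<in> pencil p v"
proof -
  assume u: "u \<in> pencil p v" and "x \<in> pencil p u"
  then obtain r s where m: "r \<in> R" "s \<in> R" "x - \<iota> r - \<iota> s * u \<in> mlt p" unfolding pencil_def by blast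
  have "(x - \<iota> r - \<iota> s * u) + \<iota> r + \<iota> s * u \<in> pencil p v"
    by (rule pencil_add[OF pencil_add[OF pencil_mlt[OF m(3)] pencil_\<iota>[OF m(1)]] pencil_scale[OF u m(2)]])
  thus ?thesis by simp
qed

lemma pencil_cancel:
  assumes p: "prm p" and c: "c \<in> R" "\<not> p \<preceq> c" and x: "x \<in> H" "\<iota> c * x \<in> pencil p u"
  shows "x \<in> pencil p u"
proof -
  obtain s t where uv: "s \<in> R" "t \<in> R" "s * c + t * p = 1" by (rule prm_bezout[OF p c])
  have "x = \<iota> (s * c + t * p) * x" using uv by simp
  also have "\<dots> = \<iota> s * (\<iota> c * x) + \<iota> t * (\<iota> p * x)" by (simp only: \<iota>_add \<iota>_mult distrib_right mult.assoc)
  also have "\<dots> \<in> pencil p u" by (rule pencil_add[OF pencil_scale[OF x(2) uv(1)] pencil_scale[OF pencil_mlt[OF mlt_self[OF x(1)]] uv(2)]])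
  finally show ?thesis .
qed

text \<open>The norm form modulo \<open>p\<close> has more than two variables, hence is isotropic.\<close>

lemma exists_isotropic:
  assumes p: "prm p"
  shows "\<exists>z\<in>H. z \<notin> mlt p \<and> p \<preceq> N z"
proof -
  have pR: "p \<in> R" using p by simp
  note fin = finite_residues[OF p]
  obtain u where u: "u \<in> H" "u \<notin> pencil p 1" using pencil_not_full[OF p H_1] by blast
  obtain v where v: "v \<in> H" "v \<notin> pencil p u" using pencil_not_full[OF p u(1)] by blast
  have one: "1 \<in> pencil p w" for w using pencil_\<iota>[of 1 p w] by simp
  show ?thesis
  proof (cases "p \<preceq> 2")
    case True
    \<comment> \<open>When 2 is 0 modulo \<open>p\<close>, N(c + d + x) differs from c^2 + d^2 + N x
      only by multiples of 2 and of Tr x; hence \<open>x\<close> is chosen outside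
      \<open>R + p H\<close> with trace 0 modulo \<open>p\<close>.\<close>
    obtain x where x: "x \<in> H" "x \<notin> pencil p 1" "p \<preceq> Tr x"
    proof (cases "p \<preceq> Tr u")
      case True
      thus ?thesis using that u by blast
    next
      case False
      let ?x = "\<iota> (Tr v) * u - \<iota> (Tr u) * v"
      have "?x \<notin> pencil p 1"
      proof
        assume "?x \<in> pencil p 1"
        hence "?x \<in> pencil p u" using pencil_mono one by blast
        hence "\<iota> (Tr v) * u - ?x \<in> pencil p u" by (rule pencil_diff[OF pencil_scale[OF pencil_self Tr_mem[OF v(1)]]])
        hence "\<iota> (Tr u) * v \<in> pencil p u" by simp
        thus False using pencil_cancel[OF p Tr_mem[OF u(1)] False v(1)] v(2) by blast
      qed
      moreover have "Tr ?x = 0" by (simp add: Tr_diff Tr_scale)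
      moreover have "?x \<in> H" using u v by auto
      ultimately show ?thesis using that[of ?x] by simp
    qed
    obtain c d where cd: "c \<in> R" "d \<in> R" "p \<preceq> c\<^sup>2 + 1 * d\<^sup>2 + N x"
      using binary_form_universal[OF p fin one_mem prm_nonunit[OF p] N_mem[OF x(1)]] by blast
    define z where "z = \<iota> (c + d) + x"
    have "N z = (c\<^sup>2 + 1 * d\<^sup>2 + N x) + (2 * (c * d) + (c + d) * Tr x)"
      unfolding z_def N_add by (simp add: Tr_scale Tr_cj power2_eq_square algebra_simps)
    also have "p \<preceq> \<dots>" using cd by (intro dv_add[OF cd(3) dv_add[OF dv_mult2[OF True] dv_mult[OF x(3)]]]) auto
    finally have "p \<preceq> N z" .
    moreover have "z \<in> H" using x cd unfolding z_def by auto
    moreover have "z \<notin> mlt p"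
    proof
      assume "z \<in> mlt p"
      hence "z - \<iota> (c + d) \<in> pencil p 1" using cd by (intro pencil_diff[OF pencil_mlt] pencil_\<iota>) auto
      thus False using x unfolding z_def by simp
    qed
    ultimately show ?thesis by blast
  next
    case False
    \<comment> \<open>Gram-Schmidt without division, invertible modulo an odd prime:
      \<open>u1\<close> is orthogonal to 1, and \<open>w\<close> below to 1 and \<open>u1\<close>,
      so the norm of \<open>c + d u1 + w\<close> is diagonal.\<close>
    define u1 where "u1 = \<iota> 2 * u - \<iota> (Tr u)"
    define v1 where "v1 = \<iota> 2 * v - \<iota> (Tr v)"
    have H1: "u1 \<in> H" "v1 \<in> H" unfolding u1_def v1_def using u v by auto
    have tr: "Tr u1 = 0" "Tr v1 = 0" unfolding u1_def v1_def by (simp_all add: Tr_diff Tr_scale Tr_\<iota>)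
    have u1: "u1 \<notin> mlt p"
    proof
      assume "u1 \<in> mlt p"
      hence "u1 + \<iota> (Tr u) \<in> pencil p 1" using u by (intro pencil_add[OF pencil_mlt] pencil_\<iota>) auto
      hence "\<iota> 2 * u \<in> pencil p 1" unfolding u1_def by simp
      thus False using pencil_cancel[OF p _ False u(1)] u by auto
    qed
    show ?thesis
    proof (cases "p \<preceq> N u1")
      case True
      thus ?thesis using H1 u1 by blast
    next
      case nN: False
      define t where "t = Tr (u1 * cj v1)"
      have t: "t \<in> R" unfolding t_def using H1 by auto
      define w where "w = \<iota> (2 * N u1) * v1 - \<iota> t * u1"
      have w: "w \<in> H" "Tr w = 0" unfolding w_def using H1 t tr by (auto simp: Tr_diff Tr_scale)
      have orth: "Tr (u1 * cj w) = 0"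
        unfolding w_def t_def cj_diff cj_scale
        by (simp add: right_diff_distrib Tr_diff Tr_def coords_mult N_def power2_eq_square algebra_simps)
      obtain c d where cd: "c \<in> R" "d \<in> R" "p \<preceq> c\<^sup>2 + N u1 * d\<^sup>2 + N w"
        using binary_form_universal[OF p fin N_mem[OF H1(1)] nN N_mem[OF w(1)]] by blast
      define z where "z = \<iota> c + \<iota> d * u1 + w"
      have "Tr (\<iota> c * cj (\<iota> d * u1)) = 0" "Tr (\<iota> c * cj w) = 0" "Tr (\<iota> d * u1 * cj w) = 0"
        using tr w(2) orth by (simp_all add: cj_scale Tr_scale Tr_cj mult.assoc)
      hence "N z = c\<^sup>2 + N u1 * d\<^sup>2 + N w"
        unfolding z_def N_add by (simp add: N_scale distrib_right Tr_add)
      hence "p \<preceq> N z" using cd by simp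
      moreover have "z \<in> H" using H1 w cd unfolding z_def by auto
      moreover have "z \<notin> mlt p"
      proof
        assume "z \<in> mlt p"
        have u1u: "u1 \<in> pencil p u" unfolding u1_def using u by (intro pencil_diff pencil_scale pencil_self pencil_\<iota>) auto
        \<comment> \<open>These terms undo the orthogonalization: what remains is
          \<open>4 * N u1\<close> times \<open>v\<close>, and this factor is invertible modulo
          \<open>p\<close>.\<close>
        have "z - \<iota> c - \<iota> d * u1 + \<iota> t * u1 + \<iota> (2 * N u1) * \<iota> (Tr v) \<in> pencil p u"
          using cd t v H1
          by (intro pencil_add[OF pencil_add[OF pencil_diff[OF pencil_diff[OF pencil_mlt[OF \<open>z \<in> mlt p\<close>] pencil_\<iota>]
                pencil_scale[OF u1u]] pencil_scale[OF u1u]] pencil_scale[OF pencil_\<iota>]]) auto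
        moreover have "z - \<iota> c - \<iota> d * u1 + \<iota> t * u1 + \<iota> (2 * N u1) * \<iota> (Tr v) = \<iota> (4 * N u1) * v"
          unfolding z_def w_def v1_def by (rule coords_eqI) (simp_all add: algebra_simps)
        ultimately have "\<iota> (4 * N u1) * v \<in> pencil p u" by simp
        moreover have "\<not> p \<preceq> 4 * N u1"
        proof
          assume "p \<preceq> 4 * N u1"
          hence "p \<preceq> 4" using nN prm_dv_mult[OF p numeral_mem N_mem[OF H1(1)]] by blast
          moreover have "p \<preceq> 2 * 2 \<longleftrightarrow> p \<preceq> 2" using prm_dv_mult[OF p numeral_mem numeral_mem] by blast
          ultimately show False using False by simp
        qed
        ultimately show False using pencil_cancel[OF p _ _ v(1), of "4 * N u1" u] v H1 by auto
      qed
      ultimately show ?thesis by blast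
    qed
  qed
qed

lemma exists_nrm:
  assumes "prm p"
  shows "\<exists>y. nrm p y"
proof -
  obtain z where z: "z \<in> H" "z \<notin> mlt p" "p \<preceq> N z" using exists_isotropic[OF assms] by blast
  show ?thesis by (rule principal_generator[OF assms z(1,3,2)]) blast
qed

end

lemma card_image_cong_iff:
  assumes "\<And>x y. x \<in> A \<Longrightarrow> y \<in> A \<Longrightarrow> f x = f y \<longleftrightarrow> g x = g y"
  shows "card (f ` A) = card (g ` A)"
proof -
  have "bij_betw (\<lambda>z. g (inv_into A f z)) (f ` A) (g ` A)"
    unfolding bij_betw_def
  proof
    show "inj_on (\<lambda>z. g (inv_into A f z)) (f ` A)"
    proof (rule inj_onI)
      fix z w assume zw: "z \<in> f ` A" "w \<in> f ` A" "g (inv_into A f z) = g (inv_into A f w)"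
      hence "f (inv_into A f z) = f (inv_into A f w)" using assms inv_into_into by metis
      thus "z = w" using zw by (simp add: f_inv_into_f)
    qed
    have "g (inv_into A f (f x)) = g x" if "x \<in> A" for x
      using assms[of "inv_into A f (f x)" x] that by (simp add: inv_into_into f_inv_into_f)
    thus "(\<lambda>z. g (inv_into A f z)) ` f ` A = g ` A" by (simp add: image_image cong: image_cong)
  qed
  thus ?thesis by (rule bij_betw_same_card)
qed

lemma (in pid_in_field) multiples_eq: "(*) d ` R = {x. d \<preceq> x}"
  unfolding dv_def by auto

lemma (in pid_in_field) finite_prime_ideals_dividing:
  assumes "x \<in> R" "x \<noteq> 0"
  shows "finite {(*) p ` R | p. prm p \<and> p \<preceq> x}"
  using assms
proof (induction x rule: prime_induct)
  case (unit u)
  hence "\<not> (prm p \<and> p \<preceq> u)" for p using dv_trans prm_nonunit unit by blast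
  hence "{(*) p ` R | p. prm p \<and> p \<preceq> u} = {}" by blast
  thus ?case by (simp only: finite.emptyI)
next
  case (prime q x)
  have "{(*) p ` R | p. prm p \<and> p \<preceq> q * x} \<subseteq> insert ((*) q ` R) {(*) p ` R | p. prm p \<and> p \<preceq> x}"
  proof
    fix P assume "P \<in> {(*) p ` R | p. prm p \<and> p \<preceq> q * x}"
    then obtain p where p: "prm p" "p \<preceq> q * x" "P = (*) p ` R" by blast
    show "P \<in> insert ((*) q ` R) {(*) p ` R | p. prm p \<and> p \<preceq> x}"
    proof (cases "p \<preceq> x")
      case False
      hence "p \<preceq> q" using prm_dv_mult[OF p(1) prm_mem[OF prime(1)] prime(2)] p by blast
      moreover have "q \<preceq> p" by (rule prm_dv_prm[OF p(1) prime(1) calculation])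
      ultimately have "P = (*) q ` R" unfolding p(3) multiples_eq using dv_trans by blast
      thus ?thesis by blast
    qed (use p in blast)
  qed
  thus ?case by (rule finite_subset) (use prime(4)[OF prime(2) dv_refl] in simp)
qed

section \<open>Idempotents modulo p and the number of ideals of norm p\<close>

context principal_order
begin

definition eqv :: "'k \<Rightarrow> 'q \<Rightarrow> 'q \<Rightarrow> bool" where "eqv p x y \<longleftrightarrow> x - y \<in> mlt p"

lemma eqv_sym: "eqv p x y \<Longrightarrow> eqv p y x"
  unfolding eqv_def using mlt_minus by fastforce

lemma eqv_trans [trans]: "eqv p x y \<Longrightarrow> eqv p y z \<Longrightarrow> eqv p x z"
  unfolding eqv_def using mlt_add[of "x - y" p "y - z"] by simp

lemma eqv_left: "eqv p x y \<Longrightarrow> h \<in> H \<Longrightarrow> eqv p (h * x) (h * y)"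
  unfolding eqv_def using mlt_left[of "x - y" p h] by (simp add: right_diff_distrib)

lemma eqv_right: "eqv p x y \<Longrightarrow> h \<in> H \<Longrightarrow> eqv p (x * h) (y * h)"
  unfolding eqv_def using mlt_right[of "x - y" p h] by (simp add: left_diff_distrib)

lemma eqv_mlt: "eqv p x y \<Longrightarrow> x \<in> mlt p \<longleftrightarrow> y \<in> mlt p"
  unfolding eqv_def using mlt_add[of "x - y" p y] mlt_diff[of x p "x - y"] by auto

lemma eqv_rid: "eqv p x z \<Longrightarrow> nrm p y \<Longrightarrow> x \<in> rid y \<longleftrightarrow> z \<in> rid y"
  unfolding eqv_def using mlt_subset_rid[of p y] rid_add[of "x - z" y z] rid_diff[of x y "x - z"] by auto

lemma one_notin_rid: "prm p \<Longrightarrow> nrm p y \<Longrightarrow> 1 \<notin> rid y"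
  using nrm_dv_N[of p y 1] by auto

text \<open>The sum of the two ideals is principal, \<open>d H\<close>, with N d dividing
  \<open>p\<close>. If \<open>p\<close> divided N d, both ideals would equal \<open>d H\<close>;
  otherwise comparing norms in \<open>y1 = d h\<close> makes N d a unit.\<close>

lemma maxi_comaximal:
  assumes p: "prm p" and y: "nrm p y1" "nrm p y2" and ne: "rid y1 \<noteq> rid y2"
  obtains h k where "h \<in> H" "k \<in> H" "y1 * h + y2 * k = 1"
proof -
  define L where "L = {y1 * h + y2 * k | h k. h \<in> H \<and> k \<in> H}"
  have pR: "p \<in> R" "p \<noteq> 0" using p by auto
  have yH: "y1 \<in> H" "y2 \<in> H" using y nrm_H by auto
  have y1L: "rid y1 \<subseteq> L"
  proof
    fix x assume "x \<in> rid y1"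
    then obtain h where h: "h \<in> H" "x = y1 * h" unfolding rid_def by blast
    hence "x = y1 * h + y2 * 0" by simp
    thus "x \<in> L" unfolding L_def using h H_0 by blast
  qed
  have y2L: "y2 \<in> L"
  proof -
    have "y2 = y1 * 0 + y2 * 1" by simp
    thus ?thesis unfolding L_def using H_0 H_1 by blast
  qed
  have "\<exists>u. L = (*) u ` H"
  proof (rule H_principal)
    show "L \<subseteq> H" unfolding L_def using yH by auto
    show "z + z' \<in> L" if zz: "z \<in> L" "z' \<in> L" for z z'
    proof -
      obtain h k h' k' where "z = y1 * h + y2 * k" "z' = y1 * h' + y2 * k'" "h \<in> H" "h' \<in> H" "k \<in> H" "k' \<in> H"
        using zz unfolding L_def by blast
      hence "z + z' = y1 * (h + h') + y2 * (k + k')" "h + h' \<in> H" "k + k' \<in> H"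
        by (auto simp: algebra_simps)
      thus ?thesis unfolding L_def by blast
    qed
    show "z * r \<in> L" if zr: "z \<in> L" "r \<in> H" for z r
    proof -
      obtain h k where "z = y1 * h + y2 * k" "h \<in> H" "k \<in> H"
        using zr unfolding L_def by blast
      hence "z * r = y1 * (h * r) + y2 * (k * r)" "h * r \<in> H" "k * r \<in> H"
        using zr by (auto simp: algebra_simps)
      thus ?thesis unfolding L_def by blast
    qed
    show "\<iota> p \<in> L" using y1L mlt_subset_rid[OF y(1)] mlt_self[OF H_1, of p] by auto
  qed (use pR in auto)
  then obtain d where d: "L = rid d" unfolding rid_def by blast
  have dH: "d \<in> H" using rid_self[of d] unfolding d[symmetric] L_def using yH by auto
  have y1d: "y1 \<in> rid d" using y1L rid_self d by blast
  have y2d: "y2 \<in> rid d" using y2L d by blast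
  obtain h where h: "h \<in> H" "y1 = d * h" using y1d unfolding rid_def by blast
  have y1p: "N y1 \<preceq> p" "p \<preceq> N y1" using y unfolding nrm_def by auto
  have dp: "N d \<preceq> p" by (rule dv_trans[OF _ y1p(1)]) (use h N_mult in simp)
  have "\<not> p \<preceq> N d"
  proof
    assume "p \<preceq> N d"
    hence "nrm p d" unfolding nrm_def using dp dH by blast
    hence "rid y1 = rid d" "rid y2 = rid d" using rid_eq_of_mem[OF p] y y1d y2d by blast+
    thus False using ne by simp
  qed
  hence "p \<preceq> N h" using y1p(2) h prm_dv_mult[OF p N_mem[OF dH] N_mem[OF h(1)]] by (simp add: N_mult)
  hence "N d * p \<preceq> N y1" using h by (simp add: N_mult dv_mult_mono)
  hence "p * N d \<preceq> p * 1" using dv_trans[OF _ y1p(1)] by (simp add: mult.commute)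
  hence "N d \<preceq> 1" using dv_mult_cancel pR by blast
  then obtain g where "g \<in> H" "d * g = 1" using unit_inverse_mem dH by blast
  hence "1 \<in> L" unfolding d rid_def by force
  thus ?thesis using that unfolding L_def by auto
qed

text \<open>By \<open>square_eq\<close>, norm 0 and trace 1 modulo \<open>p\<close> make
  \<open>e\<close> idempotent, and they exclude 0 and 1. This form suits \<open>hensel\<close>,
  where the trace is the derivative.\<close>

definition idem :: "'k \<Rightarrow> 'q \<Rightarrow> bool" where
  "idem p e \<longleftrightarrow> e \<in> H \<and> p \<preceq> N e \<and> p \<preceq> Tr e - 1"

text \<open>The components of 1 in two comaximal ideals have norm 0 modulo \<open>p\<close>, and N(1
  - e) = 1 - Tr e + N e then forces trace 1.\<close>

lemma exists_idem:
  assumes p: "prm p" and y: "nrm p y1" "nrm p y2" and ne: "rid y1 \<noteq> rid y2"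
  obtains e where "idem p e"
proof -
  obtain h k where hk: "h \<in> H" "k \<in> H" "y1 * h + y2 * k = 1" by (rule maxi_comaximal[OF assms])
  define e where "e = y1 * h"
  have eH: "e \<in> H" unfolding e_def using hk nrm_H[OF y(1)] by simp
  have 1: "p \<preceq> N e" unfolding e_def by (rule nrm_dv_N[OF y(1) rid_mem[OF hk(1)]])
  have "1 - e = y2 * k" using hk(3) unfolding e_def by (simp add: algebra_simps)
  hence "p \<preceq> N (1 - e)" using nrm_dv_N[OF y(2) rid_mem[OF hk(2)]] by simp
  moreover have "N (1 - e) = 1 + N e - Tr e" using N_add[of 1 "- e"] by (simp add: cj_def Tr_def)
  ultimately have "p \<preceq> N e - (1 + N e - Tr e)" using dv_diff[OF 1] by metis
  hence "idem p e" unfolding idem_def using eH 1 by simp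
  thus ?thesis by (rule that)
qed

lemma idem_compl:
  assumes "idem p e"
  shows "idem p (1 - e)"
proof -
  have e: "e \<in> H" "p \<preceq> N e" "p \<preceq> Tr e - 1" using assms unfolding idem_def by auto
  have "N (1 - e) = N e - (Tr e - 1)" using N_add[of 1 "- e"] by (simp add: cj_def Tr_def)
  moreover have "Tr (1 - e) - 1 = - (Tr e - 1)" by (simp add: Tr_def)
  ultimately show ?thesis unfolding idem_def using e(1) dv_diff[OF e(2,3)] dv_uminus[OF e(3)] by simp
qed

lemma idem_facts:
  assumes e: "idem p e" and p: "prm p"
  shows "e \<in> H" "eqv p (e * e) e" "eqv p (cj e) (1 - e)" "e \<notin> mlt p"
    "w \<in> H \<Longrightarrow> eqv p (e * w * e) (\<iota> (Tr (e * w)) * e)"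
proof -
  have e': "e \<in> H" "p \<preceq> N e" "p \<preceq> Tr e - 1" using e unfolding idem_def by auto
  show "e \<in> H" by fact
  have "e * e - e = \<iota> (Tr e - 1) * e - \<iota> (N e) * 1"
    unfolding square_eq by (simp add: \<iota>_diff algebra_simps)
  thus "eqv p (e * e) e" unfolding eqv_def using mlt_diff[OF mlt_\<iota>[OF e'(3,1)] mlt_\<iota>[OF e'(2) H_1]] by simp
  have "cj e - (1 - e) = \<iota> (Tr e - 1) * 1" unfolding cj_def by (simp add: \<iota>_diff)
  thus "eqv p (cj e) (1 - e)" unfolding eqv_def using mlt_\<iota>[OF e'(3) H_1] by simp
  show "e \<notin> mlt p"
  proof
    assume "e \<in> mlt p"
    hence "p \<preceq> Tr e - (Tr e - 1)" using mlt_Tr e'(3) dv_diff by blast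
    thus False using p by simp
  qed
  assume w: "w \<in> H"
  have "e * w * e - \<iota> (Tr (e * w)) * e = - (\<iota> (N e) * cj w)" by (simp add: mult_mult_self)
  thus "eqv p (e * w * e) (\<iota> (Tr (e * w)) * e)"
    unfolding eqv_def using mlt_minus[OF mlt_\<iota>[OF e'(2) cj_mem[OF w]]] by simp
qed

text \<open>If \<open>(1 - e) H e\<close> vanishes modulo \<open>p\<close>, then \<open>e H + p H = y H\<close> is two-sided, whence
  \<open>y H = H y\<close> and \<open>e H (1 - e)\<close> vanishes as well. Modulo \<open>p\<close>, the order is then spanned by
  \<open>1\<close> and \<open>e\<close>.\<close>

lemma corner_nonzero:
  assumes p: "prm p" and e: "idem p e"
  shows "\<exists>w\<in>H. (1 - e) * w * e \<notin> mlt p"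
proof (rule ccontr)
  assume "\<not> ?thesis"
  hence corner: "(1 - e) * w * e \<in> mlt p" if "w \<in> H" for w using that by blast
  define f where "f = 1 - e"
  have f: "idem p f" unfolding f_def by (rule idem_compl[OF e])
  note E = idem_facts[OF e p] and F = idem_facts[OF f p]
  have eN: "p \<preceq> N e" using e unfolding idem_def by blast
  obtain y where y: "nrm p y" "e \<in> rid y" "\<forall>z\<in>rid y. \<exists>h\<in>H. z - e * h \<in> mlt p"
    by (rule principal_generator[OF p E(1) eN E(4)])
  have yH: "y \<in> H" using y nrm_H by blast
  have Ny: "N y \<noteq> 0" using y(1) prm_nz[OF p] unfolding nrm_def dv_def by auto
  obtain g where g: "g \<in> H" "y - e * g \<in> mlt p" using y(3) rid_self by blast
  \<comment> \<open>Since \<open>(1 - e) h e\<close> vanishes modulo \<open>p\<close>, the element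
    \<open>h e\<close> lies in \<open>e H + p H = y H\<close>.\<close>
  have left: "h * y \<in> rid y" if h: "h \<in> H" for h
  proof -
    have "h * e = e * (h * e) + (1 - e) * h * e" by (simp add: algebra_simps)
    moreover have "\<dots> \<in> rid y"
      using h corner[OF h] mlt_subset_rid[OF y(1)] E(1) by (intro rid_add rid_right[OF y(2)]) auto
    ultimately have "h * e \<in> rid y" by simp
    hence "h * e * g \<in> rid y" using g rid_right by blast
    moreover have "h * (y - e * g) \<in> rid y" using mlt_left[OF g(2) h] mlt_subset_rid[OF y(1)] by blast
    ultimately have "h * e * g + h * (y - e * g) \<in> rid y" by (rule rid_add)
    thus ?thesis by (simp add: algebra_simps)
  qed
  define y' where "y' = \<iota> (inverse (N y)) * cj y"
  have inv: "y * y' = 1" "y' * y = 1" unfolding y'_def using N_nonzero_inverse[OF Ny] by auto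
  have conj: "y' * h * y \<in> H" if h: "h \<in> H" for h
  proof -
    obtain k where "k \<in> H" "h * y = y * k" using left[OF h] unfolding rid_def by blast
    thus ?thesis by (metis inv(2) mult.assoc mult_1_left)
  qed
  \<comment> \<open>The ideal being two-sided, y^-1 H y lies in \<open>H\<close>;
    \<open>H_normalizer\<close> reverses the conjugation.\<close>
  have right: "\<exists>k\<in>H. y * h = k * y" if h: "h \<in> H" for h
  proof
    show "y * h * y' \<in> H" by (rule H_normalizer[OF inv(2) conj h])
    show "y * h = y * h * y' * y" using inv(2) by (simp add: mult.assoc)
  qed
  obtain k where k: "k \<in> H" "e = y * k" using y(2) unfolding rid_def by blast
  obtain k' where k': "k' \<in> H" "e = k' * y" using right[OF k(1)] k(2) by auto
  \<comment> \<open>Writing \<open>e\<close> also as \<open>k' y\<close> puts a \<open>y\<close>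
    before \<open>w\<close> and a \<open>cj y\<close> behind it in \<open>e w cj e\<close>; moving
    \<open>y\<close> across \<open>w\<close> produces the scalar \<open>y cj y = N y\<close>. Modulo
    \<open>p\<close>, \<open>cj e\<close> is \<open>f\<close>.\<close>
  have other: "e * w * f \<in> mlt p" if w: "w \<in> H" for w
  proof -
    obtain w' where w': "w' \<in> H" "y * w = w' * y" using right[OF w] by blast
    have "e * w * cj e = k' * (y * w) * (cj y * cj k')" unfolding k'(2) cj_mult by (simp add: mult.assoc)
    also have "\<dots> = k' * w' * (y * cj y) * cj k'" unfolding w'(2) by (simp add: mult.assoc)
    also have "\<dots> = \<iota> (N y) * (k' * w' * cj k')" by (metis mult_cj \<iota>_central mult.assoc)
    also have "\<dots> \<in> mlt p" using y(1) k' w' unfolding nrm_def by (intro mlt_\<iota>) auto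
    finally have "e * w * cj e \<in> mlt p" .
    moreover have "eqv p (e * w * cj e) (e * w * f)" unfolding f_def using E w by (intro eqv_left) auto
    ultimately show ?thesis using eqv_mlt by blast
  qed
  have "w \<in> pencil p e" if w: "w \<in> H" for w
  proof -
    have m: "e * w * e - \<iota> (Tr (e * w)) * e \<in> mlt p" "f * w * f - \<iota> (Tr (f * w)) * f \<in> mlt p"
      using E(5)[OF w] F(5)[OF w] unfolding eqv_def by auto
    \<comment> \<open>Peirce decomposition: the diagonal corners are multiples of \<open>e\<close>
      and \<open>f\<close> modulo \<open>p\<close>, and the other two vanish.\<close>
    have "w = (e * w * e - \<iota> (Tr (e * w)) * e) + (f * w * f - \<iota> (Tr (f * w)) * f) + e * w * f + f * w * e
        + (\<iota> (Tr (e * w)) * e + (\<iota> (Tr (f * w)) - \<iota> (Tr (f * w)) * e))"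
      unfolding f_def by (simp add: algebra_simps)
    also have "\<dots> \<in> pencil p e"
      using mlt_add[OF mlt_add[OF mlt_add[OF m] other[OF w]] corner[OF w, folded f_def]] E(1) F(1) w
      by (intro pencil_add[OF pencil_mlt] pencil_add[OF pencil_scale[OF pencil_self]]
          pencil_diff[OF pencil_\<iota> pencil_scale[OF pencil_self]]) auto
    finally show ?thesis .
  qed
  thus False using pencil_not_full[OF p E(1)] by blast
qed

text \<open>With \<open>f = 1 - e\<close> and \<open>g = f w0 e\<close>, the element
  \<open>g\<close> lies in the ideal of \<open>f\<close> and \<open>p\<close>, hence generates it
  modulo \<open>p\<close>, so \<open>f\<close> is \<open>g h\<close>. Therefore \<open>f w e\<close>
  is \<open>g (e h f w e)\<close>, and the factor in brackets is a scalar multiple of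
  \<open>e\<close> by the trace identity.\<close>

lemma corner_line:
  assumes p: "prm p" and e: "idem p e"
    and w0: "w0 \<in> H" "(1 - e) * w0 * e \<notin> mlt p" and w: "w \<in> H"
  obtains c where "c \<in> R" "eqv p ((1 - e) * w * e) (\<iota> c * ((1 - e) * w0 * e))"
proof -
  define f where "f = 1 - e"
  have f: "idem p f" unfolding f_def by (rule idem_compl[OF e])
  note E = idem_facts[OF e p] and F = idem_facts[OF f p]
  define g where "g = f * w0 * e"
  have gH: "g \<in> H" unfolding g_def using E F w0 by auto
  have gm: "g \<notin> mlt p" unfolding g_def f_def by fact
  have fN: "p \<preceq> N f" using f unfolding idem_def by blast
  have gN: "p \<preceq> N g" unfolding g_def N_mult using fN w0 E(1) by (intro dv_mult2) auto
  obtain y where y: "nrm p y" "g \<in> rid y" "\<forall>z\<in>rid y. \<exists>h\<in>H. z - g * h \<in> mlt p"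
    by (rule principal_generator[OF p gH gN gm])
  obtain z where z: "nrm p z" "f \<in> rid z" "\<forall>u\<in>rid z. \<exists>h\<in>H. u - f * h \<in> mlt p"
    by (rule principal_generator[OF p F(1) fN F(4)])
  have "g \<in> rid z" unfolding g_def mult.assoc using z(2) w0 E(1) by (intro rid_right) auto
  hence "rid y = rid z" using rid_eq_of_common[OF p y(1) z(1) y(2) _ gm gH] by blast
  then obtain h where h: "h \<in> H" "eqv p f (g * h)" using y(3) z(2) unfolding eqv_def by blast
  have ge: "eqv p (g * e) g" unfolding g_def mult.assoc using E F w0 by (intro eqv_left) auto
  define c where "c = Tr (e * (h * f * w))"
  have "eqv p (f * w * e) (f * f * w * e)"
    using E F w by (intro eqv_right eqv_sym[OF F(2)]) auto
  also have "f * f * w * e = f * (f * w * e)" by (simp add: mult.assoc)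
  also have "eqv p (f * (f * w * e)) (g * h * (f * w * e))" using h E F w by (intro eqv_right) auto
  also have "g * h * (f * w * e) = g * (h * f * w * e)" by (simp add: mult.assoc)
  also have "eqv p (g * (h * f * w * e)) (g * e * (h * f * w * e))"
    using h E F w by (intro eqv_right eqv_sym[OF ge]) auto
  also have "g * e * (h * f * w * e) = g * (e * (h * f * w) * e)" by (simp add: mult.assoc)
  also have "eqv p (g * (e * (h * f * w) * e)) (g * (\<iota> c * e))"
    unfolding c_def using h E(1) F(1) w gH by (intro eqv_left E(5)) auto
  also have "g * (\<iota> c * e) = \<iota> c * (g * e)" by (metis \<iota>_central mult.assoc)
  also have "eqv p (\<iota> c * (g * e)) (\<iota> c * g)"
    unfolding c_def using h E(1) F(1) w by (intro eqv_left ge) auto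
  finally have "eqv p (f * w * e) (\<iota> c * g)" .
  moreover have "c \<in> R" unfolding c_def using h E(1) F(1) w by auto
  ultimately show ?thesis using that unfolding f_def g_def by blast
qed

text \<open>The ideals other than \<open>J = (1 - e) H + p H\<close> are generated modulo \<open>p\<close> by the elements
  \<open>e - c g\<close>, where \<open>g\<close> spans the corner \<open>(1 - e) H e\<close> modulo \<open>p\<close>.\<close>

lemma card_maxi_split:
  assumes p: "prm p" and y12: "nrm p y1" "nrm p y2" "rid y1 \<noteq> rid y2"
  shows "card (maxi p) = card (residues p) + 1"
proof -
  obtain e where e: "idem p e" by (rule exists_idem[OF p y12])
  define f where "f = 1 - e"
  have f: "idem p f" unfolding f_def by (rule idem_compl[OF e])
  note E = idem_facts[OF e p] and F = idem_facts[OF f p]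
  have eN: "p \<preceq> N e" using e unfolding idem_def by blast
  have fN: "p \<preceq> N f" using f unfolding idem_def by blast
  obtain w0 where w0: "w0 \<in> H" "(1 - e) * w0 * e \<notin> mlt p" using corner_nonzero[OF p e] by blast
  define g where "g = f * w0 * e"
  have gH: "g \<in> H" unfolding g_def using E F w0 by auto
  have gm: "g \<notin> mlt p" unfolding g_def f_def by (rule w0(2))
  obtain z where z: "nrm p z" "f \<in> rid z" "\<forall>u\<in>rid z. \<exists>h\<in>H. u - f * h \<in> mlt p"
    by (rule principal_generator[OF p F(1) fN F(4)])
  have gz: "g \<in> rid z" unfolding g_def mult.assoc using z(2) w0 E(1) by (intro rid_right) auto
  have cgz: "\<iota> c * g \<in> rid z" if "c \<in> R" for c
    using rid_right[OF gz H_\<iota>[OF that]] by (simp add: \<iota>_central)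
  \<comment> \<open>\<open>Z c\<close> equals \<open>(1 - c f w0) e\<close>, so its norm vanishes
    modulo \<open>p\<close> for every \<open>c\<close>.\<close>
  define Z where "Z c = e - \<iota> c * g" for c
  have ZH: "Z c \<in> H" if "c \<in> R" for c unfolding Z_def using that gH E(1) by auto
  have ZN: "p \<preceq> N (Z c)" if c: "c \<in> R" for c
  proof -
    have "Z c = (1 - \<iota> c * (f * w0)) * e" unfolding Z_def g_def by (simp add: algebra_simps)
    thus ?thesis using dv_mult[OF eN, of "N (1 - \<iota> c * (f * w0))"] c F(1) w0(1) by (simp add: N_mult)
  qed
  \<comment> \<open>Otherwise the ideal of \<open>f\<close> would contain \<open>e - c g\<close>,
    \<open>g\<close> and \<open>f\<close>, hence 1.\<close>
  have Zz: "Z c \<notin> rid z" if c: "c \<in> R" for c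
  proof
    assume "Z c \<in> rid z"
    hence "Z c + \<iota> c * g + f \<in> rid z" using cgz[OF c] z(2) by (intro rid_add)
    moreover have "Z c + \<iota> c * g + f = 1" unfolding Z_def f_def by simp
    ultimately show False using one_notin_rid[OF p z(1)] by simp
  qed
  have Zm: "Z c \<notin> mlt p" if "c \<in> R" for c using Zz[OF that] mlt_subset_rid[OF z(1)] by blast
  have "\<exists>y. nrm p y \<and> Z c \<in> rid y" if c: "c \<in> R" for c
    by (rule principal_generator[OF p ZH[OF c] ZN[OF c] Zm[OF c]]) blast
  then obtain Y where Y: "\<And>c. c \<in> R \<Longrightarrow> nrm p (Y c)" "\<And>c. c \<in> R \<Longrightarrow> Z c \<in> rid (Y c)" by metis
  have same: "rid (Y c) = rid (Y d) \<longleftrightarrow> residue p c = residue p d" if cd: "c \<in> R" "d \<in> R" for c d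
  proof -
    have diff: "Z d - Z c = \<iota> (c - d) * g" unfolding Z_def by (simp add: \<iota>_diff algebra_simps)
    show ?thesis unfolding residue_eq_iff[OF cd]
    proof
      \<comment> \<open>The difference \<open>(c - d) g\<close> would lie in this ideal and in the
        different ideal \<open>rid z\<close>, hence in \<open>p H\<close>.\<close>
      assume "rid (Y c) = rid (Y d)"
      hence "Z d - Z c \<in> rid (Y c)" using Y cd by (intro rid_diff) auto
      moreover have "Z d - Z c \<in> rid z" unfolding diff using cgz cd by blast
      moreover have "rid (Y c) \<noteq> rid z" using Y(2)[OF cd(1)] Zz[OF cd(1)] by blast
      ultimately have "Z d - Z c \<in> mlt p"
        using rid_eq_of_common[OF p Y(1)[OF cd(1)] z(1)] ZH cd by blast
      hence "\<iota> (c - d) * g \<in> mlt p" unfolding diff .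
      thus "p \<preceq> c - d" using mlt_cancel[OF p _ _ gH] gm cd by blast
    next
      assume "p \<preceq> c - d"
      hence "eqv p (Z d) (Z c)" unfolding eqv_def diff using mlt_\<iota> gH by blast
      hence "Z d \<in> rid (Y c)" using eqv_rid Y cd by blast
      thus "rid (Y c) = rid (Y d)"
        by (rule rid_eq_of_common[OF p Y(1)[OF cd(1)] Y(1)[OF cd(2)] _ Y(2)[OF cd(2)] Zm[OF cd(2)] ZH[OF cd(2)]])
    qed
  qed
  have img: "(\<lambda>c. rid (Y c)) ` R = maxi p - {rid z}"
  proof (intro equalityI subsetI)
    fix I assume "I \<in> (\<lambda>c. rid (Y c)) ` R"
    then obtain c where c: "c \<in> R" "I = rid (Y c)" by blast
    moreover have "rid (Y c) \<noteq> rid z" using Y(2)[OF c(1)] Zz[OF c(1)] by blast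
    ultimately show "I \<in> maxi p - {rid z}" using Y(1) unfolding maxi_def by blast
  next
    fix I assume "I \<in> maxi p - {rid z}"
    then obtain y where y: "nrm p y" "I = rid y" "rid y \<noteq> rid z" unfolding maxi_def by blast
    \<comment> \<open>Multiplied by \<open>e\<close>, the relation splits \<open>e\<close> as
      \<open>s + t\<close> with \<open>s\<close> in the given ideal and \<open>t\<close> in
      \<open>rid z\<close>. Modulo \<open>p\<close> the element \<open>t\<close> lies in the corner,
      so \<open>s\<close> is congruent to some \<open>Z c\<close>.\<close>
    obtain h k where hk: "h \<in> H" "k \<in> H" "y * h + z * k = 1" by (rule maxi_comaximal[OF p y(1) z(1) y(3)])
    define s t where "s = y * (h * e)" and "t = z * (k * e)"
    have tH: "t \<in> H" unfolding t_def using hk E(1) nrm_H[OF z(1)] by auto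
    have "s + t = (y * h + z * k) * e" unfolding s_def t_def by (simp add: algebra_simps)
    hence st: "e - t = s" using hk(3) by (simp add: algebra_simps)
    have sI: "s \<in> rid y" unfolding s_def using hk E(1) by (intro rid_mem) auto
    have "t \<in> rid z" unfolding t_def using hk E(1) by (intro rid_mem) auto
    then obtain h' where h': "h' \<in> H" "eqv p t (f * h')" using z(3) unfolding eqv_def by blast
    have "eqv p t (f * h')" by (rule h'(2))
    also have "eqv p (f * h') (f * f * h')" using F h' by (intro eqv_right eqv_sym[OF F(2)]) auto
    also have "f * f * h' = f * (f * h')" by (simp add: mult.assoc)
    also have "eqv p (f * (f * h')) (f * t)" using F h' by (intro eqv_left eqv_sym[OF h'(2)]) auto
    also have "f * t = f * z * k * e" unfolding t_def by (simp add: mult.assoc)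
    also have "eqv p (f * z * k * e) (f * z * k * (e * e))"
      using F hk nrm_H[OF z(1)] by (intro eqv_left eqv_sym[OF E(2)]) auto
    also have "f * z * k * (e * e) = f * t * e" unfolding t_def by (simp add: mult.assoc)
    finally have t1: "eqv p t (f * t * e)" .
    obtain c where c: "c \<in> R" "eqv p (f * t * e) (\<iota> c * g)"
      using corner_line[OF p e w0 tH] unfolding f_def g_def by blast
    have "eqv p t (\<iota> c * g)" using t1 c(2) by (rule eqv_trans)
    hence "eqv p (Z c) s" unfolding eqv_def Z_def st[symmetric] by (simp add: algebra_simps)
    hence "Z c \<in> rid y" using eqv_rid[OF _ y(1)] sI by blast
    hence "rid y = rid (Y c)"
      by (rule rid_eq_of_common[OF p y(1) Y(1)[OF c(1)] _ Y(2)[OF c(1)] Zm[OF c(1)] ZH[OF c(1)]])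
    thus "I \<in> (\<lambda>c. rid (Y c)) ` R" using y c by blast
  qed
  have card: "card (maxi p - {rid z}) = card (residues p)"
    unfolding img[symmetric] residues_def by (rule card_image_cong_iff) (use same in blast)
  \<comment> \<open>Infinite sets have cardinality 0, so a positive cardinality transfers
    finiteness.\<close>
  have fin: "finite (maxi p - {rid z})"
  proof -
    have "finite (residue p ` R)" using finite_residues[OF p] unfolding residues_def .
    moreover have "residue p 0 \<in> residue p ` R" by blast
    ultimately have "card (residues p) > 0" unfolding residues_def using card_gt_0_iff by blast
    thus ?thesis using card card_ge_0_finite by metis
  qed
  have "finite (maxi p)" using fin by (simp add: finite_Diff2)
  moreover have "rid z \<in> maxi p" using z unfolding maxi_def by blast
  ultimately show ?thesis using card fin card_Suc_Diff1[of "maxi p" "rid z"] by simp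
qed

lemma maxi_cases:
  assumes p: "prm p"
  obtains (ramified) y where "nrm p y" "maxi p = {rid y}"
  | (split) y1 y2 where "nrm p y1" "nrm p y2" "rid y1 \<noteq> rid y2"
proof -
  obtain y where y: "nrm p y" using exists_nrm[OF p] by blast
  show ?thesis
  proof (cases "\<exists>z. nrm p z \<and> rid z \<noteq> rid y")
    case True
    thus ?thesis using split y by blast
  next
    case False
    hence "maxi p = {rid y}" using y unfolding maxi_def by blast
    thus ?thesis using ramified y by blast
  qed
qed

section \<open>Primes with a single right ideal of their norm\<close>

lemma ramified_mem:
  assumes p: "prm p" and y: "nrm p y" "maxi p = {rid y}" and z: "z \<in> H" "p \<preceq> N z"
  shows "z \<in> rid y"
proof (cases "z \<in> mlt p")
  case True
  thus ?thesis using mlt_subset_rid[OF y(1)] by blast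
next
  case False
  obtain x where x: "nrm p x" "z \<in> rid x" by (rule principal_generator[OF p z False])
  hence "rid x = rid y" using y(2) unfolding maxi_def by blast
  thus ?thesis using x by simp
qed

text \<open>Two factors \<open>y\<close> split off from \<open>z\<close> on the left. The unique
  ideal contains \<open>cj y\<close> as well, so \<open>cj y = y g\<close> with N g = 1, and
  \<open>y y\<close> is N y times a unit of \<open>H\<close>, that is, \<open>p\<close> times a
  unit.\<close>

lemma ramified_square:
  assumes p: "prm p" and y: "nrm p y" "maxi p = {rid y}" and z: "z \<in> H" "p\<^sup>2 \<preceq> N z"
  shows "z \<in> mlt p"
proof -
  have yH: "y \<in> H" and yp: "N y \<preceq> p" "p \<preceq> N y" using y(1) unfolding nrm_def by auto
  have pR: "p \<in> R" using p by simp
  have "p \<preceq> N z" by (rule dv_trans[OF _ z(2)]) (use pR in \<open>simp add: power2_eq_square\<close>)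
  then obtain h where h: "h \<in> H" "z = y * h" using ramified_mem[OF p y z(1)] unfolding rid_def by blast
  have "p * p \<preceq> p * N h"
  proof -
    have "p * p \<preceq> N y * N h" using z(2) h by (simp add: N_mult power2_eq_square)
    also have "N y * N h \<preceq> p * N h" using dv_mult_mono[OF yp(1), of "N h"] by (simp add: mult.commute)
    finally show ?thesis .
  qed
  hence "p \<preceq> N h" using dv_mult_cancel p by auto
  then obtain k where k: "k \<in> H" "h = y * k" using ramified_mem[OF p y h(1)] unfolding rid_def by blast
  have "cj y \<in> rid y" using ramified_mem[OF p y cj_mem[OF yH]] yp by simp
  then obtain g where g: "g \<in> H" "cj y = y * g" unfolding rid_def by blast
  have "N y \<noteq> 0" using yp prm_nz[OF p] unfolding dv_def by auto
  moreover have "N y * 1 = N y * N g" using N_mult[of y g] g(2) by (metis N_cj mult.right_neutral)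
  ultimately have "N g = 1" by simp
  hence gg: "g * cj g = 1" using mult_cj[of g] by simp
  have "y * y * g = \<iota> (N y)" using g(2) mult_cj[of y] by (simp add: mult.assoc)
  hence "y * y = \<iota> (N y) * cj g" using gg by (metis mult.assoc mult.right_neutral)
  hence "z = \<iota> (N y) * (cj g * k)" using h k by (metis mult.assoc)
  thus ?thesis using mlt_\<iota>[OF yp(2), of "cj g * k"] g k by auto
qed

lemma ramified_power:
  assumes p: "prm p" and y: "nrm p y" "maxi p = {rid y}" and z: "z \<in> H" "p ^ (2 * n) \<preceq> N z"
  shows "z \<in> mlt (p ^ n)"
  using z
proof (induction n arbitrary: z)
  case 0
  thus ?case by (intro mltI[of z]) auto
next
  case (Suc n)
  have pR: "p \<in> R" "p \<noteq> 0" using p by auto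
  have e: "p ^ (2 * Suc n) = p\<^sup>2 * p ^ (2 * n)" by (simp add: power2_eq_square)
  have "p\<^sup>2 \<preceq> N z" by (rule dv_trans[OF _ Suc.prems(2)], unfold e, rule dv_triv) (use pR in simp)
  then obtain k where k: "k \<in> H" "z = \<iota> p * k" using ramified_square[OF p y Suc.prems(1)] unfolding mlt_def by blast
  have "p\<^sup>2 * p ^ (2 * n) \<preceq> p\<^sup>2 * N k" using Suc.prems(2) unfolding e k(2) N_scale .
  hence "p ^ (2 * n) \<preceq> N k" using dv_mult_cancel pR by simp
  then obtain l where "l \<in> H" "k = \<iota> (p ^ n) * l" using Suc.IH k unfolding mlt_def by blast
  thus ?case using k by (intro mltI[of l]) (auto simp: \<iota>_mult mult.assoc)
qed

text \<open>Together with \<open>z\<close> the unique ideal contains \<open>cj z\<close>, hence the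
  scalar Tr z, whose norm is its square.\<close>

lemma ramified_Tr:
  assumes p: "prm p" and y: "nrm p y" "maxi p = {rid y}" and z: "z \<in> H" "p \<preceq> N z"
  shows "p \<preceq> Tr z"
proof -
  have "z + cj z \<in> rid y" using ramified_mem[OF p y] z by (intro rid_add) auto
  hence "\<iota> (Tr z) \<in> rid y" by (simp add: add_cj)
  hence "p \<preceq> (Tr z)\<^sup>2" using nrm_dv_N[OF y(1), of "\<iota> (Tr z)"] by simp
  thus ?thesis using prm_dv_power[OF p Tr_mem[OF z(1)]] by blast
qed

text \<open>In the ramified case the trace form is degenerate modulo \<open>p\<close>, so \<open>p\<close> divides its
  discriminant.\<close>

lemma ramified_bound:
  obtains D where "D \<in> R" "D \<noteq> 0"
    "\<forall>p. prm p \<and> (\<exists>y. nrm p y \<and> maxi p = {rid y}) \<longrightarrow> p \<preceq> D"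
proof -
  obtain c where c: "c \<in> R" "c \<noteq> 0" "\<iota> c * i \<in> H" "\<iota> c * j \<in> H" using H_full by blast
  obtain e where e: "e \<in> R" "e \<noteq> 0" "\<forall>x\<in>{a, b}. e * x \<in> R"
    using common_denominator[of "{a, b}"] by auto
  have eR: "e * a \<in> R" "e * b \<in> R" using e by auto
  have cij: "\<iota> (c * c) * (i * j) \<in> H"
  proof -
    have "\<iota> (c * c) * (i * j) = (\<iota> c * i) * (\<iota> c * j)" by (simp add: \<iota>_mult_mult)
    thus ?thesis using c by simp
  qed
  \<comment> \<open>\<open>D\<close> clears denominators when \<open>y\<close> is recovered from its
    traces against 1, i, j and i j, each scaled into \<open>H\<close>; it is the same constant for
    every \<open>p\<close>.\<close>
  define D where "D = 2 * c ^ 4 * (e * a) * (e * b)"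
  have "p \<preceq> D" if p: "prm p" and y: "nrm p y" "maxi p = {rid y}" for p y
  proof (rule ccontr)
    assume nD: "\<not> p \<preceq> D"
    have yH: "y \<in> H" and yp: "N y \<preceq> p" "p \<preceq> N y" using y(1) unfolding nrm_def by auto
    have tr: "p \<preceq> Tr (y * w)" if w: "w \<in> H" for w
      by (rule ramified_Tr[OF p y]) (use yH w yp in \<open>auto simp: N_mult dv_mult2\<close>)
    have "p \<preceq> Tr (y * \<iota> c)" "p \<preceq> Tr (y * (\<iota> c * i))" "p \<preceq> Tr (y * (\<iota> c * j))" "p \<preceq> Tr (y * (\<iota> (c * c) * (i * j)))"
      using tr c cij by auto
    hence t: "p \<preceq> 2 * c * c0 y" "p \<preceq> 2 * c * a * c1 y" "p \<preceq> 2 * c * b * c2 y" "p \<preceq> - (2 * c * c * a * b * c3 y)"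
      by (simp_all add: Tr_def coords_mult mult_ac)
    have t4: "p \<preceq> 2 * c * c * a * b * c3 y" using dv_uminus[OF t(4)] by simp
    have "\<iota> D * y = \<iota> ((2 * c * c0 y) * (c ^ 3 * (e * a) * (e * b))) * 1
        + \<iota> ((2 * c * a * c1 y) * (c\<^sup>2 * e * (e * b))) * (\<iota> c * i)
        + \<iota> ((2 * c * b * c2 y) * (c\<^sup>2 * e * (e * a))) * (\<iota> c * j)
        + \<iota> ((2 * c * c * a * b * c3 y) * e\<^sup>2) * (\<iota> (c * c) * (i * j))"
      unfolding D_def by (rule coords_eqI) (simp_all add: power2_eq_square power3_eq_cube power4_eq_xxxx)
    also have "\<dots> \<in> mlt p"
      using c cij eR e by (intro mlt_add mlt_\<iota> dv_mult2[OF t(1)] dv_mult2[OF t(2)] dv_mult2[OF t(3)] dv_mult2[OF t4]) auto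
    finally have "\<iota> D * y \<in> mlt p" .
    moreover have "D \<in> R" unfolding D_def using c eR by auto
    ultimately have "y \<in> mlt p" using mlt_cancel[OF p _ nD yH] by blast
    hence "p\<^sup>2 \<preceq> p" using mlt_N yp dv_trans by blast
    hence "p * p \<preceq> p * 1" by (simp add: power2_eq_square)
    thus False using dv_mult_cancel[of p p 1] p by simp
  qed
  moreover have "D \<in> R" "D \<noteq> 0" unfolding D_def using c eR e by auto
  ultimately show ?thesis using that by blast
qed

end

section \<open>Counting right ideals\<close>

lemma card_filter_eq_sum: "finite A \<Longrightarrow> card {x \<in> A. P x} = (\<Sum>x\<in>A. if P x then 1 else 0)"
  unfolding card_eq_sum by (rule sum.inter_filter)

section \<open>The divisor sum over a principal ideal domain and its recursion\<close>

context pid_in_field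
begin

definition pri :: "'k \<Rightarrow> 'k set" where "pri d = {x. d \<preceq> x}"

lemma pri_eq_iff: "pri d = pri e \<longleftrightarrow> d \<preceq> e \<and> e \<preceq> d"
  unfolding pri_def using dv_trans dv_refl by blast

lemma image_pri: "p \<noteq> 0 \<Longrightarrow> (*) p ` pri d = pri (p * d)"
proof (intro equalityI subsetI)
  fix x assume "p \<noteq> 0" "x \<in> pri (p * d)"
  then obtain c where "c \<in> R" "x = p * (d * c)" unfolding pri_def dv_def by (auto simp: mult.assoc)
  thus "x \<in> (*) p ` pri d" unfolding pri_def using dvI by blast
qed (auto simp: pri_def intro: dv_mult_mono)

text \<open>The index of the ideal \<open>I\<close> in \<open>R\<close>, identified with the
  absolute norm in \<open>ideal_norm_eq_weight\<close>. An infinite index counts as 0.\<close>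

definition weight :: "'k set \<Rightarrow> nat" where
  "weight I = card ((\<lambda>x. {y\<in>R. y - x \<in> I}) ` R)"

lemma weight_pri: "weight (pri d) = card (residues d)"
  unfolding weight_def residues_def residue_def pri_def by simp

lemma prm_assoc: "prm p \<Longrightarrow> p \<preceq> p' \<Longrightarrow> p' \<preceq> p \<Longrightarrow> prm p'"
proof -
  assume p: "prm p" "p \<preceq> p'" "p' \<preceq> p"
  have "p' \<noteq> 0" using p(3) prm_nz[OF p(1)] by (auto simp: dv_def)
  moreover have "p' \<in> R" using p dv_mem prm_mem by blast
  moreover have "p' \<preceq> x \<longleftrightarrow> p \<preceq> x" for x using p dv_trans by blast
  ultimately show ?thesis using p(1) unfolding prm_def by simp
qed

text \<open>\<open>Q\<close> marks the primes to be avoided. For \<open>x\<close> outside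
  \<open>R\<close> the set is empty, which is the value needed at \<open>x / p\<close>.\<close>

definition divisors :: "('k \<Rightarrow> bool) \<Rightarrow> 'k \<Rightarrow> 'k set set" where
  "divisors Q x = {pri d | d. d \<in> R \<and> d \<preceq> x \<and> (\<forall>p. prm p \<and> Q p \<longrightarrow> \<not> p \<preceq> d)}"

lemma divisors_unit:
  assumes "u \<in> R" "u \<preceq> 1"
  shows "divisors Q u = {R}"
proof -
  have R: "pri 1 = R" unfolding pri_def using dv_one by auto
  have "divisors Q u \<subseteq> {R}"
  proof
    fix I assume "I \<in> divisors Q u"
    then obtain d where d: "d \<in> R" "d \<preceq> u" "I = pri d" unfolding divisors_def by blast
    hence "d \<preceq> 1" using assms dv_trans by blast
    moreover have "1 \<preceq> d" using d dv_one by blast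
    ultimately show "I \<in> {R}" using d R pri_eq_iff by blast
  qed
  moreover have "R \<in> divisors Q u"
    unfolding divisors_def using R dv_one assms(1) prm_nonunit one_mem by blast
  ultimately show ?thesis by blast
qed

lemma weight_R: "weight R = 1"
proof -
  have "(\<lambda>x. {y\<in>R. y - x \<in> R}) ` R = {R}"
  proof -
    have "{y\<in>R. y - x \<in> R} = R" if "x \<in> R" for x using that by auto
    thus ?thesis using zero_mem by auto
  qed
  thus ?thesis unfolding weight_def by simp
qed

lemma prm_not_dv:
  assumes p: "prm p" and d: "d \<in> R" "d \<preceq> p * x" and x: "x \<in> R" and nd: "\<not> p \<preceq> d"
  shows "d \<preceq> x"
proof -
  obtain c where c: "c \<in> R" "p * x = d * c" using d by (auto simp: dv_def)
  have "p \<preceq> d * c" using dv_triv(2)[OF x, of p] unfolding c(2) .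
  hence "p \<preceq> c" using prm_dv_mult[OF p d(1) c(1)] nd by blast
  then obtain e where e: "e \<in> R" "c = p * e" by (auto simp: dv_def)
  have "p * x = p * (d * e)" using c(2) e(2) by (simp add: mult.left_commute)
  hence "x = d * e" using p by simp
  thus ?thesis using e(1) dvI by blast
qed

lemma divisors_ramified:
  assumes p: "prm p" "Q p" and x: "x \<in> R"
  shows "divisors Q (p * x) = divisors Q x"
proof -
  have "d \<preceq> p * x \<longleftrightarrow> d \<preceq> x" if "d \<in> R" "\<not> p \<preceq> d" for d
    using prm_not_dv[OF p(1) that(1) _ x that(2)] dv_mult[of d x p] p by auto
  thus ?thesis unfolding divisors_def using p by blast
qed

text \<open>A divisor of \<open>p x\<close> is prime to \<open>p\<close> and then divides
  \<open>x\<close>, or it is \<open>p\<close> times a divisor of \<open>x\<close>. The overlap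
  consists of the divisors of \<open>x\<close> that \<open>p\<close> divides.\<close>

lemma divisors_split:
  assumes p: "prm p" and Q: "\<forall>p'. prm p' \<longrightarrow> Q p' \<longrightarrow> \<not> p' \<preceq> p" and x: "x \<in> R" "x \<noteq> 0"
  shows "divisors Q (p * x) = divisors Q x \<union> (\<lambda>I. (*) p ` I) ` divisors Q x" (is ?A)
    and "divisors Q x \<inter> (\<lambda>I. (*) p ` I) ` divisors Q x = (\<lambda>I. (*) p ` I) ` divisors Q (x / p)" (is ?B)
proof -
  have pR: "p \<in> R" "p \<noteq> 0" using p by auto
  have free: "(\<forall>r. prm r \<and> Q r \<longrightarrow> \<not> r \<preceq> p * d) \<longleftrightarrow> (\<forall>r. prm r \<and> Q r \<longrightarrow> \<not> r \<preceq> d)" if "d \<in> R" for d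
    using Q prm_dv_mult[OF _ pR(1) that] by blast
  have img: "(\<lambda>I. (*) p ` I) ` divisors Q y =
      {pri (p * d) | d. d \<in> R \<and> d \<preceq> y \<and> (\<forall>r. prm r \<and> Q r \<longrightarrow> \<not> r \<preceq> d)}" for y
    unfolding divisors_def using image_pri[OF pR(2)] by (auto simp: image_def)
  have pd: "p * d \<preceq> p * x \<longleftrightarrow> d \<preceq> x" for d using dv_mult_cancel pR by blast
  show ?A
  proof (intro equalityI subsetI)
    fix I assume "I \<in> divisors Q (p * x)"
    then obtain d where d: "d \<in> R" "d \<preceq> p * x" "\<forall>r. prm r \<and> Q r \<longrightarrow> \<not> r \<preceq> d" "I = pri d"
      unfolding divisors_def by blast
    show "I \<in> divisors Q x \<union> (\<lambda>I. (*) p ` I) ` divisors Q x"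
    proof (cases "p \<preceq> d")
      case True
      then obtain e where e: "e \<in> R" "d = p * e" by (auto simp: dv_def)
      hence "e \<preceq> x" "\<forall>r. prm r \<and> Q r \<longrightarrow> \<not> r \<preceq> e" using d pd free by auto
      thus ?thesis unfolding img using e d(4) by blast
    next
      case False
      hence "d \<preceq> x" using prm_not_dv[OF p d(1,2) x(1)] by blast
      thus ?thesis unfolding divisors_def using d by blast
    qed
  next
    fix I assume "I \<in> divisors Q x \<union> (\<lambda>I. (*) p ` I) ` divisors Q x"
    thus "I \<in> divisors Q (p * x)"
    proof
      assume "I \<in> divisors Q x"
      thus ?thesis unfolding divisors_def using dv_mult pR by blast
    next
      assume "I \<in> (\<lambda>I. (*) p ` I) ` divisors Q x"
      then obtain d where d: "d \<in> R" "d \<preceq> x" "\<forall>r. prm r \<and> Q r \<longrightarrow> \<not> r \<preceq> d" "I = pri (p * d)"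
        unfolding img by blast
      hence "p * d \<in> R" "p * d \<preceq> p * x" "\<forall>r. prm r \<and> Q r \<longrightarrow> \<not> r \<preceq> p * d" using pd free pR by auto
      thus ?thesis unfolding divisors_def using d(4) by blast
    qed
  qed
  have xp: "p * d \<preceq> x \<longleftrightarrow> d \<preceq> x / p" for d
    using dv_mult_cancel[OF pR(2), of d "x / p"] pR by simp
  show ?B
  proof (intro equalityI subsetI)
    fix I assume I: "I \<in> divisors Q x \<inter> (\<lambda>I. (*) p ` I) ` divisors Q x"
    then obtain d where d: "d \<in> R" "d \<preceq> x" "\<forall>r. prm r \<and> Q r \<longrightarrow> \<not> r \<preceq> d" "I = pri (p * d)"
      unfolding img by blast
    obtain e where e: "e \<preceq> x" "I = pri e" using I unfolding divisors_def by blast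
    have "p * d \<preceq> e" using d e pri_eq_iff by metis
    hence "d \<preceq> x / p" using e(1) dv_trans xp by blast
    thus "I \<in> (\<lambda>I. (*) p ` I) ` divisors Q (x / p)" unfolding img using d by blast
  next
    fix I assume "I \<in> (\<lambda>I. (*) p ` I) ` divisors Q (x / p)"
    then obtain d where d: "d \<in> R" "d \<preceq> x / p" "\<forall>r. prm r \<and> Q r \<longrightarrow> \<not> r \<preceq> d" "I = pri (p * d)"
      unfolding img by blast
    have m: "p * d \<preceq> x" using d xp by blast
    have "d \<preceq> p * d" using pR by simp
    hence "d \<preceq> x" using m dv_trans by blast
    hence "I \<in> (\<lambda>I. (*) p ` I) ` divisors Q x" unfolding img using d by blast
    moreover have "I \<in> divisors Q x" unfolding divisors_def using d m free pR by blast
    ultimately show "I \<in> divisors Q x \<inter> (\<lambda>I. (*) p ` I) ` divisors Q x" by blast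
  qed
qed

text \<open>Inclusion-exclusion in \<open>divisors_split\<close>: multiplying an ideal by
  \<open>p\<close> multiplies its weight by the size of the residue field. The additive form avoids
  subtraction of natural numbers.\<close>

lemma sum_weight_split:
  assumes p: "prm p" and Q: "\<forall>p'. prm p' \<longrightarrow> Q p' \<longrightarrow> \<not> p' \<preceq> p" and x: "x \<in> R" "x \<noteq> 0"
    and fin: "finite (divisors Q x)"
  shows "finite (divisors Q (p * x))"
    and "sum weight (divisors Q (p * x)) + card (residues p) * sum weight (divisors Q (x / p))
      = (card (residues p) + 1) * sum weight (divisors Q x)"
proof -
  have pR: "p \<in> R" "p \<noteq> 0" using p by auto
  note S = divisors_split[where Q = Q, OF p Q x]
  show "finite (divisors Q (p * x))" unfolding S(1) using fin by simp
  have inj: "inj_on (\<lambda>I. (*) p ` I) A" for A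
  proof (rule inj_onI)
    fix I J assume "(*) p ` I = (*) p ` J"
    moreover have "inj ((*) p)" using pR by (auto intro: injI)
    ultimately show "I = J" by (simp add: inj_image_eq_iff)
  qed
  have w: "sum weight ((\<lambda>I. (*) p ` I) ` divisors Q y) = card (residues p) * sum weight (divisors Q y)"
    if y: "y \<noteq> 0" for y
    unfolding sum.reindex[OF inj] sum_distrib_left
  proof (rule sum.cong)
    fix I assume "I \<in> divisors Q y"
    then obtain d where d: "d \<in> R" "d \<preceq> y" "I = pri d" unfolding divisors_def by blast
    have "d \<noteq> 0" using d y by (auto simp: dv_def)
    thus "(weight \<circ> (\<lambda>I. (*) p ` I)) I = card (residues p) * weight I"
      using d pR by (simp add: image_pri weight_pri card_residues_mult)
  qed simp
  have "sum weight (divisors Q x \<union> (\<lambda>I. (*) p ` I) ` divisors Q x) + sum weight (divisors Q x \<inter> (\<lambda>I. (*) p ` I) ` divisors Q x)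
     = sum weight (divisors Q x) + sum weight ((\<lambda>I. (*) p ` I) ` divisors Q x)"
    using fin by (intro sum.union_inter) auto
  thus "sum weight (divisors Q (p * x)) + card (residues p) * sum weight (divisors Q (x / p))
      = (card (residues p) + 1) * sum weight (divisors Q x)"
    unfolding S(2) S(1)[symmetric] using w[of x] w[of "x / p"] x pR by simp
qed

end

section \<open>Right ideals of given norm and their recursion\<close>

context principal_order
begin

definition ids :: "'k \<Rightarrow> 'q set set" where
  "ids \<alpha> = {rid q | q. q \<in> H \<and> N q = \<alpha>}"

lemma card_norm_eq:
  assumes "\<alpha> \<noteq> 0"
  shows "card {q \<in> H. N q = \<alpha>} = card {q \<in> H. N q = 1} * card (ids \<alpha>)"
proof -
  have "\<exists>q. q \<in> H \<and> N q = \<alpha> \<and> rid q = I" if "I \<in> ids \<alpha>" for I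
    using that unfolding ids_def by blast
  then obtain g where g: "\<And>I. I \<in> ids \<alpha> \<Longrightarrow> g I \<in> H" "\<And>I. I \<in> ids \<alpha> \<Longrightarrow> N (g I) = \<alpha>"
    "\<And>I. I \<in> ids \<alpha> \<Longrightarrow> rid (g I) = I" by metis
  have "bij_betw (\<lambda>(I, u). g I * u) (ids \<alpha> \<times> {q \<in> H. N q = 1}) {q \<in> H. N q = \<alpha>}"
    unfolding bij_betw_def
  proof
    show "inj_on (\<lambda>(I, u). g I * u) (ids \<alpha> \<times> {q \<in> H. N q = 1})"
    proof (clarsimp simp: inj_on_def)
      fix I u I' u'
      assume I: "I \<in> ids \<alpha>" "I' \<in> ids \<alpha>" and u: "u \<in> H" "N u = 1" "u' \<in> H" "N u' = 1"
        and eq: "g I * u = g I' * u'"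
      have "rid (g I * u) = I" "rid (g I' * u') = I'" using rid_unit u g(3) I by auto
      hence "I = I'" using eq by simp
      moreover have "N (g I) \<noteq> 0" using g I assms by simp
      ultimately show "I = I' \<and> u = u'" using eq N_cancel by blast
    qed
    show "(\<lambda>(I, u). g I * u) ` (ids \<alpha> \<times> {q \<in> H. N q = 1}) = {q \<in> H. N q = \<alpha>}"
    proof (intro equalityI subsetI)
      fix q assume "q \<in> {q \<in> H. N q = \<alpha>}"
      hence q: "q \<in> H" "N q = \<alpha>" by auto
      hence I: "rid q \<in> ids \<alpha>" unfolding ids_def by blast
      hence "q \<in> rid (g (rid q))" using g(3) rid_self by simp
      then obtain u where u: "u \<in> H" "q = g (rid q) * u" unfolding rid_def by blast
      have "\<alpha> * 1 = \<alpha> * N u" using N_mult[of "g (rid q)" u] u(2) q g(2)[OF I] by simp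
      hence "N u = 1" using assms by simp
      thus "q \<in> (\<lambda>(I, u). g I * u) ` (ids \<alpha> \<times> {q \<in> H. N q = 1})" using u I
        by (intro image_eqI[of _ _ "(rid q, u)"]) auto
    qed (use g in \<open>auto simp: N_mult\<close>)
  qed
  \<comment> \<open>Infinite sets count as 0 on both sides, and the product rule holds with this
    value.\<close>
  from bij_betw_same_card[OF this] show ?thesis by (simp add: card_cartesian_product mult.commute)
qed

lemma rid_mult: "rid (y * q) = (*) y ` rid q"
  unfolding rid_def by (auto simp: image_image mult.assoc)

lemma inj_image_mult: "N y \<noteq> 0 \<Longrightarrow> inj_on (\<lambda>I. (*) y ` I) A"
proof -
  assume "N y \<noteq> 0"
  hence "inj ((*) y)" using N_cancel by (auto intro: injI)
  thus ?thesis by (intro inj_onI) (simp add: inj_image_eq_iff)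
qed

text \<open>Double counting of the pairs of a maximal ideal \<open>M\<close> of norm \<open>p\<close> and an ideal \<open>I \<subseteq> M\<close> of norm
  \<open>p x\<close>: the ideals in \<open>M = y H\<close> are the \<open>y I'\<close> with \<open>I'\<close> of norm \<open>x\<close>, and \<open>I = q H\<close> lies in one
  maximal ideal of norm \<open>p\<close>, or in all of them if \<open>p\<close> divides \<open>q\<close>.\<close>

lemma ids_recursion:
  assumes p: "prm p" and m: "maxi p = ids p" "finite (maxi p)" and x: "x \<in> R" "x \<noteq> 0" "finite (ids x)"
  shows "finite (ids (p * x))"
    and "card (ids (p * x)) + (card (maxi p) - 1) * card (ids (x / p)) = card (maxi p) * card (ids x)"
proof -
  have pR: "p \<in> R" "p \<noteq> 0" using p by auto
  have sub: "{I \<in> ids (p * x). I \<subseteq> M} = (\<lambda>I. (*) y ` I) ` ids x" if y: "y \<in> H" "N y = p" "M = rid y" for y M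
  proof (intro equalityI subsetI)
    fix I assume "I \<in> {I \<in> ids (p * x). I \<subseteq> M}"
    then obtain q where q: "q \<in> H" "N q = p * x" "I = rid q" "rid q \<subseteq> rid y" unfolding ids_def y(3) by blast
    then obtain r where r: "r \<in> H" "q = y * r" using rid_self unfolding rid_def by blast
    have "p * N r = p * x" using q r N_mult y(2) by metis
    hence "N r = x" using pR by simp
    thus "I \<in> (\<lambda>I. (*) y ` I) ` ids x" unfolding ids_def q(3) r(2) rid_mult using r by blast
  next
    fix I assume "I \<in> (\<lambda>I. (*) y ` I) ` ids x"
    then obtain r where r: "r \<in> H" "N r = x" "I = rid (y * r)" unfolding ids_def rid_mult by blast
    have "y * r \<in> H" "N (y * r) = p * x" using r y by (auto simp: N_mult)
    moreover have "rid (y * r) \<subseteq> M" unfolding y(3) by (rule rid_subset[OF rid_mem[OF r(1)]])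
    ultimately show "I \<in> {I \<in> ids (p * x). I \<subseteq> M}" unfolding ids_def r(3) by blast
  qed
  have gen: "\<exists>y\<in>H. N y = p \<and> M = rid y" if "M \<in> maxi p" for M using that unfolding m(1) ids_def by blast
  have below: "card {I \<in> ids (p * x). I \<subseteq> M} = card (ids x)" "finite {I \<in> ids (p * x). I \<subseteq> M}"
    if M: "M \<in> maxi p" for M
  proof -
    obtain y where y: "y \<in> H" "N y = p" "M = rid y" using gen[OF M] by blast
    show "card {I \<in> ids (p * x). I \<subseteq> M} = card (ids x)"
      unfolding sub[OF y] using y(2) pR by (intro card_image inj_image_mult) simp
    show "finite {I \<in> ids (p * x). I \<subseteq> M}" unfolding sub[OF y] using x by simp
  qed
  have mltM: "mlt p \<subseteq> M" if M: "M \<in> maxi p" for M using M mlt_subset_rid unfolding maxi_def by blast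
  have above: "card {M \<in> maxi p. I \<subseteq> M} = (if I \<subseteq> mlt p then card (maxi p) else 1)" if I: "I \<in> ids (p * x)" for I
  proof (cases "I \<subseteq> mlt p")
    case True
    hence "{M \<in> maxi p. I \<subseteq> M} = maxi p" using mltM by blast
    thus ?thesis using True by simp
  next
    case False
    obtain q where q: "q \<in> H" "N q = p * x" "I = rid q" using I unfolding ids_def by blast
    have qm: "q \<notin> mlt p" using False mlt_right unfolding q(3) rid_def by blast
    have "p \<preceq> N q" using q x by simp
    then obtain y where y: "nrm p y" "q \<in> rid y" using principal_generator[OF p q(1) _ qm] by blast
    have "{M \<in> maxi p. I \<subseteq> M} = {rid y}"
    proof (intro equalityI subsetI)
      fix M assume M: "M \<in> {M \<in> maxi p. I \<subseteq> M}"
      then obtain z where z: "nrm p z" "M = rid z" unfolding maxi_def by blast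
      have "q \<in> rid z" using M z(2) rid_self unfolding q(3) by blast
      hence "rid z = rid y" by (rule rid_eq_of_common[OF p z(1) y(1) _ y(2) qm q(1)])
      thus "M \<in> {rid y}" using z by simp
    next
      fix M assume "M \<in> {rid y}"
      thus "M \<in> {M \<in> maxi p. I \<subseteq> M}" using y rid_subset[OF y(2)] unfolding q(3) maxi_def by blast
    qed
    thus ?thesis using False by simp
  qed
  have m0: "card (maxi p) > 0"
  proof -
    obtain y where "nrm p y" using exists_nrm[OF p] by blast
    hence "maxi p \<noteq> {}" unfolding maxi_def by blast
    thus ?thesis using m(2) by (simp add: card_gt_0_iff)
  qed
  have "ids (p * x) \<subseteq> (\<Union>M\<in>maxi p. {I \<in> ids (p * x). I \<subseteq> M})"
  proof
    fix I assume I: "I \<in> ids (p * x)"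
    have "card {M \<in> maxi p. I \<subseteq> M} > 0" using above[OF I] m0 by simp
    hence "{M \<in> maxi p. I \<subseteq> M} \<noteq> {}" by (metis card.empty less_irrefl)
    thus "I \<in> (\<Union>M\<in>maxi p. {I \<in> ids (p * x). I \<subseteq> M})" using I by blast
  qed
  thus fin: "finite (ids (p * x))" using below(2) m(2) by (meson finite_UN_I finite_subset)
  \<comment> \<open>Dividing a generator by the scalar \<open>p\<close> divides its norm
    \<open>p x\<close> by p^2, which leaves \<open>x / p\<close>; if this is not integral, both sets
    are empty.\<close>
  have scaled: "{I \<in> ids (p * x). I \<subseteq> mlt p} = (\<lambda>I. (*) (\<iota> p) ` I) ` ids (x / p)"
  proof (intro equalityI subsetI)
    fix I assume "I \<in> {I \<in> ids (p * x). I \<subseteq> mlt p}"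
    then obtain q where q: "q \<in> H" "N q = p * x" "I = rid q" "rid q \<subseteq> mlt p" unfolding ids_def by blast
    then obtain r where r: "r \<in> H" "q = \<iota> p * r" using rid_self unfolding mlt_def by blast
    have "p * (p * N r) = p * x" using q r by (simp add: N_scale power2_eq_square mult.assoc)
    hence "N r = x / p" using pR by (simp add: field_simps)
    thus "I \<in> (\<lambda>I. (*) (\<iota> p) ` I) ` ids (x / p)" unfolding ids_def q(3) r(2) rid_mult using r by blast
  next
    fix I assume "I \<in> (\<lambda>I. (*) (\<iota> p) ` I) ` ids (x / p)"
    then obtain r where r: "r \<in> H" "N r = x / p" "I = rid (\<iota> p * r)" unfolding ids_def rid_mult by blast
    have "\<iota> p * r \<in> H" "N (\<iota> p * r) = p * x" using r pR by (auto simp: N_scale power2_eq_square)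
    moreover have "rid (\<iota> p * r) \<subseteq> mlt p" using mlt_right[OF mlt_self[OF r(1), of p]] unfolding rid_def by blast
    ultimately show "I \<in> {I \<in> ids (p * x). I \<subseteq> mlt p}" unfolding ids_def r(3) by blast
  qed
  have c0: "card {I \<in> ids (p * x). I \<subseteq> mlt p} = card (ids (x / p))"
    unfolding scaled using pR by (intro card_image inj_image_mult) simp
  have "(\<Sum>M\<in>maxi p. card {I \<in> ids (p * x). I \<subseteq> M}) = (\<Sum>M\<in>maxi p. \<Sum>I\<in>ids (p * x). if I \<subseteq> M then 1 else 0)"
    by (simp only: card_filter_eq_sum[OF fin])
  also have "\<dots> = (\<Sum>I\<in>ids (p * x). \<Sum>M\<in>maxi p. if I \<subseteq> M then 1 else 0)" by (rule sum.swap)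
  also have "\<dots> = (\<Sum>I\<in>ids (p * x). card {M \<in> maxi p. I \<subseteq> M})"
    by (simp only: card_filter_eq_sum[OF m(2)])
  \<comment> \<open>The number of ideals above \<open>I\<close> is written as 1 plus an excess;
    \<open>m0\<close> keeps the subtraction of natural numbers exact.\<close>
  also have "\<dots> = (\<Sum>I\<in>ids (p * x). 1 + (if I \<subseteq> mlt p then card (maxi p) - 1 else 0))"
    by (rule sum.cong) (use above m0 in auto)
  also have "\<dots> = card (ids (p * x)) + (\<Sum>I\<in>ids (p * x). if I \<subseteq> mlt p then card (maxi p) - 1 else 0)"
    by (simp only: sum.distrib card_eq_sum)
  also have "(\<Sum>I\<in>ids (p * x). if I \<subseteq> mlt p then card (maxi p) - 1 else 0) =
      (\<Sum>I\<in>{I \<in> ids (p * x). I \<subseteq> mlt p}. card (maxi p) - 1)"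
    using fin by (rule sum.inter_filter[symmetric])
  also have "\<dots> = (card (maxi p) - 1) * card (ids (x / p))" using c0 by (simp add: mult.commute)
  finally show "card (ids (p * x)) + (card (maxi p) - 1) * card (ids (x / p)) = card (maxi p) * card (ids x)"
    using below(1) by simp
qed

lemma nrm_assoc: "p \<preceq> p' \<Longrightarrow> p' \<preceq> p \<Longrightarrow> nrm p = nrm p'"
  unfolding nrm_def using dv_trans by blast

lemma maxi_assoc:
  assumes "p \<preceq> p'" "p' \<preceq> p"
  shows "maxi p = maxi p'"
  unfolding maxi_def nrm_assoc[OF assms] by (rule refl)

text \<open>Ramification is read off from the right ideals of \<open>H\<close>; its agreement with
  the completed algebra being a division ring is \<open>division_ring_iff_ramified\<close>.\<close>

definition ramified :: "'k \<Rightarrow> bool" where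
  "ramified p \<longleftrightarrow> (\<exists>y. nrm p y \<and> maxi p = {rid y})"

lemma ramified_assoc:
  assumes "p \<preceq> p'" "p' \<preceq> p"
  shows "ramified p = ramified p'"
  unfolding ramified_def nrm_assoc[OF assms] maxi_assoc[OF assms] by (rule refl)

lemma card_maxi: "prm p \<Longrightarrow> card (maxi p) = (if ramified p then 1 else card (residues p) + 1)"
proof (cases "ramified p")
  case True
  thus ?thesis unfolding ramified_def by auto
next
  case False
  assume p: "prm p"
  show ?thesis by (rule maxi_cases[OF p]) (use False card_maxi_split[OF p] in \<open>auto simp: ramified_def\<close>)
qed

end

section \<open>Totally positive norms and the comparison of the two recursions\<close>

locale positive_order = principal_order R \<iota> a b i j H
  for R :: "'k::field_char_0 set" and \<iota> :: "'k \<Rightarrow> 'q::ring_1" and a b :: 'k and i j :: 'q and H :: "'q set" +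
  assumes definite: "definite a b"
    and unit_square: "\<lbrakk>u \<in> R; u \<preceq> 1; totally_positive u\<rbrakk> \<Longrightarrow> \<exists>v\<in>R. v \<preceq> 1 \<and> u = v\<^sup>2"
begin

lemma totally_positive_N: "N q \<noteq> 0 \<Longrightarrow> totally_positive (N q)"
  unfolding totally_positive_def using definite_N_pos[OF definite] by blast

lemma totally_positive_cancel:
  fixes x y :: 'k
  assumes "totally_positive x" "totally_positive (x * y)"
  shows "totally_positive y"
  unfolding totally_positive_def
proof
  fix \<sigma> :: "'k \<Rightarrow> real" assume s: "\<sigma> \<in> real_embeddings"
  hence "\<sigma> (x * y) = \<sigma> x * \<sigma> y" unfolding real_embeddings_def ring_hom_def ring_of_type_algebra_def by auto
  moreover have "\<sigma> x > 0" "\<sigma> (x * y) > 0" using assms s unfolding totally_positive_def by auto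
  ultimately show "\<sigma> y > 0" by (simp add: zero_less_mult_iff)
qed

lemma maxi_eq_ids:
  assumes p: "prm p" and tp: "totally_positive p"
  shows "maxi p = ids p"
proof (intro equalityI subsetI)
  fix M assume "M \<in> ids p"
  then obtain y where "y \<in> H" "N y = p" "M = rid y" unfolding ids_def by blast
  thus "M \<in> maxi p" unfolding maxi_def nrm_def by force
next
  fix M assume "M \<in> maxi p"
  then obtain y where y: "nrm p y" "M = rid y" unfolding maxi_def by blast
  have yH: "y \<in> H" "p \<preceq> N y" "N y \<preceq> p" using y(1) unfolding nrm_def by auto
  obtain u where u: "u \<in> R" "u \<preceq> 1" "N y = p * u"
    by (rule dv_antisym[OF yH(2,3) prm_nz[OF p]])
  have u0: "u \<noteq> 0" using u(2) by (auto simp: dv_def)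
  have "totally_positive (p * u)" using totally_positive_N[of y] u u0 p by simp
  hence "totally_positive u" using totally_positive_cancel tp by blast
  then obtain v where v: "v \<in> R" "v \<preceq> 1" "u = v\<^sup>2" using unit_square u by blast
  obtain w where w: "w \<in> R" "1 = v * w" using v(2) by (auto simp: dv_def)
  have "N (y * \<iota> w) = p * (v * w)\<^sup>2" using u v by (simp add: N_mult power_mult_distrib)
  hence "N (y * \<iota> w) = p" using w by simp
  moreover have "w\<^sup>2 \<preceq> 1"
    by (rule dvI[of "v\<^sup>2"]) (use v w in \<open>auto simp flip: power_mult_distrib simp: mult.commute\<close>)
  hence "rid (y * \<iota> w) = rid y" using w by (intro rid_unit) auto
  ultimately show "M \<in> ids p" unfolding ids_def using y yH w by blast
qed

lemma ids_unit:
  assumes "\<alpha> \<in> R" "\<alpha> \<preceq> 1" "totally_positive \<alpha>"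
  shows "ids \<alpha> = {H}"
proof -
  have r1: "rid 1 = H" unfolding rid_def by simp
  have r: "rid q = H" if "q \<in> H" "N q = \<alpha>" for q using rid_unit[of q 1] that assms r1 by simp
  obtain v where "v \<in> R" "\<alpha> = v\<^sup>2" using unit_square assms by blast
  hence "\<iota> v \<in> H" "N (\<iota> v) = \<alpha>" by auto
  thus ?thesis unfolding ids_def using r by blast
qed

lemma card_ids:
  assumes "\<alpha> \<in> R" "\<alpha> \<noteq> 0" "totally_positive \<alpha>"
  shows "card (ids \<alpha>) = sum weight (divisors ramified \<alpha>)"
proof -
  have "totally_positive \<alpha> \<longrightarrow> finite (ids \<alpha>) \<and> finite (divisors ramified \<alpha>) \<and>
      card (ids \<alpha>) = sum weight (divisors ramified \<alpha>)"
    using assms(1,2)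
  proof (induction \<alpha> rule: prime_induct)
    case (unit u)
    thus ?case using ids_unit divisors_unit weight_R by auto
  next
    case (prime r x)
    show ?case
    proof
      assume tp: "totally_positive (r * x)"
      \<comment> \<open>\<open>r\<close> itself need not be totally positive. Its associate
        \<open>p = N y\<close> is, being a nonzero norm, and the unit \<open>u\<close> passes into
        the cofactor \<open>z\<close>.\<close>
      obtain y where y: "nrm r y" using exists_nrm[OF prime(1)] by blast
      define p where "p = N y"
      have rp: "r \<preceq> p" "p \<preceq> r" using y unfolding nrm_def p_def by auto
      have p: "prm p" by (rule prm_assoc[OF prime(1) rp])
      have pR: "p \<in> R" "p \<noteq> 0" using p by auto
      obtain u where u: "u \<in> R" "u \<preceq> 1" "r = p * u" by (rule dv_antisym[OF rp(2,1) pR(2)])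
      define z where "z = u * x"
      have z: "z \<in> R" "z \<noteq> 0" "r * x = p * z" unfolding z_def using u prime by auto
      have zx: "z \<preceq> x"
      proof -
        obtain v where "v \<in> R" "1 = u * v" using u(2) by (auto simp: dv_def)
        hence "x = z * v" unfolding z_def by (metis mult.commute mult.left_commute mult.right_neutral)
        thus ?thesis using \<open>v \<in> R\<close> dvI by blast
      qed
      have tpp: "totally_positive p" unfolding p_def by (rule totally_positive_N) (use pR p_def in simp)
      have tpz: "totally_positive z" using totally_positive_cancel[OF tpp] tp z(3) by simp
      have IH: "finite (ids z)" "finite (divisors ramified z)" "card (ids z) = sum weight (divisors ramified z)"
        using prime(4)[OF z(1) zx] tpz by auto
      have IH': "card (ids (z / p)) = sum weight (divisors ramified (z / p))"
      proof (cases "p \<preceq> z")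
        case True
        then obtain w where w: "w \<in> R" "z = p * w" by (auto simp: dv_def)
        have "w \<preceq> x" using w zx pR dv_trans by (metis dv_triv(1))
        moreover have "totally_positive w" using totally_positive_cancel[OF tpp] tpz w by simp
        ultimately have "card (ids w) = sum weight (divisors ramified w)" using prime(4)[OF w(1)] by blast
        thus ?thesis using w pR by simp
      next
        case False
        \<comment> \<open>A non-integral \<open>z / p\<close> is no norm from \<open>H\<close> and
          has no divisors in \<open>R\<close>, so both sides are 0.\<close>
        hence n: "z / p \<notin> R" using dvI[of "z / p" z p] pR by auto
        have "N q \<noteq> z / p" if "q \<in> H" for q using N_mem[OF that] n by auto
        hence "ids (z / p) = {}" unfolding ids_def by blast
        moreover have "\<not> d \<preceq> z / p" if "d \<in> R" for d using dv_mem[of d "z / p"] that n by blast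
        hence "divisors ramified (z / p) = {}" unfolding divisors_def by blast
        ultimately show ?thesis by simp
      qed
      note m = maxi_eq_ids[OF p tpp]
      \<comment> \<open>\<open>card_maxi\<close> gives a positive number, which rules out the value
        0 of an infinite set.\<close>
      have res0: "finite (maxi p)"
        by (rule card_ge_0_finite) (simp add: card_maxi[OF p])
      note rec = ids_recursion[OF p m res0 z(1,2) IH(1)]
      show "finite (ids (r * x)) \<and> finite (divisors ramified (r * x)) \<and>
          card (ids (r * x)) = sum weight (divisors ramified (r * x))"
      proof (cases "ramified p")
        case True
        have "divisors ramified (p * z) = divisors ramified z" by (rule divisors_ramified[where Q = ramified, OF p True z(1)])
        thus ?thesis unfolding z(3) using rec IH card_maxi[OF p] True by simp
      next
        case False
        have nr: "\<forall>p'. prm p' \<longrightarrow> ramified p' \<longrightarrow> \<not> p' \<preceq> p"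
          using False prm_dv_prm[OF _ p] ramified_assoc by blast
        note S = sum_weight_split[where Q = ramified, OF p nr z(1,2) IH(2)]
        show ?thesis unfolding z(3) using rec S IH IH' card_maxi[OF p] False by simp
      qed
    qed
  qed
  thus ?thesis using assms(3) by blast
qed

end

section \<open>Completions\<close>

context pid_in_field
begin

text \<open>\<open>V p n\<close> is the set of \<open>x\<close> with \<open>v\<^sub>p(x) \<ge> n\<close>.\<close>

definition V :: "'k \<Rightarrow> nat \<Rightarrow> 'k set" where
  "V p n = {x. \<exists>z\<in>R. \<not> p \<preceq> z \<and> p ^ n \<preceq> z * x}"

definition cauchy :: "'k \<Rightarrow> (nat \<Rightarrow> 'k) \<Rightarrow> bool" where
  "cauchy p s \<longleftrightarrow> (\<forall>n. \<exists>N. \<forall>k\<ge>N. \<forall>l\<ge>N. s k - s l \<in> V p n)"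

definition null :: "'k \<Rightarrow> (nat \<Rightarrow> 'k) \<Rightarrow> bool" where
  "null p s \<longleftrightarrow> (\<forall>n. \<exists>N. \<forall>k\<ge>N. s k \<in> V p n)"

end

locale pid_prime = pid_in_field R for R :: "'k::field_char_0 set" +
  fixes p :: 'k
  assumes p: "prm p"
begin

lemma pR [simp]: "p \<in> R" "p \<noteq> 0"
  using p by auto

lemma V_add: "x \<in> V p n \<Longrightarrow> y \<in> V p n \<Longrightarrow> x + y \<in> V p n"
proof -
  assume "x \<in> V p n" "y \<in> V p n"
  then obtain z w where z: "z \<in> R" "\<not> p \<preceq> z" "p ^ n \<preceq> z * x" and w: "w \<in> R" "\<not> p \<preceq> w" "p ^ n \<preceq> w * y"
    unfolding V_def by blast
  have "p ^ n \<preceq> w * (z * x) + z * (w * y)" by (rule dv_add[OF dv_mult[OF z(3) w(1)] dv_mult[OF w(3) z(1)]])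
  hence "p ^ n \<preceq> (z * w) * (x + y)" by (simp add: algebra_simps)
  moreover have "\<not> p \<preceq> z * w" using prm_dv_mult[OF p] z w by blast
  ultimately show ?thesis unfolding V_def using z(1) w(1) by blast
qed

lemma V_mult: "x \<in> V p n \<Longrightarrow> y \<in> V p m \<Longrightarrow> x * y \<in> V p (n + m)"
proof -
  assume "x \<in> V p n" "y \<in> V p m"
  then obtain z w where z: "z \<in> R" "\<not> p \<preceq> z" "p ^ n \<preceq> z * x" and w: "w \<in> R" "\<not> p \<preceq> w" "p ^ m \<preceq> w * y"
    unfolding V_def by blast
  obtain c where c: "c \<in> R" "z * x = p ^ n * c" using z by (auto simp: dv_def)
  obtain d where d: "d \<in> R" "w * y = p ^ m * d" using w by (auto simp: dv_def)
  have "(z * w) * (x * y) = (z * x) * (w * y)" by (simp add: mult_ac)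
  also have "\<dots> = p ^ (n + m) * (c * d)" unfolding c(2) d(2) by (simp add: power_add mult_ac)
  finally have "p ^ (n + m) \<preceq> (z * w) * (x * y)" using c d dvI by blast
  moreover have "\<not> p \<preceq> z * w" using prm_dv_mult[OF p] z w by blast
  ultimately show ?thesis unfolding V_def using z(1) w(1) by blast
qed

lemma V_mem: "x \<in> R \<Longrightarrow> p ^ n \<preceq> x \<Longrightarrow> x \<in> V p n"
  unfolding V_def using prm_nonunit[OF p] by (auto intro!: bexI[of _ 1])

text \<open>On \<open>R\<close> the localization adds nothing: multipliers prime to \<open>p\<close>
  cancel by \<open>prm_power_cancel\<close>.\<close>

lemma V_mem_iff: "x \<in> R \<Longrightarrow> x \<in> V p n \<longleftrightarrow> p ^ n \<preceq> x"
  using V_mem prm_power_cancel[OF p] unfolding V_def by blast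

lemma V_R: "x \<in> R \<Longrightarrow> x \<in> V p 0"
  by (rule V_mem) (simp_all add: dv_one)

lemma V_0 [simp]: "0 \<in> V p n"
  by (rule V_mem) auto

lemma V_scale: "c \<in> R \<Longrightarrow> x \<in> V p n \<Longrightarrow> c * x \<in> V p n"
  using V_mult[OF V_R, of c x n] by simp

lemma V_minus: "x \<in> V p n \<Longrightarrow> - x \<in> V p n"
  using V_scale[of "- 1" x n] by simp

lemma V_diff: "x \<in> V p n \<Longrightarrow> y \<in> V p n \<Longrightarrow> x - y \<in> V p n"
  using V_add[OF _ V_minus, of x n y] by simp

lemma V_mono: "m \<le> n \<Longrightarrow> x \<in> V p n \<Longrightarrow> x \<in> V p m"
proof -
  assume "m \<le> n" "x \<in> V p n"
  moreover have "p ^ m \<preceq> p ^ n" using \<open>m \<le> n\<close> by (auto simp: le_iff_add power_add)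
  ultimately show ?thesis unfolding V_def using dv_trans by blast
qed

lemma V_cancel: "p ^ c * x \<in> V p (n + c) \<longleftrightarrow> x \<in> V p n"
proof -
  have "p ^ (n + c) \<preceq> z * (p ^ c * x) \<longleftrightarrow> p ^ n \<preceq> z * x" for z
    using dv_mult_cancel[of "p ^ c" "p ^ n" "z * x"] by (simp add: power_add mult_ac)
  thus ?thesis unfolding V_def by simp
qed

lemma V_bounded: "\<exists>c. p ^ c * x \<in> V p 0"
proof -
  obtain w where w: "w \<in> R" "w \<noteq> 0" "w * x \<in> R" using fraction by blast
  obtain n v where v: "v \<in> R" "\<not> p \<preceq> v" "w = p ^ n * v" by (rule prm_multiplicity[OF p w(1,2)])
  have "v * (p ^ n * x) \<in> R" using w(3) v(3) by (simp add: mult_ac)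
  hence "p ^ n * x \<in> V p 0" unfolding V_def using v by (auto simp: dv_one)
  thus ?thesis by blast
qed

text \<open>Outside \<open>V p n\<close> the valuation of \<open>x\<close> is less than
  \<open>n\<close>, so that of p^n / x is positive. The exponents \<open>k\<close> and
  \<open>l\<close> belong to a numerator and a denominator of \<open>x\<close>.\<close>

lemma V_inverse: "x \<notin> V p n \<Longrightarrow> p ^ n * inverse x \<in> V p 0"
proof -
  assume x: "x \<notin> V p n"
  hence x0: "x \<noteq> 0" by auto
  obtain w where w: "w \<in> R" "w \<noteq> 0" "w * x \<in> R" using fraction by blast
  have "w * x \<noteq> 0" using w x0 by simp
  then obtain k u where u: "u \<in> R" "\<not> p \<preceq> u" "w * x = p ^ k * u" by (rule prm_multiplicity[OF p w(3)])
  obtain l v where v: "v \<in> R" "\<not> p \<preceq> v" "w = p ^ l * v" by (rule prm_multiplicity[OF p w(1,2)])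
  have e: "p ^ l * (v * x) = p ^ k * u" using u(3) v(3) by (simp add: mult.assoc)
  have "k < n + l"
  proof (rule ccontr)
    assume "\<not> k < n + l"
    then obtain m where "k = l + (n + m)" by (metis add.assoc add.commute le_iff_add not_less)
    hence "p ^ l * (v * x) = p ^ l * (p ^ n * (p ^ m * u))" using e by (simp add: power_add mult.assoc)
    hence "v * x = p ^ n * (p ^ m * u)" by simp
    hence "p ^ n \<preceq> v * x" using u by simp
    thus False using x v unfolding V_def by blast
  qed
  then obtain m where m: "n + l = k + m" by (metis le_iff_add less_imp_le)
  have "p ^ k * (u * (p ^ n * inverse x)) = p ^ k * (p ^ m * v)"
  proof -
    have "p ^ k * (u * (p ^ n * inverse x)) = p ^ l * (v * x) * (p ^ n * inverse x)" using e by (simp add: mult.assoc)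
    also have "\<dots> = p ^ (n + l) * v" using x0 by (simp add: power_add field_simps)
    finally show ?thesis unfolding m by (simp add: power_add mult.assoc)
  qed
  hence "u * (p ^ n * inverse x) = p ^ m * v" by simp
  hence "u * (p ^ n * inverse x) \<in> R" using v by simp
  thus ?thesis unfolding V_def using u by (auto simp: dv_one)
qed

lemma V_all_imp_0: "(\<And>n. x \<in> V p n) \<Longrightarrow> x = 0"
proof -
  assume x: "\<And>n. x \<in> V p n"
  obtain w where w: "w \<in> R" "w \<noteq> 0" "w * x \<in> R" using fraction by blast
  have "p ^ n \<preceq> w * x" for n using V_mem_iff[OF w(3)] V_scale[OF w(1) x] by blast
  hence "w * x = 0" using prm_power_dv_imp_0[OF p w(3)] by blast
  thus ?thesis using w by simp
qed

lemma cauchy_const [simp]: "cauchy p (\<lambda>_. x)"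
  unfolding cauchy_def by simp

lemma cauchy_add: "cauchy p s \<Longrightarrow> cauchy p t \<Longrightarrow> cauchy p (\<lambda>k. s k + t k)"
  unfolding cauchy_def
proof
  fix n
  assume "\<forall>n. \<exists>N. \<forall>k\<ge>N. \<forall>l\<ge>N. s k - s l \<in> V p n" "\<forall>n. \<exists>N. \<forall>k\<ge>N. \<forall>l\<ge>N. t k - t l \<in> V p n"
  then obtain M N where MN: "\<And>k l. k \<ge> M \<Longrightarrow> l \<ge> M \<Longrightarrow> s k - s l \<in> V p n" "\<And>k l. k \<ge> N \<Longrightarrow> l \<ge> N \<Longrightarrow> t k - t l \<in> V p n"
    by meson
  have "s k + t k - (s l + t l) \<in> V p n" if "k \<ge> max M N" "l \<ge> max M N" for k l
    using V_add[OF MN(1)[of k l] MN(2)[of k l]] that by (simp add: algebra_simps)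
  thus "\<exists>N. \<forall>k\<ge>N. \<forall>l\<ge>N. s k + t k - (s l + t l) \<in> V p n" by blast
qed

lemma cauchy_bounded:
  assumes "cauchy p s"
  obtains c N where "\<And>k. k \<ge> N \<Longrightarrow> p ^ c * s k \<in> V p 0"
proof -
  obtain N where N: "\<And>k l. k \<ge> N \<Longrightarrow> l \<ge> N \<Longrightarrow> s k - s l \<in> V p 0" using assms unfolding cauchy_def by meson
  obtain c where c: "p ^ c * s N \<in> V p 0" using V_bounded by blast
  have "p ^ c * s k \<in> V p 0" if "k \<ge> N" for k
  proof -
    have "p ^ c * (s k - s N) \<in> V p 0" using N[of k N] that by (intro V_scale) auto
    from V_add[OF this c] show ?thesis by (simp add: algebra_simps)
  qed
  thus ?thesis using that by blast
qed

lemma null_imp_cauchy: "null p s \<Longrightarrow> cauchy p s"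
  unfolding null_def cauchy_def by (meson V_diff)

lemma null_add: "null p s \<Longrightarrow> null p t \<Longrightarrow> null p (\<lambda>k. s k + t k)"
  unfolding null_def
proof
  fix n
  assume "\<forall>n. \<exists>N. \<forall>k\<ge>N. s k \<in> V p n" "\<forall>n. \<exists>N. \<forall>k\<ge>N. t k \<in> V p n"
  then obtain M N where MN: "\<And>k. k \<ge> M \<Longrightarrow> s k \<in> V p n" "\<And>k. k \<ge> N \<Longrightarrow> t k \<in> V p n"
    by meson
  have "s k + t k \<in> V p n" if "k \<ge> max M N" for k
    using V_add[OF MN(1)[of k] MN(2)[of k]] that by simp
  thus "\<exists>N. \<forall>k\<ge>N. s k + t k \<in> V p n" by blast
qed

lemma null_mult: "null p s \<Longrightarrow> cauchy p t \<Longrightarrow> null p (\<lambda>k. s k * t k)"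
  unfolding null_def
proof
  fix n assume s: "\<forall>n. \<exists>N. \<forall>k\<ge>N. s k \<in> V p n" and t: "cauchy p t"
  obtain c N where c: "\<And>k. k \<ge> N \<Longrightarrow> p ^ c * t k \<in> V p 0" using cauchy_bounded[OF t] by blast
  obtain M where M: "\<And>k. k \<ge> M \<Longrightarrow> s k \<in> V p (n + c)" using s by meson
  have "s k * t k \<in> V p n" if k: "k \<ge> max M N" for k
  proof -
    have "s k * (p ^ c * t k) \<in> V p (n + c + 0)" using k by (intro V_mult M c) auto
    hence "p ^ c * (s k * t k) \<in> V p (n + c)" by (simp add: mult_ac)
    thus ?thesis using V_cancel by blast
  qed
  thus "\<exists>N. \<forall>k\<ge>N. s k * t k \<in> V p n" by blast
qed

lemma cauchy_mult: "cauchy p s \<Longrightarrow> cauchy p t \<Longrightarrow> cauchy p (\<lambda>k. s k * t k)"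
  unfolding cauchy_def[of p "\<lambda>k. s k * t k"]
proof
  fix n assume s: "cauchy p s" and t: "cauchy p t"
  obtain c M where c: "\<And>k. k \<ge> M \<Longrightarrow> p ^ c * s k \<in> V p 0" using cauchy_bounded[OF s] by blast
  obtain d N where d: "\<And>k. k \<ge> N \<Longrightarrow> p ^ d * t k \<in> V p 0" using cauchy_bounded[OF t] by blast
  obtain A where A: "\<And>k l. k \<ge> A \<Longrightarrow> l \<ge> A \<Longrightarrow> s k - s l \<in> V p (n + d)" using s unfolding cauchy_def by meson
  obtain B where B: "\<And>k l. k \<ge> B \<Longrightarrow> l \<ge> B \<Longrightarrow> t k - t l \<in> V p (n + c)" using t unfolding cauchy_def by meson
  define L where "L = Max {A, B, M, N}"
  have "s k * t k - s l * t l \<in> V p n" if kl: "k \<ge> L" "l \<ge> L" for k l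
  proof -
    have ge: "k \<ge> A" "l \<ge> A" "k \<ge> B" "l \<ge> B" "l \<ge> M" "k \<ge> N" using kl unfolding L_def by auto
    have "(s k - s l) * (p ^ d * t k) \<in> V p (n + d + 0)" "(t k - t l) * (p ^ c * s l) \<in> V p (n + c + 0)"
      using ge by (intro V_mult A B c d; simp)+
    hence "p ^ d * ((s k - s l) * t k) \<in> V p (n + d)" "p ^ c * ((t k - t l) * s l) \<in> V p (n + c)"
      by (simp_all add: mult_ac)
    hence "(s k - s l) * t k + (t k - t l) * s l \<in> V p n" using V_cancel V_add by blast
    thus ?thesis by (simp add: algebra_simps)
  qed
  thus "\<exists>N. \<forall>k\<ge>N. \<forall>l\<ge>N. s k * t k - s l * t l \<in> V p n" by blast
qed

lemma cauchy_minus: "cauchy p s \<Longrightarrow> cauchy p (\<lambda>k. - s k)"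
  using cauchy_mult[OF cauchy_const[of "- 1"], of s] by simp

lemma cauchy_diff: "cauchy p s \<Longrightarrow> cauchy p t \<Longrightarrow> cauchy p (\<lambda>k. s k - t k)"
  using cauchy_add[OF _ cauchy_minus, of s t] by simp

lemma null_minus: "null p s \<Longrightarrow> null p (\<lambda>k. - s k)"
  using null_mult[of s "\<lambda>_. - 1"] by simp

lemma null_const_iff: "null p (\<lambda>_. x) \<longleftrightarrow> x = 0"
  using V_all_imp_0[of x] unfolding null_def by auto

lemma null_eventually_0: "(\<And>k. k \<ge> N \<Longrightarrow> s k = 0) \<Longrightarrow> null p s"
  unfolding null_def by (metis V_0)

lemma cauchy_not_null:
  assumes "cauchy p s" "\<not> null p s"
  obtains n N where "\<And>k. k \<ge> N \<Longrightarrow> s k \<notin> V p n"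
proof -
  obtain n where n: "\<And>N. \<exists>k\<ge>N. s k \<notin> V p n" using assms(2) unfolding null_def by blast
  obtain N where N: "\<And>k l. k \<ge> N \<Longrightarrow> l \<ge> N \<Longrightarrow> s k - s l \<in> V p n" using assms(1) unfolding cauchy_def by meson
  have "s k \<notin> V p n" if "k \<ge> N" for k
  proof
    assume k: "s k \<in> V p n"
    obtain l where l: "l \<ge> N" "s l \<notin> V p n" using n by blast
    have "s l - s k + s k \<in> V p n" using V_add[OF N[OF l(1) that] k] .
    thus False using l by simp
  qed
  thus ?thesis using that by blast
qed

lemma cauchy_inverse:
  assumes s: "cauchy p s" "\<not> null p s"
  shows "cauchy p (\<lambda>k. inverse (s k))" "\<exists>N. \<forall>k\<ge>N. s k \<noteq> 0"
proof -
  obtain n N where N: "\<And>k. k \<ge> N \<Longrightarrow> s k \<notin> V p n" using cauchy_not_null[OF s] by blast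
  have nz: "s k \<noteq> 0" if "k \<ge> N" for k using N[OF that] by auto
  thus "\<exists>N. \<forall>k\<ge>N. s k \<noteq> 0" by blast
  show "cauchy p (\<lambda>k. inverse (s k))" unfolding cauchy_def
  proof
    fix m
    \<comment> \<open>Each of the two inverses costs \<open>n\<close> in precision, hence the margin
      \<open>n + n\<close>.\<close>
    obtain M where M: "\<And>k l. k \<ge> M \<Longrightarrow> l \<ge> M \<Longrightarrow> s k - s l \<in> V p (m + (n + n))" using s(1) unfolding cauchy_def by meson
    have "inverse (s k) - inverse (s l) \<in> V p m" if kl: "k \<ge> max M N" "l \<ge> max M N" for k l
    proof -
      have "(s l - s k) * (p ^ n * inverse (s k)) * (p ^ n * inverse (s l)) \<in> V p (m + (n + n) + 0 + 0)"
        using kl N by (intro V_mult M V_inverse) auto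
      moreover have "(s l - s k) * (p ^ n * inverse (s k)) * (p ^ n * inverse (s l)) =
          p ^ (n + n) * (inverse (s k) - inverse (s l))"
        using nz[of k] nz[of l] kl by (simp add: power_add field_simps)
      ultimately show ?thesis using V_cancel by simp
    qed
    thus "\<exists>N. \<forall>k\<ge>N. \<forall>l\<ge>N. inverse (s k) - inverse (s l) \<in> V p m" by blast
  qed
qed

end

section \<open>Powers of principal ideals and the completion at a prime\<close>

context number_ring
begin

lemma carrier_eq: "carrier ring_of_integers = R"
  using R_eq by simp

lemma ideal_prod_pri:
  assumes "c \<in> R" "d \<in> R"
  shows "ideal_prod ring_of_integers (pri c) (pri d) = pri (c * d)"
proof (intro equalityI subsetI)
  fix x assume "x \<in> ideal_prod ring_of_integers (pri c) (pri d)"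
  thus "x \<in> pri (c * d)"
  proof induction
    case (prod u v)
    then obtain u' v' where "u' \<in> R" "v' \<in> R" "u = c * u'" "v = d * v'" unfolding pri_def dv_def by blast
    hence "u * v = (c * d) * (u' * v')" "u' * v' \<in> R" by (auto simp: mult_ac)
    thus ?case unfolding pri_def using dvI by simp
  next
    case (sum u v)
    thus ?case unfolding pri_def using dv_add by simp
  qed
next
  fix x assume "x \<in> pri (c * d)"
  then obtain r where "r \<in> R" "x = c * (d * r)" unfolding pri_def dv_def by (auto simp: mult.assoc)
  moreover have "c \<in> pri c" "d * r \<in> pri d" using \<open>r \<in> R\<close> unfolding pri_def by auto
  ultimately show "x \<in> ideal_prod ring_of_integers (pri c) (pri d)"
    using ideal_prod.prod[of c "pri c" "d * r" "pri d" ring_of_integers] by simp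
qed

lemma pri_power: "d \<in> R \<Longrightarrow> pri d [^]\<^bsub>ideals_set ring_of_integers\<^esub> (n :: nat) = pri (d ^ n)"
proof (induction n)
  case 0
  have "pri 1 = R" unfolding pri_def using dv_one by auto
  thus ?case using carrier_eq by (simp add: nat_pow_def ideals_set_def)
next
  case (Suc n)
  have "pri d [^]\<^bsub>ideals_set ring_of_integers\<^esub> Suc n = ideal_prod ring_of_integers (pri (d ^ n)) (pri d)"
    using Suc by (simp add: nat_pow_def ideals_set_def)
  also have "\<dots> = pri (d ^ n * d)" using Suc.prems by (intro ideal_prod_pri) auto
  finally show ?case by (simp add: mult.commute)
qed

lemma prime_nbhd_eq:
  assumes "prm p"
  shows "prime_nbhd (pri p) n = V p n"
proof -
  have "prime_nbhd (pri p) n = {y / z | y z. p ^ n \<preceq> y \<and> z \<in> R \<and> \<not> p \<preceq> z}"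
    unfolding prime_nbhd_def pri_power[OF prm_mem[OF assms]] carrier_eq unfolding pri_def by blast
  also have "\<dots> = V p n"
  proof (intro equalityI subsetI)
    fix x assume "x \<in> {y / z | y z. p ^ n \<preceq> y \<and> z \<in> R \<and> \<not> p \<preceq> z}"
    then obtain y z where yz: "x = y / z" "p ^ n \<preceq> y" "z \<in> R" "\<not> p \<preceq> z" by blast
    moreover have "z \<noteq> 0" using yz by auto
    ultimately have "z * x = y" by simp
    thus "x \<in> V p n" unfolding V_def using yz by auto
  next
    fix x assume "x \<in> V p n"
    then obtain z where z: "z \<in> R" "\<not> p \<preceq> z" "p ^ n \<preceq> z * x" unfolding V_def by blast
    moreover have "z \<noteq> 0" using z by auto
    hence "x = (z * x) / z" by simp
    ultimately show "x \<in> {y / z | y z. p ^ n \<preceq> y \<and> z \<in> R \<and> \<not> p \<preceq> z}" by blast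
  qed
  finally show ?thesis .
qed

end

locale number_prime = number_ring R + pid_prime R p for R :: "'k::field_char_0 set" and p :: 'k
begin

abbreviation "C \<equiv> cauchy_ring (pri p)"
abbreviation "I0 \<equiv> null_seqs (pri p)"

lemma null_seqs_eq: "I0 = Collect (null p)"
  unfolding null_seqs_def null_def prime_nbhd_eq[OF p] by blast

lemma C_simps [simp]:
  "carrier C = Collect (cauchy p)" "s \<otimes>\<^bsub>C\<^esub> t = (\<lambda>k. s k * t k)" "s \<oplus>\<^bsub>C\<^esub> t = (\<lambda>k. s k + t k)"
  "\<one>\<^bsub>C\<^esub> = (\<lambda>_. 1)" "\<zero>\<^bsub>C\<^esub> = (\<lambda>_. 0)"
  unfolding cauchy_ring_def cauchy_seqs_def cauchy_def prime_nbhd_eq[OF p] by auto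

lemma cring_C: "cring C"
proof (rule cringI)
  show "abelian_group C"
  proof (rule abelian_groupI)
    show "\<exists>y\<in>carrier C. y \<oplus>\<^bsub>C\<^esub> x = \<zero>\<^bsub>C\<^esub>" if "x \<in> carrier C" for x
      using that by (intro bexI[of _ "\<lambda>k. - x k"]) (auto intro: cauchy_minus)
  qed (auto intro: cauchy_add simp: add_ac)
  show "Group.comm_monoid C"
    by (rule comm_monoidI) (auto intro: cauchy_mult simp: mult_ac)
qed (auto simp: distrib_right)

lemma a_inv_C: "cauchy p s \<Longrightarrow> \<ominus>\<^bsub>C\<^esub> s = (\<lambda>k. - s k)"
proof -
  interpret cring C by (rule cring_C)
  assume "cauchy p s"
  thus ?thesis by (intro minus_equality) (auto intro: cauchy_minus)
qed

lemma ideal_I0: "ideal I0 C"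
proof -
  interpret cring C by (rule cring_C)
  show ?thesis
  proof (rule idealI)
    show "Ring.ring C" by (rule ring_axioms)
    show "subgroup I0 (add_monoid C)"
    proof (rule subgroup.intro)
      fix s assume "s \<in> I0"
      hence "null p s" by (simp add: null_seqs_eq)
      moreover from this have "inv\<^bsub>add_monoid C\<^esub> s = (\<lambda>k. - s k)"
        using a_inv_C[OF null_imp_cauchy] unfolding a_inv_def by blast
      ultimately show "inv\<^bsub>add_monoid C\<^esub> s \<in> I0" using null_minus by (simp add: null_seqs_eq)
    qed (auto simp: null_seqs_eq null_const_iff intro: null_imp_cauchy null_add)
  qed (auto simp: null_seqs_eq mult.commute intro: null_mult)
qed

definition cls :: "(nat \<Rightarrow> 'k) \<Rightarrow> (nat \<Rightarrow> 'k) set" where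
  "cls s = I0 +>\<^bsub>C\<^esub> s"

abbreviation "L \<equiv> completion (pri p)"

lemma cring_L: "cring L"
  unfolding completion_def by (rule ideal.quotient_is_cring[OF ideal_I0 cring_C])

lemma cls_hom: "cls \<in> ring_hom C L"
  using ideal.rcos_ring_hom[OF ideal_I0] unfolding cls_def completion_def by simp

lemma cls_simps:
  "cauchy p s \<Longrightarrow> cls s \<in> carrier L"
  "cauchy p s \<Longrightarrow> cauchy p t \<Longrightarrow> cls s \<otimes>\<^bsub>L\<^esub> cls t = cls (\<lambda>k. s k * t k)"
  "cauchy p s \<Longrightarrow> cauchy p t \<Longrightarrow> cls s \<oplus>\<^bsub>L\<^esub> cls t = cls (\<lambda>k. s k + t k)"
  "\<one>\<^bsub>L\<^esub> = cls (\<lambda>_. 1)"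
  using ring_hom_closed[OF cls_hom, of s] ring_hom_mult[OF cls_hom, of s t] ring_hom_add[OF cls_hom, of s t]
    ring_hom_one[OF cls_hom] by simp_all

lemma cls_eq_iff:
  assumes "cauchy p s" "cauchy p t"
  shows "cls s = cls t \<longleftrightarrow> null p (\<lambda>k. s k - t k)"
proof -
  have mem: "u \<in> cls w \<longleftrightarrow> null p (\<lambda>k. u k - w k)" for u w
  proof
    assume "u \<in> cls w"
    then obtain z where "null p z" "u = (\<lambda>k. z k + w k)"
      unfolding cls_def a_r_coset_def' null_seqs_eq by auto
    thus "null p (\<lambda>k. u k - w k)" by simp
  next
    assume "null p (\<lambda>k. u k - w k)"
    moreover have "u = (\<lambda>k. (u k - w k) + w k)" by simp
    ultimately show "u \<in> cls w" unfolding cls_def a_r_coset_def' null_seqs_eq by force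
  qed
  show ?thesis
  proof
    assume "cls s = cls t"
    moreover have "s \<in> cls s" using mem null_const_iff[of 0] by simp
    ultimately show "null p (\<lambda>k. s k - t k)" using mem by simp
  next
    assume st: "null p (\<lambda>k. s k - t k)"
    have "null p (\<lambda>k. u k - s k) \<longleftrightarrow> null p (\<lambda>k. u k - t k)" for u
      using null_add[OF _ st, of "\<lambda>k. u k - s k"] null_add[OF _ null_minus[OF st], of "\<lambda>k. u k - t k"] by auto
    thus "cls s = cls t" using mem by blast
  qed
qed

lemma zero_L: "\<zero>\<^bsub>L\<^esub> = cls (\<lambda>_. 0)"
proof -
  interpret L: cring L by (rule cring_L)
  have "cls (\<lambda>_. 0) \<oplus>\<^bsub>L\<^esub> cls (\<lambda>_. 0) = cls (\<lambda>_. 0)" by (simp add: cls_simps)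
  moreover have "cls (\<lambda>_. 0) \<in> carrier L" by (simp add: cls_simps)
  ultimately show ?thesis by (metis L.add.r_cancel_one)
qed

lemma cls_minus: "cauchy p s \<Longrightarrow> \<ominus>\<^bsub>L\<^esub> cls s = cls (\<lambda>k. - s k)"
proof -
  interpret L: cring L by (rule cring_L)
  assume s: "cauchy p s"
  show ?thesis by (rule L.minus_equality) (use s cauchy_minus[OF s] in \<open>simp_all add: cls_simps zero_L\<close>)
qed

lemma cls_diff: "cauchy p s \<Longrightarrow> cauchy p t \<Longrightarrow> cls s \<ominus>\<^bsub>L\<^esub> cls t = cls (\<lambda>k. s k - t k)"
  unfolding a_minus_def using cauchy_minus[of t] by (simp add: cls_minus cls_simps)

lemma cls_surj: "x \<in> carrier L \<Longrightarrow> \<exists>s. cauchy p s \<and> x = cls s"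
  unfolding completion_def cls_def FactRing_def A_RCOSETS_def' by auto

lemma cls_embedding: "completion_embedding (pri p) x = cls (\<lambda>_. x)"
  unfolding completion_embedding_def cls_def ..

end

section \<open>The quaternion algebra over the completion\<close>

locale local_order = principal_order R \<iota> a b i j H + number_prime R p
  for R :: "'k::field_char_0 set" and \<iota> :: "'k \<Rightarrow> 'q::ring_1" and a b :: 'k and i j :: 'q and H :: "'q set"
    and p :: 'k
begin

abbreviation "B \<equiv> base_change (completion (pri p)) (completion_embedding (pri p)) a b"

definition cauchyq :: "(nat \<Rightarrow> 'q) \<Rightarrow> bool" where
  "cauchyq \<xi> \<longleftrightarrow> cauchy p (\<lambda>k. c0 (\<xi> k)) \<and> cauchy p (\<lambda>k. c1 (\<xi> k)) \<and>
     cauchy p (\<lambda>k. c2 (\<xi> k)) \<and> cauchy p (\<lambda>k. c3 (\<xi> k))"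

definition clq where
  "clq \<xi> = (cls (\<lambda>k. c0 (\<xi> k)), cls (\<lambda>k. c1 (\<xi> k)), cls (\<lambda>k. c2 (\<xi> k)), cls (\<lambda>k. c3 (\<xi> k)))"

text \<open>\<open>B\<close> is the image of this ring under \<open>clq\<close>, so the ring axioms
  of the quaternion algebra over the completion are inherited from the algebra itself instead of
  being verified on quadruples.\<close>

definition seqs :: "(nat \<Rightarrow> 'q) ring" where
  "seqs = \<lparr>carrier = Collect cauchyq, monoid.mult = (\<lambda>\<xi> \<eta> k. \<xi> k * \<eta> k), one = (\<lambda>_. 1),
     ring.zero = (\<lambda>_. 0), add = (\<lambda>\<xi> \<eta> k. \<xi> k + \<eta> k)\<rparr>"

lemma cauchyq_const: "cauchyq (\<lambda>_. x)"
  unfolding cauchyq_def by simp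

lemma cauchyq_add: "cauchyq \<xi> \<Longrightarrow> cauchyq \<eta> \<Longrightarrow> cauchyq (\<lambda>k. \<xi> k + \<eta> k)"
  unfolding cauchyq_def by (simp add: cauchy_add)

lemma cauchyq_minus: "cauchyq \<xi> \<Longrightarrow> cauchyq (\<lambda>k. - \<xi> k)"
  unfolding cauchyq_def by (simp add: cauchy_minus)

lemma cauchyq_mult: "cauchyq \<xi> \<Longrightarrow> cauchyq \<eta> \<Longrightarrow> cauchyq (\<lambda>k. \<xi> k * \<eta> k)"
  unfolding cauchyq_def coords_mult
  by (intro conjI cauchy_add cauchy_diff cauchy_mult cauchy_const; simp)

lemma cauchyq_scale: "cauchy p s \<Longrightarrow> cauchyq \<xi> \<Longrightarrow> cauchyq (\<lambda>k. \<iota> (s k) * \<xi> k)"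
  unfolding cauchyq_def by (simp add: cauchy_mult)

lemma cauchyq_cj: "cauchyq \<xi> \<Longrightarrow> cauchyq (\<lambda>k. cj (\<xi> k))"
  unfolding cauchyq_def by (simp add: cauchy_minus)

lemma cauchyq_N: "cauchyq \<xi> \<Longrightarrow> cauchy p (\<lambda>k. N (\<xi> k))"
  unfolding cauchyq_def N_def power2_eq_square
  by (intro cauchy_add cauchy_diff cauchy_mult cauchy_const; simp)

lemma ring_seqs: "Ring.ring seqs"
proof (rule ringI)
  show "abelian_group seqs"
  proof (rule abelian_groupI)
    show "\<exists>y\<in>carrier seqs. y \<oplus>\<^bsub>seqs\<^esub> x = \<zero>\<^bsub>seqs\<^esub>" if "x \<in> carrier seqs" for x
      using that by (intro bexI[of _ "\<lambda>k. - x k"]) (auto simp: seqs_def intro: cauchyq_minus)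
  qed (auto simp: seqs_def add_ac intro: cauchyq_add cauchyq_const)
  show "Group.monoid seqs"
    by (rule monoidI) (auto simp: seqs_def mult.assoc intro: cauchyq_mult cauchyq_const)
qed (auto simp: seqs_def distrib_left distrib_right)

lemma B_simps:
  "carrier B = carrier L \<times> carrier L \<times> carrier L \<times> carrier L"
  "\<one>\<^bsub>B\<^esub> = (\<one>\<^bsub>L\<^esub>, \<zero>\<^bsub>L\<^esub>, \<zero>\<^bsub>L\<^esub>, \<zero>\<^bsub>L\<^esub>)" "\<zero>\<^bsub>B\<^esub> = (\<zero>\<^bsub>L\<^esub>, \<zero>\<^bsub>L\<^esub>, \<zero>\<^bsub>L\<^esub>, \<zero>\<^bsub>L\<^esub>)"
  unfolding base_change_def quat_ring_def by simp_all

lemma clq_mult: "cauchyq \<xi> \<Longrightarrow> cauchyq \<eta> \<Longrightarrow> clq \<xi> \<otimes>\<^bsub>B\<^esub> clq \<eta> = clq (\<lambda>k. \<xi> k * \<eta> k)"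
  unfolding cauchyq_def clq_def base_change_def quat_ring_def cls_embedding coords_mult
  by (simp add: cls_simps cls_diff cauchy_mult cauchy_add cauchy_diff)

lemma clq_add: "cauchyq \<xi> \<Longrightarrow> cauchyq \<eta> \<Longrightarrow> clq \<xi> \<oplus>\<^bsub>B\<^esub> clq \<eta> = clq (\<lambda>k. \<xi> k + \<eta> k)"
  unfolding cauchyq_def clq_def base_change_def quat_ring_def by (simp add: cls_simps)

lemma clq_one: "clq (\<lambda>_. 1) = \<one>\<^bsub>B\<^esub>" and clq_zero: "clq (\<lambda>_. 0) = \<zero>\<^bsub>B\<^esub>"
  unfolding clq_def B_simps by (simp_all add: cls_simps zero_L)

lemma clq_surj: "x \<in> carrier B \<Longrightarrow> \<exists>\<xi>. cauchyq \<xi> \<and> x = clq \<xi>"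
proof -
  assume "x \<in> carrier B"
  then obtain t u v w where x: "x = (t, u, v, w)" "t \<in> carrier L" "u \<in> carrier L" "v \<in> carrier L" "w \<in> carrier L"
    unfolding B_simps by auto
  obtain t' where t': "cauchy p t'" "t = cls t'" using cls_surj[OF x(2)] by blast
  obtain u' where u': "cauchy p u'" "u = cls u'" using cls_surj[OF x(3)] by blast
  obtain v' where v': "cauchy p v'" "v = cls v'" using cls_surj[OF x(4)] by blast
  obtain w' where w': "cauchy p w'" "w = cls w'" using cls_surj[OF x(5)] by blast
  define \<xi> where "\<xi> k = quat_of \<iota> i j (t' k, u' k, v' k, w' k)" for k
  have "cauchyq \<xi> \<and> x = clq \<xi>"
    unfolding cauchyq_def clq_def \<xi>_def coords_quat_of x(1) using t' u' v' w' by simp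
  thus ?thesis by blast
qed

lemma clq_carrier: "cauchyq \<xi> \<Longrightarrow> clq \<xi> \<in> carrier B"
  unfolding cauchyq_def clq_def B_simps by (simp add: cls_simps)

lemma clq_hom: "clq \<in> ring_hom seqs B"
  by (rule ring_hom_memI) (auto simp: seqs_def clq_carrier clq_mult clq_add clq_one)

lemma ring_B: "Ring.ring B"
proof -
  interpret S: Ring.ring seqs by (rule ring_seqs)
  have "clq ` carrier seqs = carrier B"
  proof (intro equalityI subsetI)
    fix x assume "x \<in> carrier B"
    then obtain \<xi> where "cauchyq \<xi>" "x = clq \<xi>" using clq_surj by blast
    thus "x \<in> clq ` carrier seqs" by (simp add: seqs_def)
  next
    fix x assume "x \<in> clq ` carrier seqs"
    then obtain \<xi> where "cauchyq \<xi>" "x = clq \<xi>" by (auto simp: seqs_def)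
    thus "x \<in> carrier B" using clq_carrier by blast
  qed
  hence "B \<lparr>carrier := clq ` carrier seqs, ring.zero := clq \<zero>\<^bsub>seqs\<^esub>\<rparr> = B"
    using clq_zero by (simp add: seqs_def)
  thus ?thesis using S.ring_hom_imp_img_ring[OF clq_hom] by simp
qed

lemma clq_eq_iff:
  assumes "cauchyq \<xi>" "cauchyq \<eta>"
  shows "clq \<xi> = clq \<eta> \<longleftrightarrow> null p (\<lambda>k. c0 (\<xi> k) - c0 (\<eta> k)) \<and> null p (\<lambda>k. c1 (\<xi> k) - c1 (\<eta> k)) \<and>
    null p (\<lambda>k. c2 (\<xi> k) - c2 (\<eta> k)) \<and> null p (\<lambda>k. c3 (\<xi> k) - c3 (\<eta> k))"
  using assms unfolding cauchyq_def clq_def by (simp add: cls_eq_iff)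

lemma clq_eq_0_iff:
  assumes "cauchyq \<xi>"
  shows "clq \<xi> = \<zero>\<^bsub>B\<^esub> \<longleftrightarrow> null p (\<lambda>k. c0 (\<xi> k)) \<and> null p (\<lambda>k. c1 (\<xi> k)) \<and> null p (\<lambda>k. c2 (\<xi> k)) \<and> null p (\<lambda>k. c3 (\<xi> k))"
  using clq_eq_iff[OF assms cauchyq_const[of 0]] unfolding clq_zero by simp

lemma clq_eventually_eq:
  assumes "cauchyq \<xi>" "cauchyq \<eta>" "\<And>k. k \<ge> M \<Longrightarrow> \<xi> k = \<eta> k"
  shows "clq \<xi> = clq \<eta>"
  unfolding clq_eq_iff[OF assms(1,2)]
  by (intro conjI null_eventually_0[of M]) (simp_all add: assms(3))

lemma one_neq_zero_B: "\<one>\<^bsub>B\<^esub> \<noteq> \<zero>\<^bsub>B\<^esub>"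
  using clq_eq_0_iff[OF cauchyq_const[of 1]] null_const_iff[of 1] unfolding clq_one by simp

lemma exists_multiple_in_H: "\<exists>s\<in>R. s \<noteq> 0 \<and> \<iota> s * z \<in> H"
proof -
  obtain c where c: "c \<in> R" "c \<noteq> 0" "\<iota> c * i \<in> H" "\<iota> c * j \<in> H" using H_full by blast
  obtain e where e: "e \<in> R" "e \<noteq> 0" "\<forall>x\<in>{c0 z, c1 z, c2 z, c3 z}. e * x \<in> R"
    using common_denominator[of "{c0 z, c1 z, c2 z, c3 z}"] by auto
  have "\<iota> (c * c * e) * z = \<iota> (c * c * (e * c0 z)) + \<iota> (c * (e * c1 z)) * (\<iota> c * i) + \<iota> (c * (e * c2 z)) * (\<iota> c * j)
     + \<iota> (e * c3 z) * ((\<iota> c * i) * (\<iota> c * j))"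
    by (rule coords_eqI) (simp_all add: coords_mult)
  also have "\<dots> \<in> H" using c e by auto
  finally show ?thesis using c e by (intro bexI[of _ "c * c * e"]) auto
qed

text \<open>\<open>ramified_power\<close> carried over from \<open>H\<close> to the whole algebra. A
  multiplier \<open>s\<close> with \<open>s z\<close> in \<open>H\<close> contributes its
  \<open>p\<close>-part on both sides, where it cancels. p^d is the \<open>p\<close>-part of a
  common denominator for the coordinates of \<open>H\<close>, so \<open>d\<close> depends neither on
  \<open>z\<close> nor on \<open>n\<close>.\<close>

lemma ramified_coords_bound:
  assumes "ramified p"
  obtains d where "\<And>z n. N z \<in> V p (2 * n) \<Longrightarrow> p ^ d * c0 z \<in> V p n \<and> p ^ d * c1 z \<in> V p n \<and>
     p ^ d * c2 z \<in> V p n \<and> p ^ d * c3 z \<in> V p n"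
proof -
  obtain y where y: "nrm p y" "maxi p = {rid y}" using assms unfolding ramified_def by blast
  obtain e where e: "e \<in> R" "e \<noteq> 0" "\<forall>x\<in>H. e * c0 x \<in> R \<and> e * c1 x \<in> R \<and> e * c2 x \<in> R \<and> e * c3 x \<in> R"
    using H_denominator by blast
  obtain d e' where d: "e' \<in> R" "\<not> p \<preceq> e'" "e = p ^ d * e'" by (rule prm_multiplicity[OF p e(1,2)])
  have "p ^ d * c0 z \<in> V p n \<and> p ^ d * c1 z \<in> V p n \<and> p ^ d * c2 z \<in> V p n \<and> p ^ d * c3 z \<in> V p n"
    if N: "N z \<in> V p (2 * n)" for z n
  proof -
    obtain s where s: "s \<in> R" "s \<noteq> 0" "\<iota> s * z \<in> H" using exists_multiple_in_H by blast
    obtain k s' where k: "s' \<in> R" "\<not> p \<preceq> s'" "s = p ^ k * s'" by (rule prm_multiplicity[OF p s(1,2)])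
    have "s\<^sup>2 \<in> V p (2 * k)"
      by (rule V_mem) (use s k in \<open>auto simp: power_mult_distrib power_mult[symmetric] mult.commute[of k 2]\<close>)
    hence "s\<^sup>2 * N z \<in> V p (2 * k + 2 * n)" using N by (rule V_mult)
    hence "N (\<iota> s * z) \<in> V p (2 * (k + n))" by (simp add: N_scale)
    hence "p ^ (2 * (k + n)) \<preceq> N (\<iota> s * z)" using V_mem_iff[OF N_mem[OF s(3)]] by blast
    hence "\<iota> s * z \<in> mlt (p ^ (k + n))" by (rule ramified_power[OF p y s(3)])
    then obtain h where h: "h \<in> H" "\<iota> s * z = \<iota> (p ^ (k + n)) * h" unfolding mlt_def by blast
    have "\<iota> (p ^ k) * (\<iota> s' * z) = \<iota> (p ^ k) * (\<iota> (p ^ n) * h)"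
      using h(2) unfolding k(3) by (simp add: \<iota>_mult power_add mult.assoc)
    hence z: "\<iota> s' * z = \<iota> (p ^ n) * h" by (rule \<iota>_cancel[rotated]) simp
    have nd: "\<not> p \<preceq> s' * e'" using prm_dv_mult[OF p] k d by blast
    have *: "p ^ d * c \<in> V p n" if "s' * c = p ^ n * t" "e * t \<in> R" for c t
    proof -
      have "(s' * e') * (p ^ d * c) = e * (s' * c)" unfolding d(3) by (simp add: mult_ac)
      also have "\<dots> = p ^ n * (e * t)" using that(1) by (simp add: mult_ac)
      finally have "p ^ n \<preceq> (s' * e') * (p ^ d * c)" using that(2) dvI by blast
      thus ?thesis unfolding V_def using nd k d by blast
    qed
    have "s' * c0 z = p ^ n * c0 h" "s' * c1 z = p ^ n * c1 h" "s' * c2 z = p ^ n * c2 h" "s' * c3 z = p ^ n * c3 h"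
      using arg_cong[OF z, of c0] arg_cong[OF z, of c1] arg_cong[OF z, of c2] arg_cong[OF z, of c3] by simp_all
    thus ?thesis using * e(3) h(1) by blast
  qed
  thus ?thesis using that by blast
qed

lemma ramified_null:
  assumes ram: "ramified p" and \<xi>: "cauchyq \<xi>" and N: "null p (\<lambda>k. N (\<xi> k))"
  shows "clq \<xi> = \<zero>\<^bsub>B\<^esub>"
proof -
  obtain d where d: "\<And>z n. N z \<in> V p (2 * n) \<Longrightarrow> p ^ d * c0 z \<in> V p n \<and> p ^ d * c1 z \<in> V p n \<and>
     p ^ d * c2 z \<in> V p n \<and> p ^ d * c3 z \<in> V p n" using ramified_coords_bound[OF ram] by blast
  have "\<exists>M. \<forall>k\<ge>M. c0 (\<xi> k) \<in> V p n \<and> c1 (\<xi> k) \<in> V p n \<and> c2 (\<xi> k) \<in> V p n \<and> c3 (\<xi> k) \<in> V p n" for n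
  proof -
    \<comment> \<open>The norm must be known to twice the precision of the coordinates, and
      \<open>d\<close> more absorbs their denominator.\<close>
    obtain M where M: "\<forall>k\<ge>M. N (\<xi> k) \<in> V p (2 * (n + d))" using N unfolding null_def by blast
    have "c0 (\<xi> k) \<in> V p n \<and> c1 (\<xi> k) \<in> V p n \<and> c2 (\<xi> k) \<in> V p n \<and> c3 (\<xi> k) \<in> V p n" if "k \<ge> M" for k
      using d[of "\<xi> k" "n + d"] M that V_cancel by blast
    thus ?thesis by blast
  qed
  thus ?thesis unfolding clq_eq_0_iff[OF \<xi>] null_def by meson
qed

lemma ramified_unit:
  assumes ram: "ramified p" and x: "x \<in> carrier B" "x \<noteq> \<zero>\<^bsub>B\<^esub>"
  shows "x \<in> Units B"
proof -
  obtain \<xi> where \<xi>: "cauchyq \<xi>" "x = clq \<xi>" using clq_surj[OF x(1)] by blast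
  have nn: "\<not> null p (\<lambda>k. N (\<xi> k))" using ramified_null[OF ram \<xi>(1)] x(2) \<xi>(2) by blast
  note inv = cauchy_inverse[OF cauchyq_N[OF \<xi>(1)] nn]
  \<comment> \<open>Terms of norm 0 are sent to 0 by the convention for \<open>inverse\<close>;
    there are only finitely many of them, and they do not affect the class.\<close>
  define \<eta> where "\<eta> k = \<iota> (inverse (N (\<xi> k))) * cj (\<xi> k)" for k
  have \<eta>: "cauchyq \<eta>" unfolding \<eta>_def by (intro cauchyq_scale inv cauchyq_cj \<xi>)
  obtain M where M: "\<And>k. k \<ge> M \<Longrightarrow> N (\<xi> k) \<noteq> 0" using inv(2) by blast
  have "clq (\<lambda>k. \<xi> k * \<eta> k) = clq (\<lambda>_. 1)"
    by (rule clq_eventually_eq[OF cauchyq_mult[OF \<xi>(1) \<eta>] cauchyq_const, of M])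
       (unfold \<eta>_def, rule N_nonzero_inverse(1)[OF M])
  moreover have "clq (\<lambda>k. \<eta> k * \<xi> k) = clq (\<lambda>_. 1)"
    by (rule clq_eventually_eq[OF cauchyq_mult[OF \<eta> \<xi>(1)] cauchyq_const, of M])
       (unfold \<eta>_def, rule N_nonzero_inverse(2)[OF M])
  ultimately have "clq \<xi> \<otimes>\<^bsub>B\<^esub> clq \<eta> = \<one>\<^bsub>B\<^esub>" "clq \<eta> \<otimes>\<^bsub>B\<^esub> clq \<xi> = \<one>\<^bsub>B\<^esub>"
    using clq_mult[OF \<xi>(1) \<eta>] clq_mult[OF \<eta> \<xi>(1)] clq_one by simp_all
  thus ?thesis unfolding Units_def \<xi>(2) using clq_carrier \<xi>(1) \<eta> by blast
qed

text \<open>Hensel's lemma for the polynomial \<open>s \<mapsto> N (e + s)\<close>.\<close>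

primrec hensel :: "'q \<Rightarrow> nat \<Rightarrow> 'q" where
  "hensel e 0 = e"
| "hensel e (Suc n) = hensel e n - \<iota> (N (hensel e n))"

text \<open>The derivative of N(x + s) at s = 0 is Tr x, which is 1 modulo \<open>p\<close>, so -N x
  serves as Newton step: N(x - N x) = N x (N x - (Tr x - 1)), and the second factor is divisible by
  \<open>p\<close>.\<close>

lemma hensel_props:
  assumes e: "idem p e"
  shows "hensel e n \<in> H \<and> p ^ Suc n \<preceq> N (hensel e n) \<and> p \<preceq> Tr (hensel e n) - 1"
proof (induction n)
  case 0
  thus ?case using e unfolding idem_def by simp
next
  case (Suc n)
  define x where "x = hensel e n"
  have x: "x \<in> H" "p ^ Suc n \<preceq> N x" "p \<preceq> Tr x - 1" using Suc unfolding x_def by auto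
  have pN: "p \<preceq> N x" by (rule dv_trans[OF _ x(2)]) simp
  have Ne: "N (x - \<iota> (N x)) = N x * (N x - (Tr x - 1))"
    using N_add[of x "- \<iota> (N x)"] by (simp add: cj_def Tr_def power2_eq_square algebra_simps)
  have 1: "p ^ Suc n * p \<preceq> N x * p" using dv_mult_mono[OF x(2), of p] by (simp add: mult.commute)
  have "p \<preceq> N x - (Tr x - 1)" by (rule dv_diff[OF pN x(3)])
  hence "N x * p \<preceq> N x * (N x - (Tr x - 1))" by (rule dv_mult_mono)
  hence "p ^ Suc n * p \<preceq> N (x - \<iota> (N x))" unfolding Ne by (rule dv_trans[OF 1])
  hence "p ^ Suc (Suc n) \<preceq> N (x - \<iota> (N x))" by (simp add: mult.commute mult.left_commute)
  moreover have "Tr (x - \<iota> (N x)) - 1 = (Tr x - 1) - 2 * N x" by (simp add: Tr_diff Tr_\<iota>)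
  hence "p \<preceq> Tr (x - \<iota> (N x)) - 1" using dv_diff[OF x(3) dv_mult[OF pN numeral_mem]] by metis
  moreover have "x - \<iota> (N x) \<in> H" using x(1) by auto
  ultimately show ?case unfolding x_def by simp
qed

lemma hensel_shift:
  assumes e: "idem p e"
  shows "\<exists>c\<in>R. hensel e (n + m) = hensel e n + \<iota> (p ^ n * c)"
proof (induction m)
  case 0
  show ?case by (rule bexI[of _ 0]) auto
next
  case (Suc m)
  then obtain c where c: "c \<in> R" "hensel e (n + m) = hensel e n + \<iota> (p ^ n * c)" by blast
  obtain d where d: "d \<in> R" "N (hensel e (n + m)) = p ^ Suc (n + m) * d"
    using hensel_props[OF e, of "n + m"] unfolding dv_def by blast
  have pe: "p ^ Suc (n + m) * d = p ^ n * (p ^ Suc m * d)" by (simp add: power_add mult_ac)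
  have "hensel e (n + Suc m) = hensel e (n + m) - \<iota> (N (hensel e (n + m)))" by simp
  also have "\<dots> = hensel e (n + m) - \<iota> (p ^ n * (p ^ Suc m * d))" by (simp only: d(2) pe)
  also have "\<dots> = hensel e n + \<iota> (p ^ n * c) - \<iota> (p ^ n * (p ^ Suc m * d))" by (simp only: c(2))
  also have "\<dots> = hensel e n + \<iota> (p ^ n * (c - p ^ Suc m * d))"
    by (simp only: \<iota>_diff right_diff_distrib add_diff_eq)
  finally have "hensel e (n + Suc m) = hensel e n + \<iota> (p ^ n * (c - p ^ Suc m * d))" .
  moreover have "c - p ^ Suc m * d \<in> R" using c d by auto
  ultimately show ?case by blast
qed

lemma hensel_cauchy:
  assumes e: "idem p e"
  shows "cauchyq (hensel e)"
proof -
  have diff: "\<exists>c\<in>V p n. hensel e k - hensel e l = \<iota> c" if kl: "k \<ge> n" "l \<ge> n" for n k l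
  proof -
    obtain c where c: "c \<in> R" "hensel e k = hensel e n + \<iota> (p ^ n * c)"
      using hensel_shift[OF e, of n "k - n"] kl by auto
    obtain d where d: "d \<in> R" "hensel e l = hensel e n + \<iota> (p ^ n * d)"
      using hensel_shift[OF e, of n "l - n"] kl by auto
    have "p ^ n * (c - d) \<in> V p n" using c d by (intro V_mem) auto
    moreover have "hensel e k - hensel e l = \<iota> (p ^ n * (c - d))"
      unfolding c(2) d(2) by (simp add: right_diff_distrib \<iota>_diff)
    ultimately show ?thesis by blast
  qed
  have "c0 (hensel e k) - c0 (hensel e l) \<in> V p n \<and> c1 (hensel e k) - c1 (hensel e l) \<in> V p n \<and>
      c2 (hensel e k) - c2 (hensel e l) \<in> V p n \<and> c3 (hensel e k) - c3 (hensel e l) \<in> V p n"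
    if kl: "k \<ge> n" "l \<ge> n" for n k l
  proof -
    obtain c where c: "c \<in> V p n" "hensel e k - hensel e l = \<iota> c" using diff[OF kl] by blast
    show ?thesis using c(1) unfolding coords_diff[symmetric] c(2) by simp
  qed
  thus ?thesis unfolding cauchyq_def cauchy_def by blast
qed

text \<open>The limit of \<open>hensel e\<close> has norm 0, so it and its conjugate multiply to 0.
  Neither is 0, because the trace, twice the coordinate \<open>c0\<close>, stays 1 modulo
  \<open>p\<close>; this covers primes above 2 as well.\<close>

lemma split_zero_divisors:
  assumes e: "idem p e"
  obtains x y where "x \<in> carrier B" "y \<in> carrier B" "x \<noteq> \<zero>\<^bsub>B\<^esub>" "y \<noteq> \<zero>\<^bsub>B\<^esub>" "x \<otimes>\<^bsub>B\<^esub> y = \<zero>\<^bsub>B\<^esub>"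
proof -
  let ?\<xi> = "hensel e" and ?\<eta> = "\<lambda>k. cj (hensel e k)"
  have \<xi>: "cauchyq ?\<xi>" by (rule hensel_cauchy[OF e])
  have \<eta>: "cauchyq ?\<eta>" by (rule cauchyq_cj[OF \<xi>])
  have nz: "\<not> null p (\<lambda>k. c0 (hensel e k))"
  proof
    assume "null p (\<lambda>k. c0 (hensel e k))"
    then obtain k where "c0 (hensel e k) \<in> V p 1" unfolding null_def by blast
    hence "Tr (hensel e k) \<in> V p 1" unfolding Tr_def by (intro V_scale) auto
    hence "p \<preceq> Tr (hensel e k)" using V_mem_iff[of "Tr (hensel e k)" 1] hensel_props[OF e, of k] by simp
    hence "p \<preceq> Tr (hensel e k) - (Tr (hensel e k) - 1)" using hensel_props[OF e, of k] dv_diff by blast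
    thus False using p by simp
  qed
  have "null p (\<lambda>k. N (hensel e k))"
    unfolding null_def
  proof
    fix n
    have "N (hensel e k) \<in> V p n" if "k \<ge> n" for k
    proof (rule V_mono[of n "Suc k"])
      show "N (hensel e k) \<in> V p (Suc k)" using hensel_props[OF e, of k] by (intro V_mem) auto
    qed (use that in simp)
    thus "\<exists>M. \<forall>k\<ge>M. N (hensel e k) \<in> V p n" by blast
  qed
  hence "clq (\<lambda>k. ?\<xi> k * ?\<eta> k) = \<zero>\<^bsub>B\<^esub>"
    using clq_eq_0_iff[OF cauchyq_mult[OF \<xi> \<eta>]] by (simp add: mult_cj null_const_iff)
  hence "clq ?\<xi> \<otimes>\<^bsub>B\<^esub> clq ?\<eta> = \<zero>\<^bsub>B\<^esub>" using clq_mult[OF \<xi> \<eta>] by simp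
  moreover have "clq ?\<xi> \<noteq> \<zero>\<^bsub>B\<^esub>" "clq ?\<eta> \<noteq> \<zero>\<^bsub>B\<^esub>"
    using nz clq_eq_0_iff[OF \<xi>] clq_eq_0_iff[OF \<eta>] by simp_all
  ultimately show ?thesis using that clq_carrier \<xi> \<eta> by blast
qed

lemma division_ring_iff_ramified: "division_ring B \<longleftrightarrow> ramified p"
proof
  interpret B: Ring.ring B by (rule ring_B)
  show "division_ring B" if "ramified p"
  proof -
    have "\<zero>\<^bsub>B\<^esub> \<notin> Units B"
    proof
      assume "\<zero>\<^bsub>B\<^esub> \<in> Units B"
      then obtain y where "y \<in> carrier B" "y \<otimes>\<^bsub>B\<^esub> \<zero>\<^bsub>B\<^esub> = \<one>\<^bsub>B\<^esub>" unfolding Units_def by blast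
      thus False using one_neq_zero_B B.r_null by metis
    qed
    moreover have "Units B \<subseteq> carrier B" unfolding Units_def by blast
    ultimately show ?thesis unfolding division_ring_def using ring_B ramified_unit[OF that] by blast
  qed
  show "ramified p" if d: "division_ring B"
  proof (rule ccontr)
    assume nr: "\<not> ramified p"
    obtain y1 y2 where y: "nrm p y1" "nrm p y2" "rid y1 \<noteq> rid y2"
      by (rule maxi_cases[OF p]) (use nr in \<open>auto simp: ramified_def\<close>)
    obtain e where e: "idem p e" by (rule exists_idem[OF p y])
    obtain x z where xz: "x \<in> carrier B" "z \<in> carrier B" "x \<noteq> \<zero>\<^bsub>B\<^esub>" "z \<noteq> \<zero>\<^bsub>B\<^esub>" "x \<otimes>\<^bsub>B\<^esub> z = \<zero>\<^bsub>B\<^esub>"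
      by (rule split_zero_divisors[OF e])
    have "x \<in> Units B" using d xz unfolding division_ring_def by blast
    then obtain w where w: "w \<in> carrier B" "w \<otimes>\<^bsub>B\<^esub> x = \<one>\<^bsub>B\<^esub>" unfolding Units_def by blast
    have "z = (w \<otimes>\<^bsub>B\<^esub> x) \<otimes>\<^bsub>B\<^esub> z" using w xz by simp
    also have "\<dots> = w \<otimes>\<^bsub>B\<^esub> (x \<otimes>\<^bsub>B\<^esub> z)" using w xz by (intro B.m_assoc)
    also have "\<dots> = \<zero>\<^bsub>B\<^esub>" using w xz by simp
    finally show False using xz by simp
  qed
qed

end

section \<open>Lattices and maximal orders\<close>

locale number_quaternions = number_ring R + quaternions \<iota> a b i j
  for R :: "'k::field_char_0 set" and \<iota> :: "'k \<Rightarrow> 'q::ring_1" and a b :: 'k and i j :: 'q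
begin

definition spn :: "'q set \<Rightarrow> 'q set" where
  "spn S = {\<Sum>s\<in>S. \<iota> (c s) * s | c. \<forall>s\<in>S. c s \<in> R}"

definition submodule :: "'q set \<Rightarrow> bool" where
  "submodule L \<longleftrightarrow> 0 \<in> L \<and> (\<forall>x\<in>L. \<forall>y\<in>L. x + y \<in> L) \<and> (\<forall>c\<in>R. \<forall>x\<in>L. \<iota> c * x \<in> L)"

text \<open>Bounded denominators; \<open>big\<close> below expresses full rank. Over a principal
  ideal domain a submodule with both properties is a full lattice (\<open>full_latticeI\<close>), so
  right orders and conjugate orders are recognized without exhibiting generators.\<close>

definition bdd :: "'q set \<Rightarrow> bool" where
  "bdd L \<longleftrightarrow> (\<exists>d\<in>R. d \<noteq> 0 \<and> (\<forall>x\<in>L. d * c0 x \<in> R \<and> d * c1 x \<in> R \<and> d * c2 x \<in> R \<and> d * c3 x \<in> R))"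

definition big :: "'q set \<Rightarrow> bool" where
  "big L \<longleftrightarrow> (\<exists>c\<in>R. c \<noteq> 0 \<and> \<iota> c \<in> L \<and> \<iota> c * i \<in> L \<and> \<iota> c * j \<in> L \<and> \<iota> c * (i * j) \<in> L)"

lemma submodule_sum:
  assumes "submodule L" "\<And>s. s \<in> S \<Longrightarrow> f s \<in> L"
  shows "sum f S \<in> L"
  using assms(2) by (induction S rule: infinite_finite_induct) (use assms(1) in \<open>auto simp: submodule_def\<close>)

lemma spnI: "x = (\<Sum>s\<in>S. \<iota> (c s) * s) \<Longrightarrow> (\<And>s. s \<in> S \<Longrightarrow> c s \<in> R) \<Longrightarrow> x \<in> spn S"
  unfolding spn_def by blast

lemma spn_submodule: "submodule (spn S)"
  unfolding submodule_def
proof (intro conjI ballI)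
  show "0 \<in> spn S" by (rule spnI[of _ "\<lambda>_. 0"]) simp_all
next
  fix x y assume "x \<in> spn S" "y \<in> spn S"
  then obtain c d where cd: "x = (\<Sum>s\<in>S. \<iota> (c s) * s)" "y = (\<Sum>s\<in>S. \<iota> (d s) * s)" "\<forall>s\<in>S. c s \<in> R" "\<forall>s\<in>S. d s \<in> R"
    unfolding spn_def by blast
  have "x + y = (\<Sum>s\<in>S. \<iota> (c s + d s) * s)"
    unfolding cd(1,2) by (simp add: sum.distrib \<iota>_add distrib_right)
  thus "x + y \<in> spn S" by (rule spnI) (use cd in simp)
next
  fix r x assume r: "r \<in> R" "x \<in> spn S"
  then obtain c where c: "x = (\<Sum>s\<in>S. \<iota> (c s) * s)" "\<forall>s\<in>S. c s \<in> R" unfolding spn_def by blast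
  have "\<iota> r * x = (\<Sum>s\<in>S. \<iota> (r * c s) * s)"
    unfolding c(1) by (simp add: sum_distrib_left \<iota>_mult mult.assoc)
  thus "\<iota> r * x \<in> spn S" by (rule spnI) (use c r in simp)
qed

lemma spn_base:
  assumes "finite S" "s \<in> S"
  shows "s \<in> spn S"
proof -
  have "(\<Sum>t\<in>S. \<iota> (if t = s then 1 else 0) * t) = (\<Sum>t\<in>S. if t = s then t else 0)"
    by (rule sum.cong) auto
  also have "\<dots> = s" using assms by simp
  finally have "s = (\<Sum>t\<in>S. \<iota> (if t = s then 1 else 0) * t)" ..
  thus ?thesis by (rule spnI) simp
qed

lemma spn_subset: "submodule L \<Longrightarrow> S \<subseteq> L \<Longrightarrow> spn S \<subseteq> L"
proof
  fix x assume L: "submodule L" "S \<subseteq> L" and "x \<in> spn S"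
  then obtain c where c: "x = (\<Sum>s\<in>S. \<iota> (c s) * s)" "\<forall>s\<in>S. c s \<in> R" unfolding spn_def by blast
  show "x \<in> L" unfolding c(1) using L c(2) by (intro submodule_sum[OF L(1)]) (auto simp: submodule_def)
qed

lemma coords_sum:
  "c0 (sum f S) = (\<Sum>s\<in>S. c0 (f s))" "c1 (sum f S) = (\<Sum>s\<in>S. c1 (f s))"
  "c2 (sum f S) = (\<Sum>s\<in>S. c2 (f s))" "c3 (sum f S) = (\<Sum>s\<in>S. c3 (f s))"
  by (induction S rule: infinite_finite_induct) simp_all

lemma spn_bdd:
  assumes "finite S"
  shows "bdd ((\<lambda>x. v * x * u) ` spn S)"
proof -
  define T where "T = (\<Union>s\<in>S. {c0 (v * s * u), c1 (v * s * u), c2 (v * s * u), c3 (v * s * u)})"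
  obtain d where d: "d \<in> R" "d \<noteq> 0" "\<forall>x\<in>T. d * x \<in> R"
    using common_denominator[of T] assms unfolding T_def by blast
  have "d * c0 y \<in> R \<and> d * c1 y \<in> R \<and> d * c2 y \<in> R \<and> d * c3 y \<in> R" if "y \<in> (\<lambda>x. v * x * u) ` spn S" for y
  proof -
    from that obtain c where c: "y = v * (\<Sum>s\<in>S. \<iota> (c s) * s) * u" "\<forall>s\<in>S. c s \<in> R"
      unfolding spn_def by blast
    have "y = (\<Sum>s\<in>S. \<iota> (c s) * (v * s * u))"
    proof -
      have "v * (\<iota> r * s) * u = \<iota> r * (v * s * u)" for r s by (metis \<iota>_central mult.assoc)
      thus ?thesis unfolding c(1) by (simp add: sum_distrib_left sum_distrib_right)
    qed
    hence y: "c0 y = (\<Sum>s\<in>S. c s * c0 (v * s * u))" "c1 y = (\<Sum>s\<in>S. c s * c1 (v * s * u))"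
      "c2 y = (\<Sum>s\<in>S. c s * c2 (v * s * u))" "c3 y = (\<Sum>s\<in>S. c s * c3 (v * s * u))"
      by (simp_all add: coords_sum)
    have m: "d * (\<Sum>s\<in>S. c s * f s) \<in> R" if "\<And>s. s \<in> S \<Longrightarrow> f s \<in> T" for f
    proof -
      have "d * (\<Sum>s\<in>S. c s * f s) = (\<Sum>s\<in>S. c s * (d * f s))" by (simp add: sum_distrib_left mult_ac)
      also have "\<dots> \<in> R"
      proof (rule sum_mem)
        fix s assume "s \<in> S"
        hence "c s \<in> R" "d * f s \<in> R" using that c(2) d(3) by blast+
        thus "c s * (d * f s) \<in> R" by (rule mult_mem)
      qed
      finally show ?thesis .
    qed
    show ?thesis unfolding y by (intro conjI m) (auto simp: T_def)
  qed
  thus ?thesis unfolding bdd_def using d by blast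
qed

lemma module_scale: "Modules.module (\<lambda>c q. \<iota> c * q)"
  by unfold_locales (simp_all add: distrib_left distrib_right \<iota>_add \<iota>_mult mult.assoc)

lemma full_lattice_iff:
  "full_lattice \<iota> L \<longleftrightarrow> (\<exists>S. finite S \<and> L = spn S) \<and> Modules.module.span (\<lambda>c q. \<iota> c * q) L = UNIV"
  unfolding full_lattice_def spn_def carrier_eq ..

text \<open>The outer factors \<open>v\<close> and \<open>u\<close> provide for conjugate orders
  \<open>v H u\<close>, whose boundedness enters the maximality argument.\<close>

lemma full_lattice_props:
  assumes "full_lattice \<iota> L"
  shows "submodule L" "bdd ((\<lambda>x. v * x * u) ` L)" "big L"
proof -
  obtain S where S: "finite S" "L = spn S" using assms full_lattice_iff by blast
  show L: "submodule L" unfolding S by (rule spn_submodule)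
  show "bdd ((\<lambda>x. v * x * u) ` L)" unfolding S(2) by (rule spn_bdd[OF S(1)])
  interpret M: Modules.module "\<lambda>c q. \<iota> c * q" by (rule module_scale)
  have mult: "\<exists>d\<in>R. d \<noteq> 0 \<and> \<iota> d * q \<in> L" for q
  proof -
    have "q \<in> M.span L" using assms full_lattice_iff by simp
    then obtain T r where T: "finite T" "T \<subseteq> L" "q = (\<Sum>t\<in>T. \<iota> (r t) * t)"
      unfolding M.span_explicit by blast
    obtain d where d: "d \<in> R" "d \<noteq> 0" "\<forall>x\<in>r ` T. d * x \<in> R" using common_denominator[of "r ` T"] T by blast
    have "\<iota> d * q = (\<Sum>t\<in>T. \<iota> (d * r t) * t)"
      unfolding T(3) sum_distrib_left by (rule sum.cong[OF refl]) (simp only: \<iota>_mult mult.assoc)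
    also have "\<dots> \<in> L"
    proof (rule submodule_sum[OF L])
      fix t assume t: "t \<in> T"
      have "d * r t \<in> R" "t \<in> L" using t d(3) T(2) by blast+
      thus "\<iota> (d * r t) * t \<in> L" using L unfolding submodule_def by blast
    qed
    finally show ?thesis using d by blast
  qed
  obtain d0 where d0: "d0 \<in> R" "d0 \<noteq> 0" "\<iota> d0 * 1 \<in> L" using mult by blast
  obtain d1 where d1: "d1 \<in> R" "d1 \<noteq> 0" "\<iota> d1 * i \<in> L" using mult by blast
  obtain d2 where d2: "d2 \<in> R" "d2 \<noteq> 0" "\<iota> d2 * j \<in> L" using mult by blast
  obtain d3 where d3: "d3 \<in> R" "d3 \<noteq> 0" "\<iota> d3 * (i * j) \<in> L" using mult by blast
  define c where "c = d0 * d1 * d2 * d3"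
  have sc: "\<iota> c * x \<in> L" if "\<iota> d * x \<in> L" "c = e * d" "e \<in> R" for d e x
  proof -
    have eq: "\<iota> c * x = \<iota> e * (\<iota> d * x)" unfolding that(2) by (simp only: \<iota>_mult mult.assoc)
    have "\<iota> e * (\<iota> d * x) \<in> L" using L that(1,3) unfolding submodule_def by blast
    thus ?thesis unfolding eq .
  qed
  have "\<iota> c * 1 \<in> L" by (rule sc[OF d0(3), of "d1 * d2 * d3"]) (use d1 d2 d3 in \<open>auto simp: c_def\<close>)
  moreover have "\<iota> c * i \<in> L" by (rule sc[OF d1(3), of "d0 * d2 * d3"]) (use d0 d2 d3 in \<open>auto simp: c_def\<close>)
  moreover have "\<iota> c * j \<in> L" by (rule sc[OF d2(3), of "d0 * d1 * d3"]) (use d1 d0 d3 in \<open>auto simp: c_def\<close>)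
  moreover have "\<iota> c * (i * j) \<in> L" by (rule sc[OF d3(3), of "d0 * d1 * d2"]) (use d1 d2 d0 in \<open>auto simp: c_def\<close>)
  moreover have "c \<in> R" "c \<noteq> 0" unfolding c_def using d0 d1 d2 d3 by auto
  ultimately show "big L" unfolding big_def by auto
qed

text \<open>The values of \<open>f\<close> on \<open>L\<close>, cleared of denominators, form a
  principal ideal, and \<open>m\<close> is an element whose value generates it. Applied to the four
  coordinates in turn, this is reduction to triangular form.\<close>

lemma eliminate_coordinate:
  assumes L: "submodule L" and d: "d \<in> R" "d \<noteq> 0" "\<And>x. x \<in> L \<Longrightarrow> d * f x \<in> R"
    and f: "\<And>x y. f (x + y) = f x + f y" "\<And>c x. f (\<iota> c * x) = c * f x"
  obtains m where "m \<in> L" "\<forall>x\<in>L. \<exists>c\<in>R. f (x - \<iota> c * m) = 0"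
proof -
  have "\<exists>e\<in>R. (\<lambda>x. d * f x) ` L = (*) e ` R"
  proof (rule principal)
    show "(\<lambda>x. d * f x) ` L \<subseteq> R" using d by auto
    have "f 0 = 0" using f(2)[of 0 0] by simp
    thus "0 \<in> (\<lambda>x. d * f x) ` L" using L unfolding submodule_def by force
    show "x + y \<in> (\<lambda>x. d * f x) ` L" if xy: "x \<in> (\<lambda>x. d * f x) ` L" "y \<in> (\<lambda>x. d * f x) ` L" for x y
    proof -
      obtain u v where uv: "u \<in> L" "v \<in> L" "x = d * f u" "y = d * f v" using xy by auto
      hence "x + y = d * f (u + v)" by (simp add: f(1) distrib_left)
      moreover have "u + v \<in> L" using uv L unfolding submodule_def by blast
      ultimately show ?thesis by blast
    qed
    show "c * x \<in> (\<lambda>x. d * f x) ` L" if cx: "c \<in> R" "x \<in> (\<lambda>x. d * f x) ` L" for c x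
    proof -
      obtain u where u: "u \<in> L" "x = d * f u" using cx by auto
      hence "c * x = d * f (\<iota> c * u)" by (simp add: f(2) mult.left_commute)
      moreover have "\<iota> c * u \<in> L" using u L cx unfolding submodule_def by blast
      ultimately show ?thesis by blast
    qed
  qed
  then obtain e where e: "e \<in> R" "(\<lambda>x. d * f x) ` L = (*) e ` R" by blast
  have "e * 1 \<in> (*) e ` R" by blast
  then obtain m where m: "m \<in> L" "e = d * f m" unfolding e(2)[symmetric] by auto
  have "\<exists>c\<in>R. f (x - \<iota> c * m) = 0" if x: "x \<in> L" for x
  proof -
    have "d * f x \<in> (*) e ` R" using x unfolding e(2)[symmetric] by blast
    then obtain c where c: "c \<in> R" "d * f x = e * c" by blast
    have "f x = c * f m" using c(2) d(2) unfolding m(2) by simp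
    moreover have "f (x - \<iota> c * m) = f x - c * f m" using f(1)[of x "\<iota> (- c) * m"] f(2)[of "- c" m] by (simp add: \<iota>_minus)
    ultimately show ?thesis using c(1) by auto
  qed
  thus ?thesis using that m(1) by blast
qed

lemma submodule_kernel:
  assumes "submodule L" "\<And>x y. f (x + y) = f x + f y" "\<And>c x. f (\<iota> c * x) = c * f x"
  shows "submodule {x \<in> L. f x = (0 :: 'k)}"
proof -
  have "f 0 = 0" using assms(3)[of 0 0] by simp
  thus ?thesis using assms unfolding submodule_def by simp
qed

lemma submodule_diff: "submodule L \<Longrightarrow> x \<in> L \<Longrightarrow> y \<in> L \<Longrightarrow> c \<in> R \<Longrightarrow> x - \<iota> c * y \<in> L"
proof -
  assume "submodule L" "x \<in> L" "y \<in> L" "c \<in> R"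
  moreover from this have "\<iota> (- c) * y \<in> L" unfolding submodule_def by blast
  ultimately have "x + \<iota> (- c) * y \<in> L" unfolding submodule_def by blast
  thus ?thesis by (simp add: \<iota>_minus)
qed

lemma full_latticeI:
  assumes L: "submodule L" "bdd L" "big L"
  shows "full_lattice \<iota> L"
proof -
  obtain d where d: "d \<in> R" "d \<noteq> 0" "\<forall>x\<in>L. d * c0 x \<in> R \<and> d * c1 x \<in> R \<and> d * c2 x \<in> R \<and> d * c3 x \<in> R"
    using L(2) unfolding bdd_def by blast
  define L1 where "L1 = {x \<in> L. c0 x = 0}"
  define L2 where "L2 = {x \<in> L1. c1 x = 0}"
  define L3 where "L3 = {x \<in> L2. c2 x = 0}"
  have s1: "submodule L1" unfolding L1_def by (rule submodule_kernel[OF L(1)]) simp_all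
  have s2: "submodule L2" unfolding L2_def by (rule submodule_kernel[OF s1]) simp_all
  have s3: "submodule L3" unfolding L3_def by (rule submodule_kernel[OF s2]) simp_all
  have sub: "L1 \<subseteq> L" "L2 \<subseteq> L" "L3 \<subseteq> L" unfolding L1_def L2_def L3_def by auto
  have dR: "\<And>x. x \<in> L \<Longrightarrow> d * c0 x \<in> R" "\<And>x. x \<in> L1 \<Longrightarrow> d * c1 x \<in> R"
    "\<And>x. x \<in> L2 \<Longrightarrow> d * c2 x \<in> R" "\<And>x. x \<in> L3 \<Longrightarrow> d * c3 x \<in> R" using d(3) sub by blast+
  obtain m0 where m0: "m0 \<in> L" "\<forall>x\<in>L. \<exists>c\<in>R. c0 (x - \<iota> c * m0) = 0"
    by (rule eliminate_coordinate[OF L(1) d(1,2) dR(1) coords_add(1) coords_scale_left(1)])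
  obtain m1 where m1: "m1 \<in> L1" "\<forall>x\<in>L1. \<exists>c\<in>R. c1 (x - \<iota> c * m1) = 0"
    by (rule eliminate_coordinate[OF s1 d(1,2) dR(2) coords_add(2) coords_scale_left(2)])
  obtain m2 where m2: "m2 \<in> L2" "\<forall>x\<in>L2. \<exists>c\<in>R. c2 (x - \<iota> c * m2) = 0"
    by (rule eliminate_coordinate[OF s2 d(1,2) dR(3) coords_add(3) coords_scale_left(3)])
  obtain m3 where m3: "m3 \<in> L3" "\<forall>x\<in>L3. \<exists>c\<in>R. c3 (x - \<iota> c * m3) = 0"
    by (rule eliminate_coordinate[OF s3 d(1,2) dR(4) coords_add(4) coords_scale_left(4)])
  define S where "S = {m0, m1, m2, m3}"
  have S: "finite S" "S \<subseteq> L" unfolding S_def using m0 m1 m2 m3 sub by auto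
  have "x \<in> spn S" if x: "x \<in> L" for x
  proof -
    obtain r0 where r0: "r0 \<in> R" "c0 (x - \<iota> r0 * m0) = 0" using m0(2) x by blast
    define x1 where "x1 = x - \<iota> r0 * m0"
    have x1: "x1 \<in> L1" using submodule_diff[OF L(1) x m0(1) r0(1)] r0(2) unfolding L1_def x1_def by simp
    obtain r1 where r1: "r1 \<in> R" "c1 (x1 - \<iota> r1 * m1) = 0" using m1(2) x1 by blast
    define x2 where "x2 = x1 - \<iota> r1 * m1"
    have x2: "x2 \<in> L2" using submodule_diff[OF s1 x1 m1(1) r1(1)] r1(2) unfolding L2_def x2_def by simp
    obtain r2 where r2: "r2 \<in> R" "c2 (x2 - \<iota> r2 * m2) = 0" using m2(2) x2 by blast
    define x3 where "x3 = x2 - \<iota> r2 * m2"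
    have x3: "x3 \<in> L3" using submodule_diff[OF s2 x2 m2(1) r2(1)] r2(2) unfolding L3_def x3_def by simp
    obtain r3 where r3: "r3 \<in> R" "c3 (x3 - \<iota> r3 * m3) = 0" using m3(2) x3 by blast
    have "x3 - \<iota> r3 * m3 \<in> L3" by (rule submodule_diff[OF s3 x3 m3(1) r3(1)])
    hence "x3 - \<iota> r3 * m3 = 0" using r3(2) unfolding L3_def L2_def L1_def by (intro coords_eqI) auto
    hence "x = \<iota> r0 * m0 + \<iota> r1 * m1 + \<iota> r2 * m2 + \<iota> r3 * m3" unfolding x3_def x2_def x1_def by (simp add: algebra_simps)
    moreover have "m0 \<in> spn S" "m1 \<in> spn S" "m2 \<in> spn S" "m3 \<in> spn S" using spn_base[OF S(1)] unfolding S_def by auto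
    ultimately show ?thesis using spn_submodule[of S] r0 r1 r2 r3 unfolding submodule_def by simp
  qed
  hence "L = spn S" using spn_subset[OF L(1) S(2)] by blast
  moreover have "Modules.module.span (\<lambda>c q. \<iota> c * q) L = UNIV"
  proof -
    interpret M: Modules.module "\<lambda>c q. \<iota> c * q" by (rule module_scale)
    obtain c where c: "c \<in> R" "c \<noteq> 0" "\<iota> c \<in> L" "\<iota> c * i \<in> L" "\<iota> c * j \<in> L" "\<iota> c * (i * j) \<in> L"
      using L(3) unfolding big_def by blast
    have "q \<in> M.span L" for q
    proof -
      have "q = \<iota> (c0 q / c) * \<iota> c + \<iota> (c1 q / c) * (\<iota> c * i) + \<iota> (c2 q / c) * (\<iota> c * j) + \<iota> (c3 q / c) * (\<iota> c * (i * j))"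
        using c(2) by (intro coords_eqI) simp_all
      also have "\<dots> \<in> M.span L" using c by (intro M.span_add M.span_scale M.span_base)
      finally show ?thesis .
    qed
    thus ?thesis by blast
  qed
  ultimately show ?thesis using full_lattice_iff S(1) by blast
qed

lemma bdd_subset: "bdd L \<Longrightarrow> M \<subseteq> L \<Longrightarrow> bdd M"
  unfolding bdd_def by blast

lemma big_superset: "big L \<Longrightarrow> L \<subseteq> M \<Longrightarrow> big M"
  unfolding big_def by blast

lemma bdd_scale:
  assumes "c \<in> R" "c \<noteq> 0" "bdd ((\<lambda>x. \<iota> c * x) ` L)"
  shows "bdd L"
proof -
  obtain d where d: "d \<in> R" "d \<noteq> 0" "\<And>x. x \<in> L \<Longrightarrow> d * (c * c0 x) \<in> R \<and> d * (c * c1 x) \<in> R \<and> d * (c * c2 x) \<in> R \<and> d * (c * c3 x) \<in> R"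
    using assms(3) unfolding bdd_def by auto
  thus ?thesis unfolding bdd_def using assms(1,2) by (intro bexI[of _ "d * c"]) (auto simp: mult.assoc)
qed

lemma maximal_eq:
  assumes H: "maximal_order \<iota> H" and G: "submodule G" "bdd G" "H \<subseteq> G" "\<And>x y. x \<in> G \<Longrightarrow> y \<in> G \<Longrightarrow> x * y \<in> G"
  shows "G = H"
proof -
  have "full_lattice \<iota> H" "1 \<in> H" using H unfolding maximal_order_def quat_order_def by auto
  hence "big G" using full_lattice_props(3) big_superset G(3) by blast
  hence "quat_order \<iota> G" unfolding quat_order_def using full_latticeI G \<open>1 \<in> H\<close> by blast
  thus ?thesis using H G(3) unfolding maximal_order_def by blast
qed

text \<open>Maximality identifies the right order of \<open>L\<close>: it contains \<open>H\<close>,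
  and a nonzero scalar in \<open>L\<close> multiplies it into \<open>H\<close>, so it is an order.
  Class number 1 then gives \<open>x L = H\<close> with \<open>x\<close> invertible. For the
  normalizer property, \<open>H\<close> is compared with the order \<open>v H u\<close> that
  contains it.\<close>

lemma principal_order_of_maximal:
  assumes H: "maximal_order \<iota> H" and cn: "class_number \<iota> H = 1"
  shows "principal_order R \<iota> a b i j H"
proof -
  have HL: "full_lattice \<iota> H" and H1: "1 \<in> H" and Hm: "\<And>x y. x \<in> H \<Longrightarrow> y \<in> H \<Longrightarrow> x * y \<in> H"
    using H unfolding maximal_order_def quat_order_def by auto
  have Hs: "submodule H" by (rule full_lattice_props(1)[OF HL])
  have Hbig: "big H" by (rule full_lattice_props(3)[OF HL])
  have Hbdd: "bdd H" using full_lattice_props(2)[OF HL, of 1 1] by simp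
  have Hsc: "\<iota> c * x \<in> H" if "c \<in> R" "x \<in> H" for c x using Hs that unfolding submodule_def by blast
  have lat: "full_lattice \<iota> L \<and> right_order L = H"
    if L: "L \<subseteq> H" "\<And>x y. x \<in> L \<Longrightarrow> y \<in> L \<Longrightarrow> x + y \<in> L" "\<And>x h. x \<in> L \<Longrightarrow> h \<in> H \<Longrightarrow> x * h \<in> L"
      and c: "c \<in> R" "c \<noteq> 0" "\<iota> c \<in> L" for L c
  proof
    have Lsc: "\<iota> r * x \<in> L" if "r \<in> R" "x \<in> L" for r x
      using L(3)[OF that(2) Hsc[OF that(1) H1]] by (simp add: \<iota>_central)
    have "0 \<in> L" using Lsc[OF zero_mem c(3)] by simp
    hence Ls: "submodule L" unfolding submodule_def using L(2) Lsc by blast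
    have cH: "\<iota> c * h \<in> L" if "h \<in> H" for h using L(3)[OF c(3) that] .
    obtain r where r: "r \<in> R" "r \<noteq> 0" "\<iota> r \<in> H" "\<iota> r * i \<in> H" "\<iota> r * j \<in> H" "\<iota> r * (i * j) \<in> H"
      using Hbig unfolding big_def by blast
    have "big L" unfolding big_def
      using cH[OF r(3)] cH[OF r(4)] cH[OF r(5)] cH[OF r(6)] r(1,2) c(1,2)
      by (intro bexI[of _ "c * r"]) (auto simp: \<iota>_mult mult.assoc)
    thus "full_lattice \<iota> L" using full_latticeI Ls bdd_subset[OF Hbdd L(1)] by blast
    show "right_order L = H"
    proof (rule maximal_eq[OF H])
      show "submodule (right_order L)" unfolding submodule_def right_order_def
      proof (intro conjI ballI CollectI)
        fix r x l assume "r \<in> R" "x \<in> {x. \<forall>l\<in>L. l * x \<in> L}" "l \<in> L"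
        moreover have "l * (\<iota> r * x) = \<iota> r * (l * x)" by (metis \<iota>_central mult.assoc)
        ultimately show "l * (\<iota> r * x) \<in> L" using Lsc by simp
      qed (use L(2) \<open>0 \<in> L\<close> in \<open>auto simp: distrib_left\<close>)
      have "(\<lambda>x. \<iota> c * x) ` right_order L \<subseteq> H" using c(3) L(1) unfolding right_order_def by auto
      thus "bdd (right_order L)" using bdd_scale[OF c(1,2)] bdd_subset[OF Hbdd] by blast
      show "H \<subseteq> right_order L" unfolding right_order_def using L(3) by blast
      show "x * y \<in> right_order L" if "x \<in> right_order L" "y \<in> right_order L" for x y
        using that unfolding right_order_def by (auto simp flip: mult.assoc)
    qed
  qed
  show ?thesis
  proof
    show "1 \<in> H" by (rule H1)
    show "x + y \<in> H" if "x \<in> H" "y \<in> H" for x y using Hs that unfolding submodule_def by blast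
    show "x * y \<in> H" if "x \<in> H" "y \<in> H" for x y by (rule Hm[OF that])
    show "\<iota> c * x \<in> H" if "c \<in> R" "x \<in> H" for c x by (rule Hsc[OF that])
    show "\<exists>d\<in>R. d \<noteq> 0 \<and> (\<forall>x\<in>H. d * c0 x \<in> R \<and> d * c1 x \<in> R \<and> d * c2 x \<in> R \<and> d * c3 x \<in> R)"
      using Hbdd unfolding bdd_def .
    show "\<exists>c\<in>R. c \<noteq> 0 \<and> \<iota> c * i \<in> H \<and> \<iota> c * j \<in> H" using Hbig unfolding big_def by blast
    show "\<exists>u. L = (*) u ` H"
      if L: "L \<subseteq> H" "\<And>x y. x \<in> L \<Longrightarrow> y \<in> L \<Longrightarrow> x + y \<in> L" "\<And>x h. x \<in> L \<Longrightarrow> h \<in> H \<Longrightarrow> x * h \<in> L"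
        and c: "c \<in> R" "c \<noteq> 0" "\<iota> c \<in> L" for L c
    proof -
      let ?A = "lattices_with_right_order \<iota> H" and ?r = "lattice_equiv \<iota> H"
      have LA: "L \<in> ?A" using lat[OF L c] unfolding lattices_with_right_order_def by blast
      have HA: "H \<in> ?A"
        using lat[of H 1] Hs Hm H1 unfolding lattices_with_right_order_def submodule_def by simp
      have "card (?A // ?r) = 1" using cn unfolding class_number_def .
      then obtain K where K: "?A // ?r = {K}" by (auto simp: card_1_singleton_iff)
      have "?r `` {L} \<in> ?A // ?r" "?r `` {H} \<in> ?A // ?r" using LA HA by (auto intro: quotientI)
      hence "?r `` {L} = ?r `` {H}" using K by simp
      moreover have "(H, H) \<in> ?r"
      proof -
        have "1 \<in> Units (ring_of_type_algebra :: 'q ring)" unfolding Units_def ring_of_type_algebra_def by auto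
        moreover have "H = (\<lambda>l. 1 * l) ` H" by simp
        ultimately show ?thesis unfolding lattice_equiv_def using HA by blast
      qed
      ultimately have "(L, H) \<in> ?r" by blast
      then obtain x where x: "x \<in> Units (ring_of_type_algebra :: 'q ring)" "H = (\<lambda>l. x * l) ` L"
        unfolding lattice_equiv_def by blast
      then obtain u where u: "u * x = 1" unfolding Units_def ring_of_type_algebra_def by auto
      have "(*) u ` H = (\<lambda>l. u * (x * l)) ` L" unfolding x(2) by (simp add: image_image)
      also have "\<dots> = L" using u by (simp flip: mult.assoc)
      finally show ?thesis by blast
    qed
    show "v * h * u \<in> H" if uv: "u * v = 1" and conj: "\<And>h. h \<in> H \<Longrightarrow> u * h * v \<in> H" and h: "h \<in> H" for u v h
    proof -
      define w where "w = \<iota> (inverse (N u)) * cj u"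
      have w: "u * w = 1" "w * u = 1" unfolding w_def using N_nonzero_inverse[OF unit_N_nonzero[OF uv]] by auto
      have "(w * u) * v = w * (u * v)" by (rule mult.assoc)
      hence "v = w" using w(2) uv by simp
      hence vu: "v * u = 1" using w by simp
      define G where "G = {x. u * x * v \<in> H}"
      have "G = H"
      proof (rule maximal_eq[OF H])
        show "submodule G" unfolding submodule_def G_def
        proof (intro conjI ballI CollectI)
          fix r x assume "r \<in> R" "x \<in> {x. u * x * v \<in> H}"
          moreover have "u * (\<iota> r * x) * v = \<iota> r * (u * x * v)" by (metis \<iota>_central mult.assoc)
          ultimately show "u * (\<iota> r * x) * v \<in> H" using Hsc by simp
        qed (use Hs in \<open>auto simp: submodule_def distrib_left distrib_right\<close>)
        have "G \<subseteq> (\<lambda>x. v * x * u) ` H"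
        proof
          fix x assume "x \<in> G"
          moreover have "v * (u * x * v) * u = (v * u) * x * (v * u)" by (simp only: mult.assoc)
          hence "x = v * (u * x * v) * u" using vu by simp
          ultimately show "x \<in> (\<lambda>x. v * x * u) ` H" unfolding G_def by blast
        qed
        thus "bdd G" using full_lattice_props(2)[OF HL] bdd_subset by blast
        show "H \<subseteq> G" unfolding G_def using conj by blast
        show "x * y \<in> G" if "x \<in> G" "y \<in> G" for x y
        proof -
          have "(u * x * v) * (u * y * v) = u * x * (v * u) * y * v" by (simp only: mult.assoc)
          hence "u * (x * y) * v = (u * x * v) * (u * y * v)" using vu by (simp add: mult.assoc)
          thus ?thesis using that Hm unfolding G_def by simp
        qed
      qed
      moreover have "u * (v * h * u) * v = (u * v) * h * (u * v)" by (simp only: mult.assoc)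
      hence "v * h * u \<in> G" unfolding G_def using uv h by simp
      ultimately show ?thesis by simp
    qed
  qed
qed

end

section \<open>The divisor sum\<close>

context number_ring
begin

lemma algebraic_int_iff: "algebraic_int x \<longleftrightarrow> x \<in> R"
  using R_eq by simp

lemma pri_subset_R: "d \<in> R \<Longrightarrow> pri d \<subseteq> R"
  unfolding pri_def using dv_mem by blast

lemma PIdl_eq_pri: "PIdl\<^bsub>ring_of_integers\<^esub> d = pri d"
  unfolding cgenideal_def carrier_eq pri_def dv_def by (auto simp: mult.commute)

lemma ideal_norm_eq_weight:
  assumes "d \<in> R"
  shows "ideal_norm (pri d) = weight (pri d)"
proof -
  have "pri d +>\<^bsub>ring_of_integers\<^esub> x = {y\<in>R. y - x \<in> pri d}" if x: "x \<in> R" for x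
  proof (intro equalityI subsetI)
    fix y assume "y \<in> pri d +>\<^bsub>ring_of_integers\<^esub> x"
    then obtain z where "z \<in> pri d" "y = z + x" unfolding a_r_coset_def' by auto
    thus "y \<in> {y\<in>R. y - x \<in> pri d}" using pri_subset_R[OF assms] x by auto
  next
    fix y assume "y \<in> {y\<in>R. y - x \<in> pri d}"
    thus "y \<in> pri d +>\<^bsub>ring_of_integers\<^esub> x"
      unfolding a_r_coset_def' by (auto intro!: bexI[of _ "y - x"])
  qed
  hence "carrier (ring_of_integers Quot pri d) = (\<lambda>x. {y\<in>R. y - x \<in> pri d}) ` R"
    unfolding FactRing_def A_RCOSETS_def' carrier_eq by auto
  thus ?thesis unfolding ideal_norm_def Coset.order_def weight_def by simp
qed

end

section \<open>Divisibility of ideals as divisibility of generators\<close>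

locale number_pid = number_ring R for R :: "'k::field_char_0 set" +
  assumes principal_domain: "principal_domain (ring_of_integers :: 'k ring)"
begin

interpretation P: principal_domain "ring_of_integers :: 'k ring" by (rule principal_domain)

lemma ideal_pri: "d \<in> R \<Longrightarrow> ideal (pri d) ring_of_integers"
  using P.cgenideal_ideal[of d] unfolding PIdl_eq_pri carrier_eq .

lemma ideal_is_pri: "ideal I ring_of_integers \<Longrightarrow> \<exists>d\<in>R. I = pri d"
  using P.exists_gen[of I] unfolding PIdl_eq_pri carrier_eq .

lemma pri_divides_iff:
  assumes "c \<in> R" "d \<in> R"
  shows "pri c divides\<^bsub>ideals_set ring_of_integers\<^esub> pri d \<longleftrightarrow> c \<preceq> d"
proof
  assume "pri c divides\<^bsub>ideals_set ring_of_integers\<^esub> pri d"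
  then obtain K where K: "ideal K ring_of_integers" "pri d = ideal_prod ring_of_integers (pri c) K"
    unfolding factor_def ideals_set_def by auto
  obtain e where e: "e \<in> R" "K = pri e" using ideal_is_pri[OF K(1)] by blast
  have "pri d = pri (c * e)" using K(2) ideal_prod_pri[OF assms(1) e(1)] unfolding e(2) by simp
  hence "c * e \<preceq> d" using pri_eq_iff by blast
  moreover have "c \<preceq> c * e" using e(1) by simp
  ultimately show "c \<preceq> d" using dv_trans by blast
next
  assume "c \<preceq> d"
  then obtain e where e: "e \<in> R" "d = c * e" by (auto simp: dv_def)
  have "pri d = ideal_prod ring_of_integers (pri c) (pri e)" unfolding e(2) by (rule ideal_prod_pri[OF assms(1) e(1), symmetric])
  thus "pri c divides\<^bsub>ideals_set ring_of_integers\<^esub> pri d"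
    unfolding factor_def ideals_set_def using ideal_pri[OF e(1)] by auto
qed

lemma primeideal_pri_iff:
  assumes "d \<in> R"
  shows "finite_prime (pri d) \<longleftrightarrow> prm d"
proof
  assume fp: "finite_prime (pri d)"
  hence pi: "primeideal (pri d) ring_of_integers" and ne: "pri d \<noteq> {0}" unfolding finite_prime_def by auto
  have "d \<noteq> 0"
  proof
    assume "d = 0"
    hence "pri d = {0}" unfolding pri_def dv_def by auto
    thus False using ne by simp
  qed
  moreover have "\<not> d \<preceq> 1"
  proof
    assume "d \<preceq> 1"
    hence "d \<preceq> x" if "x \<in> R" for x using dv_trans dv_one that by blast
    hence "R = pri d" using pri_subset_R[OF assms] unfolding pri_def by blast
    thus False using primeideal.I_notcarr[OF pi] carrier_eq by simp
  qed
  moreover have "d \<preceq> x \<or> d \<preceq> y" if "x \<in> R" "y \<in> R" "d \<preceq> x * y" for x y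
    using primeideal.I_prime[OF pi, of x y] that unfolding pri_def carrier_eq by simp
  ultimately show "prm d" unfolding prm_def using assms by blast
next
  assume d: "prm d"
  have "primeideal (pri d) ring_of_integers"
  proof (rule primeidealI)
    show "ideal (pri d) ring_of_integers" by (rule ideal_pri[OF assms])
    show "cring (ring_of_integers :: 'k ring)" by (rule P.is_cring)
    have "1 \<notin> pri d" using d unfolding pri_def by simp
    thus "carrier ring_of_integers \<noteq> pri d" using one_mem unfolding carrier_eq by metis
    show "x \<in> pri d \<or> y \<in> pri d"
      if "x \<in> carrier ring_of_integers" "y \<in> carrier ring_of_integers" "x \<otimes>\<^bsub>ring_of_integers\<^esub> y \<in> pri d" for x y
      using that prm_dv_mult[OF d] unfolding carrier_eq pri_def by simp
  qed
  moreover have "d \<in> pri d" unfolding pri_def by simp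
  hence "pri d \<noteq> {0}" using d prm_nz by blast
  ultimately show "finite_prime (pri d)" unfolding finite_prime_def by blast
qed

lemma finite_prime_iff: "finite_prime I \<longleftrightarrow> (\<exists>p. prm p \<and> I = pri p)"
proof
  assume I: "finite_prime I"
  hence "ideal I ring_of_integers" unfolding finite_prime_def primeideal_def by blast
  then obtain d where "d \<in> R" "I = pri d" using ideal_is_pri by blast
  thus "\<exists>p. prm p \<and> I = pri p" using I primeideal_pri_iff by blast
qed (use primeideal_pri_iff prm_mem in blast)

text \<open>Only the set of primes dividing the product is recorded, because
  \<open>divisor_sum\<close> consults nothing else about the discriminant.\<close>

lemma finprod_primes:
  assumes "finite A" "\<forall>I\<in>A. \<exists>p. prm p \<and> I = pri p"
  shows "\<exists>e\<in>R. (\<Otimes>\<^bsub>ideals_set ring_of_integers\<^esub> I\<in>A. I) = pri e \<and> (\<forall>p. prm p \<longrightarrow> (p \<preceq> e \<longleftrightarrow> pri p \<in> A))"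
  using assms
proof (induction A rule: finite_induct)
  case empty
  interpret M: Group.comm_monoid "ideals_set ring_of_integers :: 'k set ring" by (rule P.ideals_set_is_comm_monoid)
  have "pri 1 = R" unfolding pri_def using dv_one by auto
  hence "(\<Otimes>\<^bsub>ideals_set ring_of_integers\<^esub> I\<in>{}. I) = pri 1"
    unfolding M.finprod_empty by (simp add: ideals_set_def algebraic_int_iff)
  thus ?case by (intro bexI[of _ 1]) auto
next
  case (insert I A)
  interpret M: Group.comm_monoid "ideals_set ring_of_integers :: 'k set ring" by (rule P.ideals_set_is_comm_monoid)
  obtain e where e: "e \<in> R" "(\<Otimes>\<^bsub>ideals_set ring_of_integers\<^esub> I\<in>A. I) = pri e"
    "\<And>p. prm p \<Longrightarrow> p \<preceq> e \<longleftrightarrow> pri p \<in> A" using insert by auto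
  obtain r where r: "prm r" "I = pri r" using insert.prems by blast
  have car: "J \<in> carrier (ideals_set ring_of_integers)" if J: "J \<in> insert I A" for J
  proof -
    obtain p where "prm p" "J = pri p" using insert.prems J by blast
    thus ?thesis using ideal_pri[OF prm_mem] by (simp add: ideals_set_def)
  qed
  have "(\<Otimes>\<^bsub>ideals_set ring_of_integers\<^esub> I\<in>insert I A. I) =
      I \<otimes>\<^bsub>ideals_set ring_of_integers\<^esub> (\<Otimes>\<^bsub>ideals_set ring_of_integers\<^esub> I\<in>A. I)"
    using insert car by (intro M.finprod_insert) auto
  also have "\<dots> = ideal_prod ring_of_integers (pri r) (pri e)" unfolding r(2) e(2) by (simp add: ideals_set_def)
  also have "\<dots> = pri (r * e)" using r e by (intro ideal_prod_pri) auto
  finally have 1: "(\<Otimes>\<^bsub>ideals_set ring_of_integers\<^esub> I\<in>insert I A. I) = pri (r * e)" .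
  have 2: "p \<preceq> r * e \<longleftrightarrow> pri p \<in> insert I A" if p: "prm p" for p
  proof -
    have "p \<preceq> r \<longleftrightarrow> pri p = pri r" using prm_dv_prm[OF p r(1)] pri_eq_iff by blast
    thus ?thesis using prm_dv_mult[OF p prm_mem[OF r(1)] e(1)] e(3)[OF p] r(2) by blast
  qed
  show ?case using 1 2 r e by (intro bexI[of _ "r * e"]) auto
qed

end

section \<open>The discriminant and the divisor sum of the order\<close>

locale class_number_one_order = positive_order R \<iota> a b i j H + number_pid R
  for R :: "'k::field_char_0 set" and \<iota> :: "'k \<Rightarrow> 'q::ring_1" and a b :: 'k and i j :: 'q and H :: "'q set"
begin

lemma ramified_primes_eq: "ramified_primes a b = {pri p | p. prm p \<and> ramified p}"
proof -
  have "division_ring (base_change (completion (pri p)) (completion_embedding (pri p)) a b) \<longleftrightarrow> ramified p"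
    if "prm p" for p
  proof -
    interpret local_order R \<iota> a b i j H p by unfold_locales (rule that)
    show ?thesis by (rule division_ring_iff_ramified)
  qed
  thus ?thesis unfolding ramified_primes_def finite_prime_iff by blast
qed

text \<open>\<open>finprod\<close> over an infinite set is the unit ideal by default; only
  finiteness makes the discriminant see its primes.\<close>

lemma finite_ramified_primes: "finite (ramified_primes a b)"
proof -
  obtain D where D: "D \<in> R" "D \<noteq> 0" "\<forall>p. prm p \<and> (\<exists>y. nrm p y \<and> maxi p = {rid y}) \<longrightarrow> p \<preceq> D"
    by (rule ramified_bound)
  have "ramified_primes a b \<subseteq> {(*) p ` R | p. prm p \<and> p \<preceq> D}"
    unfolding ramified_primes_eq ramified_def pri_def multiples_eq using D(3) by blast
  thus ?thesis using finite_prime_ideals_dividing[OF D(1,2)] finite_subset by blast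
qed

lemma discriminant_eq:
  obtains e where "e \<in> R" "discriminant a b = pri e" "\<And>p. prm p \<Longrightarrow> p \<preceq> e \<longleftrightarrow> ramified p"
proof -
  obtain e where e: "e \<in> R" "(\<Otimes>\<^bsub>ideals_set ring_of_integers\<^esub> I\<in>ramified_primes a b. I) = pri e"
    "\<forall>p. prm p \<longrightarrow> (p \<preceq> e \<longleftrightarrow> pri p \<in> ramified_primes a b)"
    using finprod_primes[OF finite_ramified_primes] ramified_primes_eq by blast
  have "pri p \<in> ramified_primes a b \<longleftrightarrow> ramified p" if "prm p" for p
    unfolding ramified_primes_eq using that ramified_assoc pri_eq_iff by blast
  thus ?thesis using that e unfolding discriminant_def by blast
qed

lemma divisor_sum_eq:
  assumes "\<alpha> \<in> R"
  shows "divisor_sum (discriminant a b) \<alpha> = sum weight (divisors ramified \<alpha>)"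
proof -
  obtain e where e: "e \<in> R" "discriminant a b = pri e" "\<And>p. prm p \<Longrightarrow> p \<preceq> e \<longleftrightarrow> ramified p"
    using discriminant_eq by blast
  have cond: "(\<forall>P. finite_prime P \<and> P divides\<^bsub>ideals_set ring_of_integers\<^esub> (discriminant a b) \<longrightarrow>
      \<not> P divides\<^bsub>ideals_set ring_of_integers\<^esub> (pri d)) \<longleftrightarrow> (\<forall>p. prm p \<and> ramified p \<longrightarrow> \<not> p \<preceq> d)"
    if d: "d \<in> R" for d
  proof -
    have "pri p divides\<^bsub>ideals_set ring_of_integers\<^esub> (discriminant a b) \<longleftrightarrow> ramified p"
      "pri p divides\<^bsub>ideals_set ring_of_integers\<^esub> (pri d) \<longleftrightarrow> p \<preceq> d" if p: "prm p" for p
      using pri_divides_iff[OF prm_mem[OF p] e(1)] pri_divides_iff[OF prm_mem[OF p] d] e(3)[OF p] unfolding e(2) by simp_all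
    thus ?thesis unfolding finite_prime_iff by blast
  qed
  have "{I. (\<exists>\<delta> \<in> carrier ring_of_integers. I = PIdl\<^bsub>ring_of_integers\<^esub> \<delta>) \<and>
                I divides\<^bsub>ideals_set ring_of_integers\<^esub> (PIdl\<^bsub>ring_of_integers\<^esub> \<alpha>) \<and>
                (\<forall>P. finite_prime P \<and> P divides\<^bsub>ideals_set ring_of_integers\<^esub> (discriminant a b) \<longrightarrow>
                     \<not> P divides\<^bsub>ideals_set ring_of_integers\<^esub> I)} = divisors ramified \<alpha>"
    unfolding PIdl_eq_pri carrier_eq divisors_def using cond pri_divides_iff[OF _ assms] by blast
  moreover have "ideal_norm I = weight I" if "I \<in> divisors ramified \<alpha>" for I
    using that ideal_norm_eq_weight unfolding divisors_def by blast
  ultimately show ?thesis unfolding divisor_sum_def by (simp cong: sum.cong)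
qed

text \<open>Without real embeddings every unit would be a square, so \<open>- 1\<close> would be a \<open>2\<^sup>n\<close>-th power for
  all \<open>n\<close>, which is impossible in a finite residue field of odd characteristic.\<close>

lemma not_totally_positive_0: "\<not> totally_positive (0 :: 'k)"
proof
  assume tp0: "totally_positive (0 :: 'k)"
  have "\<sigma> 0 = 0" if "\<sigma> \<in> real_embeddings" for \<sigma> :: "'k \<Rightarrow> real"
  proof -
    have "\<sigma> (x + y) = \<sigma> x + \<sigma> y" for x y
      using that unfolding real_embeddings_def ring_hom_def ring_of_type_algebra_def by auto
    from this[of 0 0] show ?thesis by simp
  qed
  hence no: "(real_embeddings :: ('k \<Rightarrow> real) set) = {}" using tp0 unfolding totally_positive_def by force
  hence sq: "\<exists>v\<in>R. v \<preceq> 1 \<and> u = v\<^sup>2" if "u \<in> R" "u \<preceq> 1" for u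
    using unit_square[OF that] unfolding totally_positive_def by blast
  have root: "\<exists>x\<in>R. x \<preceq> 1 \<and> x ^ 2 ^ n = - 1" for n
  proof (induction n)
    case 0
    show ?case by (rule bexI[of _ "- 1"]) (auto intro: dvI[of "- 1"])
  next
    case (Suc n)
    then obtain x where x: "x \<in> R" "x \<preceq> 1" "x ^ 2 ^ n = - 1" by blast
    then obtain v where v: "v \<in> R" "v \<preceq> 1" "x = v\<^sup>2" using sq by blast
    have "v ^ 2 ^ Suc n = x ^ 2 ^ n" unfolding v(3) by (simp add: power_mult[symmetric])
    thus ?case using x v by auto
  qed
  then obtain x where x: "\<And>n. x n \<in> R" "\<And>n. x n ^ 2 ^ n = - 1" by metis
  have "\<not> (3 :: 'k) \<preceq> 1"
  proof
    assume "(3 :: 'k) \<preceq> 1"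
    then obtain c where c: "c \<in> R" "1 = 3 * c" by (auto simp: dv_def)
    hence "c = 1 / 3" by (simp add: eq_divide_eq mult.commute)
    hence "c \<in> \<rat>" by (rule ssubst) simp
    moreover have "algebraic_int c" using c R_eq by simp
    ultimately have "c \<in> \<int>" by (intro rational_algebraic_int_is_int)
    then obtain m where "c = of_int m" by (auto elim: Ints_cases)
    hence "of_int 1 = (of_int (3 * m) :: 'k)" using c(2) by simp
    hence "1 = 3 * m" by (simp only: of_int_eq_iff)
    thus False by presburger
  qed
  \<comment> \<open>A prime above 3 does not divide 2, so 1 and -1 are different modulo
    \<open>p\<close>.\<close>
  then obtain p where p: "prm p" "p \<preceq> 3" using exists_prime_divisor[of 3] by auto
  have np: "\<not> p \<preceq> 2"
  proof
    assume "p \<preceq> 2"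
    hence "p \<preceq> 3 - 2" using p(2) dv_diff by blast
    thus False using p(1) by simp
  qed
  \<comment> \<open>For k < l the power \<open>x k ^ 2 ^ l\<close> is 1, whereas
    \<open>x l ^ 2 ^ l\<close> is -1, so equal residues would make \<open>p\<close> divide
    2.\<close>
  have "residue p (x k) \<noteq> residue p (x l)" if kl: "k < l" for k l
  proof
    assume "residue p (x k) = residue p (x l)"
    hence "p \<preceq> x k - x l" using residue_eq_iff[OF x(1) x(1)] by blast
    moreover have "x k - x l \<preceq> x k ^ n - x l ^ n" for n
    proof (induction n)
      case (Suc n)
      have "x k ^ Suc n - x l ^ Suc n = x k * (x k ^ n - x l ^ n) + x l ^ n * (x k - x l)"
        by (simp add: algebra_simps)
      also have "x k - x l \<preceq> \<dots>" by (rule dv_add[OF dv_mult[OF Suc x(1)] dv_mult[OF dv_refl]]) (simp add: x(1))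
      finally show ?case .
    qed simp
    ultimately have "p \<preceq> x k ^ 2 ^ l - x l ^ 2 ^ l" using dv_trans by blast
    moreover have "x k ^ 2 ^ l = 1"
    proof -
      obtain m where m: "l = k + Suc m" using kl less_iff_Suc_add by auto
      have "x k ^ 2 ^ l = (x k ^ 2 ^ k) ^ 2 ^ Suc m" unfolding m by (simp only: power_add power_mult)
      also have "\<dots> = (- 1) ^ 2 ^ Suc m" unfolding x(2) ..
      finally show ?thesis by simp
    qed
    ultimately show False using x(2)[of l] np by simp
  qed
  hence "inj (\<lambda>k. residue p (x k))" by (intro injI) (metis linorder_neqE_nat)
  moreover have "range (\<lambda>k. residue p (x k)) \<subseteq> residues p" unfolding residues_def using x(1) by blast
  ultimately show False using finite_residues[OF p(1)] finite_subset range_inj_infinite by blast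
qed

end

theorem theorem2p16:
  fixes \<iota> :: "'k::field_char_0 \<Rightarrow> 'q::ring_1"
    and a b \<alpha> :: 'k
    and i j :: 'q
    and H :: "'q set"
  assumes "number_field TYPE('k)"
    and "totally_real TYPE('k)"
    and "narrow_class_number_one TYPE('k)"
    and "quaternion_algebra \<iota> a b i j"
    and "definite a b"
    and "maximal_order \<iota> H"
    and "class_number \<iota> H = 1"
    and "\<alpha> \<in> carrier ring_of_integers"
    and "totally_positive \<alpha>"
  shows "repr_number \<iota> i j H \<alpha> =
           card (norm_one_elements \<iota> i j H) * divisor_sum (discriminant a b) \<alpha>"
proof -
  define R where "R = {x :: 'k. algebraic_int x}"
  have pd: "principal_domain (ring_of_integers :: 'k ring)"
    using assms(3) unfolding narrow_class_number_one_def by blast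
  interpret pid_in_field R unfolding R_def by (rule number_field_pid[OF assms(1) pd])
  interpret number_quaternions R \<iota> a b i j
    by unfold_locales (use R_def assms in auto)
  interpret principal_order R \<iota> a b i j H by (rule principal_order_of_maximal[OF assms(6,7)])
  have units: "u \<in> Units (ring_of_integers :: 'k ring) \<longleftrightarrow> u \<in> R \<and> dv u 1" for u
    unfolding Units_def carrier_eq dv_def by (auto simp: mult.commute)
  have sq: "\<exists>v\<in>R. dv v 1 \<and> u = v\<^sup>2" if "u \<in> R" "dv u 1" "totally_positive u" for u
    using assms(3) that units unfolding narrow_class_number_one_def by blast
  have "positive_order R \<iota> a b i j H"
    by (rule positive_order.intro[OF principal_order_axioms positive_order_axioms.intro[OF assms(5) sq]])
  moreover have "number_pid R"
    by (rule number_pid.intro[OF number_ring_axioms number_pid_axioms.intro[OF pd]])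
  ultimately interpret class_number_one_order R \<iota> a b i j H
    by (rule class_number_one_order.intro)
  have \<alpha>: "\<alpha> \<in> R" using assms(8) by (simp add: R_def)
  \<comment> \<open>Total positivity quantifies over the real embeddings and would hold vacuously
    for 0 if there were none; the lemma excludes this.\<close>
  have \<alpha>0: "\<alpha> \<noteq> 0" using assms(9) not_totally_positive_0 by blast
  have "repr_number \<iota> i j H \<alpha> = card {q \<in> H. N q = 1} * card (ids \<alpha>)"
    unfolding repr_number_def nrd_eq by (rule card_norm_eq[OF \<alpha>0])
  also have "card (ids \<alpha>) = divisor_sum (discriminant a b) \<alpha>"
    unfolding divisor_sum_eq[OF \<alpha>] by (rule card_ids[OF \<alpha> \<alpha>0 assms(9)])
  finally show ?thesis unfolding norm_one_elements_def nrd_eq .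
qed

end
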